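(* Let $J\subseteq\Delta^d_n$ be an M-convex set. Let $\mathrm{B}\subseteq V_J/W_J$ be the closed unit ball with respect to some norm and let $X=\mathrm{B}\setminus(\underline{\mathrm{Dr}}_J\cap\partial\mathrm{B})$. Then the space $\underline{\mathrm{L}}_J$ is homeomorphic to $X$.
   Context: $\Delta^d_n=\{\alpha\in\mathbb{Z}^n_{\ge0}:\sum\alpha_i=d\}$; $J$ is M-convex if nonempty and for all $\alpha,\beta\in J$, $i$ with $\alpha_i<\beta_i$ there is $j$ with $\alpha_j>\beta_j$ and $\alpha+e_i-e_j,\beta-e_i+e_j\in J$; $\delta^\pm_J$ are coordinatewise max/min over $J$. A nonzero homogeneous polynomial $f$ of degree $d$ with nonnegative coefficients is Lorentzian if its support is M-convex and $\partial^\alpha f$ has Hessian with at most one positive eigenvalue for all $\alpha\in\Delta^{d-2}_n$. $\mathrm{L}_J$ is the set of Lorentzian polynomials with support $J$, and $\underline{\mathrm{L}}_J$ is its quotient by the action of $\mathbb{R}^n_{>0}$ given by $(c.f)(x)=f(c_1x_1,\dots,c_nx_n)$, with quotient topology. A list $b_1,\dots,b_k\ge0$ is $0$-null if all are zero or the maximum is attained at least twice, and $\infty$-null if all are zero, the maximum is attained at least twice, or at least three are nonzero. For $q\in\{0,\infty\}$, a strong $\mathbb{T}_q$-representation of $J$ is $\rho\colon\Delta^d_n\to\mathbb{R}_{\ge0}$ with support $J$ such that for all $2\le s\le d$, $\alpha\in\Delta^{d-s}_n$ with $\delta^-_J\le\alpha$, $i_0\le\dots\le i_s$, $j_2\le\dots\le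 j_s$ with $\alpha+\sum e_{i_m}+\sum e_{j_m}\le\delta^+_J$, the numbers $\rho(\alpha+\sum_{m\ne k}e_{i_m})\rho(\alpha+e_{i_k}+e_{j_2}+\dots+e_{j_s})$, $k=0,\dots,s$, are $q$-null. $V_J=\{(\log\rho(\alpha))_{\alpha\in J}:\rho$ a strong $\mathbb{T}_\infty$-representation$\}$, a linear subspace of $\mathbb{R}^J$; $W_J$ is the span of the vectors $(\alpha_i)_{\alpha\in J}$, $i\in[n]$. The reduced Dressian $\underline{\mathrm{Dr}}_J\subseteq V_J/W_J$ is the image of the set of strong $\mathbb{T}_0$-representations under coordinatewise logarithm and the quotient map. *)

theory Defs
  imports
    "HOL-Library.Poly_Mapping"
    "HOL-Analysis.Function_Topology"
    "Jordan_Normal_Form.Char_Poly"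
begin

text \<open>Conventions: the index set \<open>[n]\<close> is \<^term>\<open>{..<n}\<close>; exponent vectors
  are finitely supported functions \<^typ>\<open>nat \<Rightarrow>\<^sub>0 nat\<close> (zero outside \<open>[n]\<close>); polynomials are
  finitely supported functions from exponent vectors to the reals, multiplied by the convolution
  product of \<^theory>\<open>HOL-Library.Poly_Mapping\<close>.\<close>

type_synonym expo = "nat \<Rightarrow>\<^sub>0 nat"
type_synonym rpoly = "expo \<Rightarrow>\<^sub>0 real"

abbreviation unit_expo :: "nat \<Rightarrow> expo" where
  "unit_expo i \<equiv> Poly_Mapping.single i 1"

definition simplex_pts :: "nat \<Rightarrow> nat \<Rightarrow> expo set" where
  "simplex_pts n d =
     {\<alpha>. Poly_Mapping.keys \<alpha> \<subseteq> {..<n} \<and> (\<Sum>i<n. Poly_Mapping.lookup \<alpha> i) = d}"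

text \<open>The truncated subtractions below are exact: \<open>\<alpha>\<^sub>j > \<beta>\<^sub>j\<close> gives \<open>\<alpha>\<^sub>j \<ge> 1\<close>, and
  \<open>\<alpha>\<^sub>i < \<beta>\<^sub>i\<close> gives \<open>\<beta>\<^sub>i \<ge> 1\<close>.\<close>

definition M_convex :: "expo set \<Rightarrow> bool" where
  "M_convex J \<longleftrightarrow> J \<noteq> {} \<and>
     (\<forall>\<alpha>\<in>J. \<forall>\<beta>\<in>J. \<forall>i. Poly_Mapping.lookup \<alpha> i < Poly_Mapping.lookup \<beta> i \<longrightarrow>
        (\<exists>j. Poly_Mapping.lookup \<alpha> j > Poly_Mapping.lookup \<beta> j \<and>
             \<alpha> + unit_expo i - unit_expo j \<in> J \<and> \<beta> - unit_expo i + unit_expo j \<in> J))"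

definition delta_plus :: "expo set \<Rightarrow> nat \<Rightarrow> nat" where
  "delta_plus J i = Max ((\<lambda>\<alpha>. Poly_Mapping.lookup \<alpha> i) ` J)"

definition delta_minus :: "expo set \<Rightarrow> nat \<Rightarrow> nat" where
  "delta_minus J i = Min ((\<lambda>\<alpha>. Poly_Mapping.lookup \<alpha> i) ` J)"

text \<open>Terms with \<open>\<beta>\<^sub>i = 0\<close>, where the subtraction truncates, have coefficient \<open>0\<close>.\<close>

definition partial_deriv :: "nat \<Rightarrow> rpoly \<Rightarrow> rpoly" where
  "partial_deriv i f = (\<Sum>\<beta>\<in>Poly_Mapping.keys f.
     Poly_Mapping.single (\<beta> - unit_expo i)
       (real (Poly_Mapping.lookup \<beta> i) * Poly_Mapping.lookup f \<beta>))"

definition partial_derivs :: "nat \<Rightarrow> expo \<Rightarrow> rpoly \<Rightarrow> rpoly" where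
  "partial_derivs n \<alpha> f =
     foldr (\<lambda>i g. (partial_deriv i ^^ Poly_Mapping.lookup \<alpha> i) g) [0..<n] f"

text \<open>Only used for quadratic forms, whose second partial derivatives are constants;
  a constant is read off as the coefficient of the exponent vector \<open>0\<close>.\<close>

definition hessian :: "nat \<Rightarrow> rpoly \<Rightarrow> real mat" where
  "hessian n f = mat n n
     (\<lambda>(i, j). Poly_Mapping.lookup (partial_deriv i (partial_deriv j f)) 0)"

text \<open>Eigenvalues are counted with multiplicity.\<close>

definition at_most_one_pos_eigenvalue :: "real mat \<Rightarrow> bool" where
  "at_most_one_pos_eigenvalue A \<longleftrightarrow>
     (\<Sum>r\<in>{r. eigenvalue A r \<and> r > 0}. Polynomial.order r (char_poly A)) \<le> 1"

definition lorentzian :: "nat \<Rightarrow> nat \<Rightarrow> rpoly \<Rightarrow> bool" where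
  "lorentzian n d f \<longleftrightarrow>
     f \<noteq> 0 \<and> Poly_Mapping.keys f \<subseteq> simplex_pts n d \<and> (\<forall>\<alpha>. 0 \<le> Poly_Mapping.lookup f \<alpha>) \<and>
     M_convex (Poly_Mapping.keys f) \<and>
     (2 \<le> d \<longrightarrow> (\<forall>\<alpha>\<in>simplex_pts n (d - 2).
        at_most_one_pos_eigenvalue (hessian n (partial_derivs n \<alpha> f))))"

definition lorentzian_set :: "nat \<Rightarrow> nat \<Rightarrow> expo set \<Rightarrow> rpoly set" where
  "lorentzian_set n d J = {f. lorentzian n d f \<and> Poly_Mapping.keys f = J}"

text \<open>The substitution \<open>f(c\<^sub>0 x\<^sub>0, c\<^sub>1 x\<^sub>1, \<dots>)\<close>; \<^term>\<open>Poly_Mapping.single (unit_expo i) (c i)\<close> is the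
  monomial \<open>c\<^sub>i x\<^sub>i\<close>.\<close>

definition rescale :: "(nat \<Rightarrow> real) \<Rightarrow> rpoly \<Rightarrow> rpoly" where
  "rescale c f = (\<Sum>\<alpha>\<in>Poly_Mapping.keys f.
     Poly_Mapping.single 0 (Poly_Mapping.lookup f \<alpha>) *
     (\<Prod>i\<in>Poly_Mapping.keys \<alpha>. Poly_Mapping.single (unit_expo i) (c i) ^ Poly_Mapping.lookup \<alpha> i))"

definition rescale_rel :: "nat \<Rightarrow> nat \<Rightarrow> expo set \<Rightarrow> (rpoly \<times> rpoly) set" where
  "rescale_rel n d J = {(f, g). f \<in> lorentzian_set n d J \<and> g \<in> lorentzian_set n d J \<and>
     (\<exists>c. (\<forall>i<n. 0 < c i) \<and> g = rescale c f)}"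

definition quotient_topology :: "'a topology \<Rightarrow> ('a \<times> 'a) set \<Rightarrow> 'a set topology" where
  "quotient_topology X r = topology (\<lambda>U. U \<subseteq> topspace X // r \<and>
     openin X {x \<in> topspace X. r `` {x} \<in> U})"

lemma openin_quotient_topology:
  "openin (quotient_topology X r) U \<longleftrightarrow>
     U \<subseteq> topspace X // r \<and> openin X {x \<in> topspace X. r `` {x} \<in> U}"
proof -
  have "istopology (\<lambda>U. U \<subseteq> topspace X // r \<and> openin X {x \<in> topspace X. r `` {x} \<in> U})"
    unfolding istopology_def
  proof (intro conjI allI impI)
    fix S T
    assume "S \<subseteq> topspace X // r \<and> openin X {x \<in> topspace X. r `` {x} \<in> S}"
      and "T \<subseteq> topspace X // r \<and> openin X {x \<in> topspace X. r `` {x} \<in> T}"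
    moreover have "{x \<in> topspace X. r `` {x} \<in> S \<inter> T} =
        {x \<in> topspace X. r `` {x} \<in> S} \<inter> {x \<in> topspace X. r `` {x} \<in> T}" by auto
    ultimately show "S \<inter> T \<subseteq> topspace X // r"
      and "openin X {x \<in> topspace X. r `` {x} \<in> S \<inter> T}" by auto
  next
    fix \<K>
    assume *: "\<forall>K\<in>\<K>. K \<subseteq> topspace X // r \<and> openin X {x \<in> topspace X. r `` {x} \<in> K}"
    then show "\<Union>\<K> \<subseteq> topspace X // r" by blast
    have "{x \<in> topspace X. r `` {x} \<in> \<Union>\<K>} = (\<Union>K\<in>\<K>. {x \<in> topspace X. r `` {x} \<in> K})" by auto
    with * show "openin X {x \<in> topspace X. r `` {x} \<in> \<Union>\<K>}" by auto
  qed
  then show ?thesis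
    unfolding quotient_topology_def by (simp add: topology_inverse')
qed

lemma topspace_quotient_topology: "topspace (quotient_topology X r) = topspace X // r"
proof -
  have "{x \<in> topspace X. r `` {x} \<in> topspace X // r} = topspace X"
    by (auto simp: quotient_def)
  then have "openin (quotient_topology X r) (topspace X // r)"
    by (simp add: openin_quotient_topology)
  then show ?thesis
    by (meson openin_quotient_topology openin_subset openin_topspace subset_antisym)
qed

text \<open>Polynomials with support \<^term>\<open>J\<close> carry the Euclidean topology of their coefficients.\<close>

definition lorentzian_top :: "nat \<Rightarrow> nat \<Rightarrow> expo set \<Rightarrow> rpoly topology" where
  "lorentzian_top n d J = pullback_topology (lorentzian_set n d J) Poly_Mapping.lookup euclidean"

definition reduced_lorentzian :: "nat \<Rightarrow> nat \<Rightarrow> expo set \<Rightarrow> rpoly set topology" where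
  "reduced_lorentzian n d J = quotient_topology (lorentzian_top n d J) (rescale_rel n d J)"

definition max_attained_twice :: "real list \<Rightarrow> bool" where
  "max_attained_twice b \<longleftrightarrow>
     (\<exists>k<length b. \<exists>l<length b. k \<noteq> l \<and> b ! k = b ! l \<and> (\<forall>m<length b. b ! m \<le> b ! k))"

definition null_zero :: "real list \<Rightarrow> bool" where
  "null_zero b \<longleftrightarrow> (\<forall>k<length b. b ! k = 0) \<or> max_attained_twice b"

definition null_infty :: "real list \<Rightarrow> bool" where
  "null_infty b \<longleftrightarrow> (\<forall>k<length b. b ! k = 0) \<or> max_attained_twice b \<or>
     3 \<le> card {k. k < length b \<and> b ! k \<noteq> 0}"

text \<open>The parameter \<^term>\<open>null\<close> is \<^const>\<open>null_zero\<close> for \<open>q = 0\<close> and \<^const>\<open>null_infty\<close>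
  for \<open>q = \<infinity>\<close>. Values of \<^term>\<open>\<rho>\<close> outside \<^term>\<open>simplex_pts n d\<close> are irrelevant.\<close>

definition strong_rep ::
    "(real list \<Rightarrow> bool) \<Rightarrow> nat \<Rightarrow> nat \<Rightarrow> expo set \<Rightarrow> (expo \<Rightarrow> real) \<Rightarrow> bool" where
  "strong_rep null n d J \<rho> \<longleftrightarrow>
     (\<forall>\<alpha>\<in>simplex_pts n d. 0 \<le> \<rho> \<alpha>) \<and>
     {\<alpha> \<in> simplex_pts n d. \<rho> \<alpha> \<noteq> 0} = J \<and>
     (\<forall>s \<alpha> i j.
        2 \<le> s \<and> s \<le> d \<and> \<alpha> \<in> simplex_pts n (d - s) \<and>
        (\<forall>k<n. delta_minus J k \<le> Poly_Mapping.lookup \<alpha> k) \<and>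
        i ` {0..s} \<subseteq> {..<n} \<and> mono_on {0..s} i \<and>
        j ` {2..s} \<subseteq> {..<n} \<and> mono_on {2..s} j \<and>
        (\<forall>k<n. Poly_Mapping.lookup
           (\<alpha> + (\<Sum>m=0..s. unit_expo (i m)) + (\<Sum>m=2..s. unit_expo (j m))) k \<le> delta_plus J k)
        \<longrightarrow> null (map (\<lambda>k. \<rho> (\<alpha> + (\<Sum>m\<in>{0..s} - {k}. unit_expo (i m))) *
                            \<rho> (\<alpha> + unit_expo (i k) + (\<Sum>m=2..s. unit_expo (j m)))) [0..<Suc s]))"

text \<open>\<open>\<real>\<^sup>J\<close> is represented by the real functions on exponent vectors that vanish outside
  \<^term>\<open>J\<close>.\<close>

definition log_vec :: "expo set \<Rightarrow> (expo \<Rightarrow> real) \<Rightarrow> expo \<Rightarrow> real" where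
  "log_vec J \<rho> = (\<lambda>\<alpha>. if \<alpha> \<in> J then ln (\<rho> \<alpha>) else 0)"

definition V_space :: "nat \<Rightarrow> nat \<Rightarrow> expo set \<Rightarrow> (expo \<Rightarrow> real) set" where
  "V_space n d J = log_vec J ` {\<rho>. strong_rep null_infty n d J \<rho>}"

definition W_space :: "nat \<Rightarrow> expo set \<Rightarrow> (expo \<Rightarrow> real) set" where
  "W_space n J = {w. \<exists>c :: nat \<Rightarrow> real. w =
     (\<lambda>\<alpha>. if \<alpha> \<in> J then \<Sum>i<n. c i * real (Poly_Mapping.lookup \<alpha> i) else 0)}"

text \<open>Points of the quotient \<open>V / W\<close> are the classes of \<open>VW_rel\<close>, i.e. the cosets of \<open>W\<close> in \<open>V\<close>;
  \<open>VW_norm\<close> and \<open>closed_unit_ball\<close> refer to functions on these cosets, whose vector space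
  operations are given on representatives.\<close>

definition VW_rel :: "nat \<Rightarrow> nat \<Rightarrow> expo set \<Rightarrow> ((expo \<Rightarrow> real) \<times> (expo \<Rightarrow> real)) set" where
  "VW_rel n d J = {(v, w). v \<in> V_space n d J \<and> w \<in> V_space n d J \<and>
     (\<lambda>\<alpha>. v \<alpha> - w \<alpha>) \<in> W_space n J}"

abbreviation VW_class :: "nat \<Rightarrow> nat \<Rightarrow> expo set \<Rightarrow> (expo \<Rightarrow> real) \<Rightarrow> (expo \<Rightarrow> real) set" where
  "VW_class n d J v \<equiv> VW_rel n d J `` {v}"

definition VW_top :: "nat \<Rightarrow> nat \<Rightarrow> expo set \<Rightarrow> (expo \<Rightarrow> real) set topology" where
  "VW_top n d J = quotient_topology (top_of_set (V_space n d J)) (VW_rel n d J)"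

definition VW_norm :: "nat \<Rightarrow> nat \<Rightarrow> expo set \<Rightarrow> ((expo \<Rightarrow> real) set \<Rightarrow> real) \<Rightarrow> bool" where
  "VW_norm n d J N \<longleftrightarrow>
     (\<forall>v\<in>V_space n d J. 0 \<le> N (VW_class n d J v)) \<and>
     (\<forall>v\<in>V_space n d J. N (VW_class n d J v) = 0 \<longleftrightarrow>
        VW_class n d J v = VW_class n d J (\<lambda>_. 0)) \<and>
     (\<forall>v\<in>V_space n d J. \<forall>a.
        N (VW_class n d J (\<lambda>\<alpha>. a * v \<alpha>)) = \<bar>a\<bar> * N (VW_class n d J v)) \<and>
     (\<forall>v\<in>V_space n d J. \<forall>w\<in>V_space n d J.
        N (VW_class n d J (\<lambda>\<alpha>. v \<alpha> + w \<alpha>)) \<le> N (VW_class n d J v) + N (VW_class n d J w))"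

definition closed_unit_ball ::
    "nat \<Rightarrow> nat \<Rightarrow> expo set \<Rightarrow> ((expo \<Rightarrow> real) set \<Rightarrow> real) \<Rightarrow> (expo \<Rightarrow> real) set set" where
  "closed_unit_ball n d J N = {C \<in> V_space n d J // VW_rel n d J. N C \<le> 1}"

definition reduced_dressian :: "nat \<Rightarrow> nat \<Rightarrow> expo set \<Rightarrow> (expo \<Rightarrow> real) set set" where
  "reduced_dressian n d J =
     (\<lambda>\<rho>. VW_class n d J (log_vec J \<rho>)) ` {\<rho>. strong_rep null_zero n d J \<rho>}"

end

theory Submission
  imports Defs "HOL-Analysis.Generalised_Binomial_Theorem" "HOL-Library.Function_Algebras"
begin

text \<open>
  In logarithmic coordinates (with coefficients multiplied by \<open>\<alpha>!\<close>) the Lorentzian polynomials with support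
  \<open>J\<close> form a closed subset \<open>S\<close> of \<open>V\<^sub>J\<close>, invariant under \<open>W\<^sub>J\<close>. A nonnegative symmetric matrix \<open>H\<close> has at most
  one positive eigenvalue iff \<open>H\<^sub>i\<^sub>j = v\<^sub>i v\<^sub>j (1 - Q\<^sub>i\<^sub>j)\<close> with \<open>Q\<close> positive semidefinite and \<open>\<bar>Q\<^sub>i\<^sub>j\<bar> \<le> 1\<close>. The
  binomial series of \<open>1 - (1 - q)\<^sup>p\<close>, \<open>0 < p < 1\<close>, has positive coefficients, so by Schur's product theorem this
  class is closed under \<open>H\<^sub>i\<^sub>j \<mapsto> H\<^sub>i\<^sub>j\<^sup>p\<close>; if in addition the diagonal is decreased, the result is an interior
  point. Hence \<open>S\<close> is star-shaped about \<open>- \<Sum>\<alpha>\<^sub>k\<^sup>2\<close> in the strong sense that open segments from the centre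
  consist of interior points of \<open>S\<close> in \<open>V\<^sub>J\<close>. Its recession directions are exactly the logarithms of strong
  representations over \<open>\<T>\<^sub>0\<close>: such functions have Lorentzian Hessians (an ultrametric is of negative type), and
  conversely the inequality \<open>H\<^sub>i\<^sub>j H\<^sub>k\<^sub>l \<le> 16 max (H\<^sub>i\<^sub>k H\<^sub>j\<^sub>l) (H\<^sub>i\<^sub>l H\<^sub>j\<^sub>k)\<close> along a ray dequantises to the tropical
  one. A radial rescaling by the gauge of \<open>S\<close> therefore maps \<open>S / W\<^sub>J\<close> onto the unit ball without the Dressian
  part of its boundary.
\<close>

section \<open>Positive semidefinite forms\<close>

text \<open>Powers alone do not reach the interior: a positive matrix of rank one keeps rank one
  under entrywise powers and lies on the boundary, and this is why the centre must also shrink the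
  diagonal. A second obstacle is an off-diagonal zero entry. It makes two rows proportional, and an
  arbitrary small perturbation can destroy this. The three-term relations of V_J restore it: inside
  V_J a nearby matrix is determined, up to scaling of rows and columns, by its restriction to a set
  of indices whose mutual entries are nonzero, so definiteness is needed only there. The same
  relations become linear equations after taking logarithms, because the zero pattern depends on J
  alone. The strong relations of all lengths have to be reduced to three-term ones, since an
  eigenvalue condition sees a single Hessian at a time. The constant 16 is 4 times 4: the kernel 1 -
  Q behaves like a squared distance and satisfies the triangle inequality up to the factor 2, which
  is used twice.\<close>

definition bform :: "'a set \<Rightarrow> ('a \<Rightarrow> 'a \<Rightarrow> real) \<Rightarrow> ('a \<Rightarrow> real) \<Rightarrow> ('a \<Rightarrow> real) \<Rightarrow> real" where
  "bform I H x y = (\<Sum>i\<in>I. \<Sum>j\<in>I. H i j * x i * y j)"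

abbreviation qform :: "'a set \<Rightarrow> ('a \<Rightarrow> 'a \<Rightarrow> real) \<Rightarrow> ('a \<Rightarrow> real) \<Rightarrow> real" where
  "qform I H x \<equiv> bform I H x x"

definition sym_on :: "'a set \<Rightarrow> ('a \<Rightarrow> 'a \<Rightarrow> real) \<Rightarrow> bool" where
  "sym_on I H \<longleftrightarrow> (\<forall>i\<in>I. \<forall>j\<in>I. H i j = H j i)"

definition psd :: "'a set \<Rightarrow> ('a \<Rightarrow> 'a \<Rightarrow> real) \<Rightarrow> bool" where
  "psd I H \<longleftrightarrow> sym_on I H \<and> (\<forall>x. 0 \<le> qform I H x)"

definition unit_fun :: "'a \<Rightarrow> 'a \<Rightarrow> real" where
  "unit_fun a = (\<lambda>i. if i = a then 1 else 0)"

lemma psdI: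
  "(\<And>i j. i \<in> I \<Longrightarrow> j \<in> I \<Longrightarrow> H i j = H j i) \<Longrightarrow> (\<And>x. 0 \<le> qform I H x) \<Longrightarrow> psd I H"
  unfolding psd_def sym_on_def by blast

lemma psd_sym: "psd I H \<Longrightarrow> i \<in> I \<Longrightarrow> j \<in> I \<Longrightarrow> H i j = H j i"
  unfolding psd_def sym_on_def by blast

lemma psd_nonneg: "psd I H \<Longrightarrow> 0 \<le> qform I H x"
  unfolding psd_def by blast

lemma bform_cong:
  assumes "\<And>i j. i \<in> I \<Longrightarrow> j \<in> I \<Longrightarrow> H i j = H' i j" "\<And>i. i \<in> I \<Longrightarrow> x i = x' i" "\<And>i. i \<in> I \<Longrightarrow> y i = y' i"
  shows "bform I H x y = bform I H' x' y'"
  unfolding bform_def by (intro sum.cong refl) (simp add: assms)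

lemma psd_cong:
  assumes "\<And>i j. i \<in> I \<Longrightarrow> j \<in> I \<Longrightarrow> H i j = H' i j"
  shows "psd I H \<longleftrightarrow> psd I H'"
proof -
  have "qform I H x = qform I H' x" for x by (intro bform_cong assms) auto
  then show ?thesis unfolding psd_def sym_on_def by (simp add: assms)
qed

lemma bform_add_left: "bform I H (\<lambda>i. x i + y i) z = bform I H x z + bform I H y z"
  unfolding bform_def by (simp add: algebra_simps sum.distrib)

lemma bform_add_right: "bform I H z (\<lambda>i. x i + y i) = bform I H z x + bform I H z y"
  unfolding bform_def by (simp add: algebra_simps sum.distrib)

lemma bform_scale_left: "bform I H (\<lambda>i. c * x i) z = c * bform I H x z"
  unfolding bform_def by (simp add: algebra_simps sum_distrib_left)

lemma bform_scale_right: "bform I H z (\<lambda>i. c * x i) = c * bform I H z x"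
  unfolding bform_def by (simp add: algebra_simps sum_distrib_left)

lemma bform_commute: "sym_on I H \<Longrightarrow> bform I H x y = bform I H y x"
  unfolding bform_def sym_on_def
  by (subst sum.swap, intro sum.cong refl) (simp add: mult.commute mult.left_commute)

lemma bform_add_form: "bform I (\<lambda>i j. H i j + G i j) x y = bform I H x y + bform I G x y"
  unfolding bform_def by (simp add: algebra_simps sum.distrib)

lemma bform_diff_form: "bform I (\<lambda>i j. H i j - G i j) x y = bform I H x y - bform I G x y"
  unfolding bform_def by (simp add: algebra_simps sum_subtractf)

lemma bform_scale_form: "bform I (\<lambda>i j. c * H i j) x y = c * bform I H x y"
  unfolding bform_def by (simp add: algebra_simps sum_distrib_left)

lemma bform_rank_one: "bform I (\<lambda>i j. v i * w j) x y = (\<Sum>i\<in>I. v i * x i) * (\<Sum>j\<in>I. w j * y j)"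
  unfolding bform_def sum_product by (intro sum.cong refl) (simp add: ac_simps)

lemma bform_sum_form: "bform I (\<lambda>i j. \<Sum>k\<in>K. F k i j) x y = (\<Sum>k\<in>K. bform I (F k) x y)"
  by (induction K rule: infinite_finite_induct)
     (simp_all add: bform_add_form, simp_all add: bform_def)

lemma bform_diag:
  assumes "finite I"
  shows "bform I (\<lambda>i j. if i = j then D i else 0) x y = (\<Sum>i\<in>I. D i * x i * y i)"
  unfolding bform_def
proof (intro sum.cong refl)
  fix i assume "i \<in> I"
  have "(\<Sum>j\<in>I. (if i = j then D i else 0) * x i * y j) = (\<Sum>j\<in>I. if i = j then D i * x i * y j else 0)"
    by (intro sum.cong) auto
  then show "(\<Sum>j\<in>I. (if i = j then D i else 0) * x i * y j) = D i * x i * y i"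
    using \<open>i \<in> I\<close> assms by simp
qed

lemma bform_unit_left: "finite I \<Longrightarrow> a \<in> I \<Longrightarrow> bform I H (unit_fun a) y = (\<Sum>j\<in>I. H a j * y j)"
proof -
  assume I: "finite I" "a \<in> I"
  have "bform I H (unit_fun a) y = (\<Sum>i\<in>I. if i = a then \<Sum>j\<in>I. H i j * y j else 0)"
    unfolding bform_def unit_fun_def by (intro sum.cong) auto
  then show ?thesis using I by simp
qed

lemma sum_unit_fun: "finite I \<Longrightarrow> b \<in> I \<Longrightarrow> (\<Sum>j\<in>I. h j * unit_fun b j) = h b"
proof -
  assume I: "finite I" "b \<in> I"
  have "(\<Sum>j\<in>I. h j * unit_fun b j) = (\<Sum>j\<in>I. if j = b then h j else 0)"
    unfolding unit_fun_def by (intro sum.cong) auto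
  then show ?thesis using I by simp
qed

lemma bform_unit: "finite I \<Longrightarrow> a \<in> I \<Longrightarrow> b \<in> I \<Longrightarrow> bform I H (unit_fun a) (unit_fun b) = H a b"
  by (simp add: bform_unit_left sum_unit_fun)

lemma qform_line:
  assumes "sym_on I H"
  shows "qform I H (\<lambda>i. x i + t * y i) = qform I H x + 2 * t * bform I H x y + t\<^sup>2 * qform I H y"
  using bform_commute[OF assms, of x y]
  by (simp add: bform_add_left bform_add_right bform_scale_left bform_scale_right
      algebra_simps power2_eq_square)

text \<open>Near 0 a quadratic term cannot compensate a linear one. At \<open>t = - b / k\<close>
  with positive \<open>k > c\<close> the expression is negative unless \<open>b = 0\<close>.\<close>

lemma nonneg_line_imp_zero:
  fixes b c :: real
  assumes "\<And>t. 0 \<le> 2 * t * b + t\<^sup>2 * c"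
  shows "b = 0"
proof (rule ccontr)
  assume b: "b \<noteq> 0"
  define k where "k = \<bar>c\<bar> + 1"
  have k: "k > 0" "c < k" unfolding k_def by auto
  have "0 \<le> 2 * (- b / k) * b + (- b / k)\<^sup>2 * c" by (rule assms)
  also have "\<dots> = (b\<^sup>2 / k) * (c / k - 2)"
    using k by (simp add: field_simps power2_eq_square)
  also have "\<dots> < 0"
  proof -
    have "b\<^sup>2 / k > 0" using b k by simp
    moreover have "c / k - 2 < 0" using k by (simp add: field_simps)
    ultimately show ?thesis by (rule mult_pos_neg)
  qed
  finally show False by simp
qed

text \<open>An isotropic vector minimises a semidefinite form, so the first variation vanishes
  there: isotropic vectors lie in the radical.\<close>

lemma psd_zero_bform:
  assumes "psd I H" "qform I H x = 0"
  shows "bform I H x y = 0"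
proof (rule nonneg_line_imp_zero)
  fix t
  have "0 \<le> qform I H (\<lambda>i. x i + t * y i)" using assms(1) unfolding psd_def by blast
  then show "0 \<le> 2 * t * bform I H x y + t\<^sup>2 * qform I H y"
    using assms by (simp add: qform_line psd_def)
qed

lemma psd_diag_nonneg: "finite I \<Longrightarrow> psd I H \<Longrightarrow> a \<in> I \<Longrightarrow> 0 \<le> H a a"
  by (metis bform_unit psd_def)

text \<open>Cholesky factorisation, by eliminating one index at a time.\<close>

lemma psd_gram:
  assumes "finite I" "psd I H"
  shows "\<exists>(m::nat) B. \<forall>i\<in>I. \<forall>j\<in>I. H i j = (\<Sum>l<m. B l i * B l j)"
  using assms
proof (induction I arbitrary: H rule: finite_induct)
  case empty
  then show ?case by simp
next
  case (insert a I)
  let ?I = "insert a I"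
  have sym: "sym_on ?I H" using insert.prems unfolding psd_def by blast
  have fin: "finite ?I" using insert by simp
  have d: "0 \<le> H a a" using psd_diag_nonneg[OF fin insert.prems] by blast
  \<comment> \<open>The Schur complement of the entry at \<open>a\<close>. If that entry is 0, the
    convention for division makes \<open>G\<close> equal to \<open>H\<close>.\<close>
  define G where "G i j = H i j - H a i * H a j / H a a" for i j
  have q: "0 \<le> qform I G x" for x
  proof (cases "H a a = 0")
    case True
    have "qform ?I H (\<lambda>i. if i = a then 0 else x i) = qform I H x"
      using insert.hyps unfolding bform_def by (auto intro!: sum.cong)
    moreover have "qform I G x = qform I H x"
      using True by (intro bform_cong) (auto simp: G_def)
    ultimately show ?thesis using insert.prems unfolding psd_def by metis
  next
    case False
    define s where "s = (\<Sum>j\<in>I. H a j * x j)"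
    define y where "y = (\<lambda>i. if i = a then 0 else x i)"
    have qy: "qform ?I H y = qform I H x"
      using insert.hyps unfolding bform_def y_def by (auto intro!: sum.cong)
    have "bform ?I H y (unit_fun a) = (\<Sum>j\<in>?I. H a j * y j)"
      using bform_commute[OF sym] bform_unit_left[OF fin, of a H y] by simp
    also have "\<dots> = s" using insert.hyps unfolding s_def y_def by (auto intro!: sum.cong)
    \<comment> \<open>The added multiple of \<open>unit_fun a\<close> minimises the form in
      coordinate \<open>a\<close>; the minimum is the value of the Schur complement.\<close>
    finally have "qform ?I H (\<lambda>i. y i + (- s / H a a) * unit_fun a i) = qform I H x - s\<^sup>2 / H a a"
      using False qy fin
      by (subst qform_line[OF sym]) (simp add: bform_unit field_simps power2_eq_square)
    moreover have "qform I G x = qform I H x - s\<^sup>2 / H a a"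
    proof -
      have "qform I G x = qform I H x - qform I (\<lambda>i j. (H a i / H a a) * H a j) x"
        unfolding bform_diff_form[symmetric] by (intro bform_cong) (auto simp: G_def)
      also have "qform I (\<lambda>i j. (H a i / H a a) * H a j) x = s\<^sup>2 / H a a"
        unfolding bform_rank_one s_def
        by (simp add: sum_divide_distrib[symmetric] power2_eq_square)
      finally show ?thesis .
    qed
    ultimately show ?thesis using insert.prems unfolding psd_def by metis
  qed
  have "G i j = G j i" if "i \<in> I" "j \<in> I" for i j
  proof -
    have "H i j = H j i" using sym that unfolding sym_on_def by blast
    then show ?thesis by (simp add: G_def mult.commute)
  qed
  then have "psd I G" unfolding psd_def sym_on_def using q by blast
  from insert.IH[OF this] obtain m :: nat and B where
    B: "\<And>i j. i \<in> I \<Longrightarrow> j \<in> I \<Longrightarrow> G i j = (\<Sum>l<m. B l i * B l j)" by metis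
  \<comment> \<open>If the pivot is 0, the unit vector at \<open>a\<close> is isotropic and the
    whole row vanishes, so the rank-one term with denominator 0 is still correct.\<close>
  have row: "H a i = 0" if "H a a = 0" "i \<in> ?I" for i
  proof -
    have "bform ?I H (unit_fun a) (unit_fun i) = 0"
      by (rule psd_zero_bform[OF insert.prems]) (use that fin in \<open>simp add: bform_unit\<close>)
    then show ?thesis using that fin by (simp add: bform_unit)
  qed
  define C where "C l i = (if l = m then H a i / sqrt (H a a) else if i = a then 0 else B l i)" for l i
  have "H i j = (\<Sum>l<Suc m. C l i * C l j)" if "i \<in> ?I" "j \<in> ?I" for i j
  proof -
    have 1: "C m i * C m j = H a i * H a j / H a a"
      unfolding C_def using d by (simp add: real_sqrt_mult[symmetric])
    show ?thesis
    proof (cases "i = a \<or> j = a")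
      case True
      have "(\<Sum>l<m. C l i * C l j) = 0" using True by (intro sum.neutral) (auto simp: C_def)
      moreover have "H i j = H a i * H a j / H a a"
      proof (cases "H a a = 0")
        case z: True
        then show ?thesis using True row[OF z] that sym unfolding sym_on_def by (metis div_by_0)
      next
        case False
        have "H i j = H j i" using sym that unfolding sym_on_def by blast
        then show ?thesis using True False by auto
      qed
      ultimately show ?thesis using 1 by simp
    next
      case False
      then have "(\<Sum>l<m. C l i * C l j) = G i j" using B[of i j] that unfolding C_def
        by (auto intro!: sum.cong)
      then show ?thesis using 1 unfolding G_def by simp
    qed
  qed
  then show ?case by blast
qed

text \<open>Schur's product theorem: a Gram factorisation of \<open>H\<close> splits the entrywise
  product into a sum of copies of \<open>G\<close>, each scaled on both sides by a diagonal
  matrix.\<close>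

lemma psd_schur:
  assumes "finite I" "psd I H" "psd I G"
  shows "psd I (\<lambda>i j. H i j * G i j)"
proof -
  obtain m :: nat and B where B: "\<And>i j. i \<in> I \<Longrightarrow> j \<in> I \<Longrightarrow> H i j = (\<Sum>l<m. B l i * B l j)"
    using psd_gram[OF assms(1,2)] by metis
  have "qform I (\<lambda>i j. H i j * G i j) x = (\<Sum>l<m. qform I G (\<lambda>i. B l i * x i))" for x
  proof -
    have "qform I (\<lambda>i j. H i j * G i j) x = qform I (\<lambda>i j. \<Sum>l<m. B l i * B l j * G i j) x"
      by (intro bform_cong) (simp_all add: B sum_distrib_right)
    also have "\<dots> = (\<Sum>l<m. qform I G (\<lambda>i. B l i * x i))"
      unfolding bform_sum_form by (intro sum.cong refl) (simp add: bform_def algebra_simps)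
    finally show ?thesis .
  qed
  moreover have "0 \<le> (\<Sum>l<m. qform I G (\<lambda>i. B l i * x i))" for x
    using assms(3) unfolding psd_def by (blast intro: sum_nonneg)
  ultimately show ?thesis using psd_sym[OF assms(2)] psd_sym[OF assms(3)]
    by (intro psdI) auto
qed

lemma psd_one: "psd I (\<lambda>i j. 1)"
  using bform_rank_one[of I "\<lambda>_. 1" "\<lambda>_. 1"] by (simp add: psd_def sym_on_def)

lemma psd_power:
  assumes "finite I" "psd I H"
  shows "psd I (\<lambda>i j. H i j ^ k)"
proof (induction k)
  case 0
  show ?case by (simp add: psd_one)
next
  case (Suc k)
  show ?case using psd_schur[OF assms Suc] by simp
qed

text \<open>The two inequalities come from the test vectors e_i + e_j and e_i - e_j.\<close>

lemma psd_entry_bound: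
  assumes "finite I" "psd I H" "i \<in> I" "j \<in> I" "H i i \<le> 1" "H j j \<le> 1"
  shows "\<bar>H i j\<bar> \<le> 1"
proof -
  have "0 \<le> qform I H (\<lambda>k. unit_fun i k + t * unit_fun j k)" for t
    using assms unfolding psd_def by blast
  then have *: "0 \<le> H i i + 2 * t * H i j + t\<^sup>2 * H j j" for t
    using assms by (subst (asm) qform_line) (simp_all add: psd_def bform_unit)
  show ?thesis using *[of 1] *[of "-1"] assms by auto
qed

lemma psd_scale:
  assumes "psd I H"
  shows "psd I (\<lambda>i j. r i * r j * H i j)"
proof (rule psdI)
  fix i j assume "i \<in> I" "j \<in> I"
  then show "r i * r j * H i j = r j * r i * H j i" using psd_sym[OF assms, of i j] by simp
next
  fix x
  have "qform I (\<lambda>i j. r i * r j * H i j) x = qform I H (\<lambda>i. r i * x i)"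
    unfolding bform_def by (intro sum.cong refl) (simp add: ac_simps)
  then show "0 \<le> qform I (\<lambda>i j. r i * r j * H i j) x" using psd_nonneg[OF assms] by simp
qed

lemma psd_add:
  assumes "psd I H" "psd I G"
  shows "psd I (\<lambda>i j. H i j + G i j)"
  using psd_sym[OF assms(1)] psd_sym[OF assms(2)] psd_nonneg[OF assms(1)] psd_nonneg[OF assms(2)]
  by (intro psdI) (auto simp: bform_add_form)

lemma psd_cmult:
  assumes "psd I H" "0 \<le> c"
  shows "psd I (\<lambda>i j. c * H i j)"
  using psd_sym[OF assms(1)] psd_nonneg[OF assms(1)] assms(2)
  by (intro psdI) (auto simp: bform_scale_form)

lemma psd_sum:
  assumes "\<And>k. k \<in> K \<Longrightarrow> psd I (F k)"
  shows "psd I (\<lambda>i j. \<Sum>k\<in>K. F k i j)"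
proof (rule psdI)
  fix i j assume "i \<in> I" "j \<in> I"
  then show "(\<Sum>k\<in>K. F k i j) = (\<Sum>k\<in>K. F k j i)" using psd_sym[OF assms] by (intro sum.cong) auto
next
  fix x
  show "0 \<le> qform I (\<lambda>i j. \<Sum>k\<in>K. F k i j) x"
    unfolding bform_sum_form using psd_nonneg[OF assms] by (intro sum_nonneg) auto
qed

lemma tendsto_bform:
  assumes "\<And>i j. i \<in> I \<Longrightarrow> j \<in> I \<Longrightarrow> ((\<lambda>m. F m i j) \<longlongrightarrow> G i j) A"
  shows "((\<lambda>m. bform I (F m) x y) \<longlongrightarrow> bform I G x y) A"
  unfolding bform_def by (intro tendsto_sum tendsto_mult assms tendsto_const)

lemma psd_limit:
  assumes lim: "\<And>i j. i \<in> I \<Longrightarrow> j \<in> I \<Longrightarrow> ((\<lambda>m. F m i j) \<longlongrightarrow> G i j) A"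
    and ev: "\<forall>\<^sub>F m in A. psd I (F m)" and A: "A \<noteq> bot"
  shows "psd I G"
proof (rule psdI)
  fix i j assume ij: "i \<in> I" "j \<in> I"
  have "\<forall>\<^sub>F m in A. F m i j = F m j i"
    using ev by eventually_elim (rule psd_sym[OF _ ij])
  then have "((\<lambda>m. F m j i) \<longlongrightarrow> G i j) A"
    using lim[OF ij] by (rule tendsto_cong[THEN iffD1])
  then show "G i j = G j i" using lim[OF ij(2,1)] by (rule tendsto_unique[OF A])
next
  fix x
  have "\<forall>\<^sub>F m in A. 0 \<le> qform I (F m) x"
    using ev by eventually_elim (rule psd_nonneg)
  then show "0 \<le> qform I G x" by (intro tendsto_lowerbound[OF tendsto_bform[OF lim] _ A])
qed

section \<open>Binomial series of semidefinite kernels\<close>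

definition binom_coeff :: "real \<Rightarrow> nat \<Rightarrow> real" where
  "binom_coeff p k = - (pochhammer (- p) k / fact k)"

text \<open>\<open>binom_coeff p k\<close> is minus the coefficient of q^k in (1 - q)^p, hence -1 at
  \<open>k = 0\<close>. For \<open>k > 0\<close> exactly one factor of (-p)(1 - p)(2 - p)... is
  negative.\<close>

lemma binom_coeff_pos: "0 < p \<Longrightarrow> p < 1 \<Longrightarrow> 0 < k \<Longrightarrow> 0 < binom_coeff p k"
  unfolding binom_coeff_def
  by (cases k) (auto simp: pochhammer_rec intro!: divide_pos_pos mult_pos_pos pochhammer_pos)

lemma binom_coeff_sums:
  fixes q :: real
  assumes "\<bar>q\<bar> < 1"
  shows "(\<lambda>k. binom_coeff p k * q ^ k) sums (- ((1 - q) powr p))"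
proof -
  have "(\<lambda>k. (p gchoose k) * (- q) ^ k) sums (1 + (- q)) powr p"
    using assms by (intro gen_binomial_real) simp
  from sums_minus[OF this] show ?thesis
    unfolding binom_coeff_def gbinomial_pochhammer
    by (simp add: power_minus[of q] mult.assoc) (simp add: power_mult_distrib[symmetric] ac_simps)
qed

text \<open>All coefficients of \<open>(1 - q)\<^sup>p\<close> except the constant one are negative, so Schur's product theorem
  applies term by term.\<close>

lemma psd_binomial_tail:
  assumes I: "finite I" and Q: "psd I Q" and bnd: "\<And>i j. i \<in> I \<Longrightarrow> j \<in> I \<Longrightarrow> \<bar>Q i j\<bar> \<le> 1"
    and p: "0 < p" "p < 1"
  shows "psd I (\<lambda>i j. 1 - (1 - Q i j) powr p - (\<Sum>k\<in>{1..K}. binom_coeff p k * Q i j ^ k))"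
\<comment> \<open>Entries of \<open>Q\<close> may be 1 or -1, on the boundary of the disc of
  convergence. The series is therefore applied to \<open>t * Q i j\<close> with
  \<open>t < 1\<close>, and then \<open>t\<close> tends to 1.\<close>
proof (rule psd_limit)
  show "at_left (1::real) \<noteq> bot" by simp
  fix i j assume ij: "i \<in> I" "j \<in> I"
  have "((\<lambda>t. 1 - t * Q i j) \<longlongrightarrow> 1 - 1 * Q i j) (at_left 1)"
    by (intro tendsto_intros)
  moreover have "\<forall>\<^sub>F t in at_left 1. 0 \<le> 1 - t * Q i j"
  proof -
    have "\<forall>\<^sub>F t::real in at_left 1. t \<in> {0<..<1}" by (rule eventually_at_left_real) simp
    then show ?thesis
    proof eventually_elim
      case (elim t)
      then have "\<bar>t * Q i j\<bar> \<le> 1" using bnd[OF ij] by (simp add: abs_mult mult_le_one)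
      then show ?case by linarith
    qed
  qed
  ultimately have "((\<lambda>t. (1 - t * Q i j) powr p) \<longlongrightarrow> (1 - Q i j) powr p) (at_left 1)"
    using p by (intro tendsto_powr2) auto
  moreover have "((\<lambda>t. \<Sum>k\<in>{1..K}. binom_coeff p k * (t * Q i j) ^ k)
      \<longlongrightarrow> (\<Sum>k\<in>{1..K}. binom_coeff p k * (1 * Q i j) ^ k)) (at_left 1)"
    by (intro tendsto_intros)
  ultimately show "((\<lambda>t. 1 - (1 - t * Q i j) powr p - (\<Sum>k\<in>{1..K}. binom_coeff p k * (t * Q i j) ^ k))
      \<longlongrightarrow> 1 - (1 - Q i j) powr p - (\<Sum>k\<in>{1..K}. binom_coeff p k * Q i j ^ k)) (at_left 1)"
    by (intro tendsto_diff tendsto_const) simp_all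
next
  have "\<forall>\<^sub>F t::real in at_left 1. t \<in> {0<..<1}" by (rule eventually_at_left_real) simp
  then show "\<forall>\<^sub>F t in at_left 1. psd I (\<lambda>i j. 1 - (1 - t * Q i j) powr p - (\<Sum>k\<in>{1..K}. binom_coeff p k * (t * Q i j) ^ k))"
  proof eventually_elim
    case (elim t)
    define q where "q i j = t * Q i j" for i j
    have q: "psd I q" unfolding q_def using elim by (intro psd_cmult Q) auto
    show ?case
    \<comment> \<open>With the terms up to \<open>K\<close> removed, what remains is a limit of
      finite sums of semidefinite kernels. Keeping \<open>K\<close> arbitrary later allows any
      single power of \<open>Q\<close> to be split off.\<close>
    proof (rule psd_limit[where A = sequentially and F = "\<lambda>N i j. \<Sum>k\<in>{K<..K+N}. binom_coeff p k * q i j ^ k"])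
      show "sequentially \<noteq> bot" by simp
      show "\<forall>\<^sub>F N in sequentially. psd I (\<lambda>i j. \<Sum>k\<in>{K<..K + N}. binom_coeff p k * q i j ^ k)"
        using binom_coeff_pos[OF p] by (intro always_eventually allI psd_sum psd_cmult psd_power I q)
          (auto intro: less_imp_le)
    next
      fix i j assume ij: "i \<in> I" "j \<in> I"
      have "\<bar>q i j\<bar> < 1"
      proof -
        have "\<bar>q i j\<bar> \<le> t * 1" unfolding q_def abs_mult using elim bnd[OF ij] by (intro mult_mono) auto
        then show ?thesis using elim by simp
      qed
      from binom_coeff_sums[OF this, of p]
      have "(\<lambda>N. \<Sum>k<N. binom_coeff p k * q i j ^ k) \<longlonglongrightarrow> - ((1 - q i j) powr p)"
        unfolding sums_def .
      from LIMSEQ_ignore_initial_segment[OF this, of "Suc K"]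
      have "(\<lambda>N. (\<Sum>k<N + Suc K. binom_coeff p k * q i j ^ k) - (\<Sum>k\<le>K. binom_coeff p k * q i j ^ k)) \<longlonglongrightarrow>
         - ((1 - q i j) powr p) - (\<Sum>k\<le>K. binom_coeff p k * q i j ^ k)"
        by (intro tendsto_diff tendsto_const)
      moreover have "(\<Sum>k<N + Suc K. binom_coeff p k * q i j ^ k) - (\<Sum>k\<le>K. binom_coeff p k * q i j ^ k)
          = (\<Sum>k\<in>{K<..K+N}. binom_coeff p k * q i j ^ k)" for N
      proof -
        have "{..<N + Suc K} = {..K} \<union> {K<..K+N}" by auto
        then show ?thesis by (simp add: sum.union_disjoint ivl_disj_int)
      qed
      moreover have "(\<Sum>k\<le>K. binom_coeff p k * q i j ^ k) = - 1 + (\<Sum>k\<in>{1..K}. binom_coeff p k * q i j ^ k)"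
      proof -
        have "{..K} = insert 0 {1..K}" by auto
        then show ?thesis by (simp add: binom_coeff_def)
      qed
      ultimately have "(\<lambda>N. \<Sum>k\<in>{K<..K+N}. binom_coeff p k * q i j ^ k) \<longlonglongrightarrow>
          - ((1 - q i j) powr p) - (- 1 + (\<Sum>k\<in>{1..K}. binom_coeff p k * q i j ^ k))"
        by (simp only:)
      moreover have "- A - (- 1 + B) = 1 - A - B" for A B :: real by simp
      ultimately show "(\<lambda>N. \<Sum>k\<in>{K<..K+N}. binom_coeff p k * q i j ^ k) \<longlonglongrightarrow>
          1 - (1 - t * Q i j) powr p - (\<Sum>k\<in>{1..K}. binom_coeff p k * (t * Q i j) ^ k)"
        unfolding q_def by (simp only:)
    qed
  qed
qed

section \<open>Forms with at most one positive eigenvalue\<close>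

text \<open>At most one positive eigenvalue, expressed as domination by the square of a linear form.
  Domination passes to restrictions, pullbacks and smaller diagonals without any mention of
  eigenvalues.\<close>

definition lor :: "'a set \<Rightarrow> ('a \<Rightarrow> 'a \<Rightarrow> real) \<Rightarrow> bool" where
  "lor I H \<longleftrightarrow> (\<exists>v. \<forall>x. qform I H x \<le> (\<Sum>i\<in>I. v i * x i)\<^sup>2)"

lemma lor_cong:
  assumes "\<And>i j. i \<in> I \<Longrightarrow> j \<in> I \<Longrightarrow> H i j = H' i j"
  shows "lor I H \<longleftrightarrow> lor I H'"
proof -
  have "qform I H x = qform I H' x" for x by (intro bform_cong assms) auto
  then show ?thesis unfolding lor_def by simp
qed

lemma psd_imp_lor: "psd I (\<lambda>i j. v i * v j - H i j) \<Longrightarrow> lor I H"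
  unfolding lor_def
  by (rule exI[of _ v]) (use psd_nonneg[of I "\<lambda>i j. v i * v j - H i j"] in
      \<open>auto simp: bform_diff_form bform_rank_one power2_eq_square\<close>)

text \<open>A violation would give a plane on which the form is positive definite; that plane meets the
  hyperplane orthogonal to \<open>v\<close>.\<close>

lemma lor_reverse_Cauchy:
  assumes sym: "sym_on I H" and lor: "lor I H" and w: "0 \<le> qform I H w"
  shows "qform I H w * qform I H x \<le> (bform I H w x)\<^sup>2"
proof (rule ccontr)
  assume neg: "\<not> ?thesis"
  have pos: "0 < qform I H w" using neg w by (cases "qform I H w = 0") auto
  obtain v where v: "\<And>x. qform I H x \<le> (\<Sum>i\<in>I. v i * x i)\<^sup>2" using lor unfolding lor_def by blast
  \<comment> \<open>This \<open>c\<close> makes \<open>z\<close> orthogonal to \<open>w\<close> for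
    \<open>H\<close>, so the form is diagonal on the plane spanned by \<open>w\<close> and
    \<open>z\<close>.\<close>
  define c where "c = bform I H w x / qform I H w"
  define z where "z = (\<lambda>i. x i + (- c) * w i)"
  have wz: "bform I H w z = 0"
    unfolding z_def bform_add_right bform_scale_right c_def using pos by simp
  have "qform I H z = qform I H x + 2 * (- c) * bform I H x w + (- c)\<^sup>2 * qform I H w"
    unfolding z_def by (rule qform_line[OF sym])
  also have "\<dots> = qform I H x - (bform I H w x)\<^sup>2 / qform I H w"
    using bform_commute[OF sym, of x w] pos unfolding c_def by (simp add: field_simps power2_eq_square)
  finally have "qform I H z = qform I H x - (bform I H w x)\<^sup>2 / qform I H w" .
  moreover have "(bform I H w x)\<^sup>2 / qform I H w < qform I H x"
    using neg pos by (simp add: pos_divide_less_eq mult.commute)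
  ultimately have zz: "qform I H z > 0" by simp
  define a where "a = (\<Sum>i\<in>I. v i * w i)"
  define b where "b = (\<Sum>i\<in>I. v i * z i)"
  define y where "y = (\<lambda>i. b * w i + (- a) * z i)"
  have "(\<Sum>i\<in>I. v i * y i) = (\<Sum>i\<in>I. b * (v i * w i) + (- a) * (v i * z i))"
    unfolding y_def by (intro sum.cong refl) (simp add: algebra_simps)
  also have "\<dots> = b * a + (- a) * b"
    unfolding sum.distrib sum_distrib_left[symmetric] a_def[symmetric] b_def[symmetric] ..
  finally have "qform I H y \<le> 0" using v[of y] by simp
  moreover have "qform I H y = b\<^sup>2 * qform I H w + a\<^sup>2 * qform I H z"
    using wz bform_commute[OF sym, of z w] unfolding y_def bform_add_right bform_scale_right bform_add_left bform_scale_left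
    by (simp add: algebra_simps power2_eq_square)
  moreover have "0 \<le> b\<^sup>2 * qform I H w" using pos by simp
  moreover have "0 \<le> a\<^sup>2 * qform I H z" using zz by simp
  ultimately have "a\<^sup>2 * qform I H z = 0" by linarith
  then have "a = 0" using zz by simp
  then show False using v[of w] pos unfolding a_def by simp
qed

lemma qform_ones: "qform I H (\<lambda>_. 1) = (\<Sum>i\<in>I. \<Sum>j\<in>I. H i j)"
  unfolding bform_def by simp

lemma nonneg_row_sum_zero:
  fixes H :: "'a \<Rightarrow> 'a \<Rightarrow> real"
  assumes "finite I" "\<And>i j. i \<in> I \<Longrightarrow> j \<in> I \<Longrightarrow> 0 \<le> H i j" "i \<in> I" "(\<Sum>j\<in>I. H i j) = 0" "j \<in> I"
  shows "H i j = 0"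
proof -
  have "\<forall>j\<in>I. H i j = 0"
    using assms(4) by (subst (asm) sum_nonneg_eq_0_iff) (use assms in auto)
  then show ?thesis using assms(5) by blast
qed

text \<open>For nonnegative entries the vector of ones is a universal test vector: its value is the
  sum \<open>s\<close> of all entries. With row sums \<open>r i\<close> the explicit choice
  \<open>v i = r i / sqrt s\<close> works, and it vanishes exactly at zero rows;
  \<open>s = 0\<close> means that all entries vanish.\<close>

lemma lor_structure:
  assumes I: "finite I" and sym: "sym_on I H" and nn: "\<And>i j. i \<in> I \<Longrightarrow> j \<in> I \<Longrightarrow> 0 \<le> H i j"
    and main: "\<And>x. qform I H (\<lambda>_. 1) * qform I H x \<le> (bform I H (\<lambda>_. 1) x)\<^sup>2"
  shows "\<exists>v. (\<forall>i\<in>I. 0 \<le> v i) \<and> (\<forall>i\<in>I. v i = 0 \<longleftrightarrow> (\<forall>j\<in>I. H i j = 0)) \<and> psd I (\<lambda>i j. v i * v j - H i j)"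
proof -
  define r where "r i = (\<Sum>j\<in>I. H i j)" for i
  define s where "s = (\<Sum>i\<in>I. r i)"
  have s: "qform I H (\<lambda>_. 1) = s" unfolding qform_ones s_def r_def ..
  have rx: "bform I H (\<lambda>_. 1) x = (\<Sum>i\<in>I. r i * x i)" for x
    unfolding bform_def r_def by (subst sum.swap, intro sum.cong refl)
      (use sym in \<open>auto simp: sym_on_def sum_distrib_right intro!: sum.cong\<close>)
  have r0: "0 \<le> r i" if "i \<in> I" for i unfolding r_def using nn that by (intro sum_nonneg)
  have row: "r i = 0 \<longleftrightarrow> (\<forall>j\<in>I. H i j = 0)" if "i \<in> I" for i
    using nonneg_row_sum_zero[OF I nn that] unfolding r_def by auto
  have s0: "0 \<le> s" unfolding s_def using r0 by (intro sum_nonneg)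
  have symH: "H i j = H j i" if "i \<in> I" "j \<in> I" for i j using sym that unfolding sym_on_def by blast
  show ?thesis
  proof (cases "s = 0")
    case True
    then have "\<And>i. i \<in> I \<Longrightarrow> r i = 0" using r0 I unfolding s_def by (simp add: sum_nonneg_eq_0_iff)
    then have z: "H i j = 0" if "i \<in> I" "j \<in> I" for i j using row that by blast
    have "psd I (\<lambda>i j. 0 * 0 - H i j)"
      by (rule psd_cong[THEN iffD1, OF _ psd_cmult[OF psd_one, of 0]]) (use z in auto)
    then show ?thesis using z by (intro exI[of _ "\<lambda>_. 0"]) auto
  next
    case False
    then have sp: "s > 0" using s0 by simp
    have "psd I (\<lambda>i j. (r i / sqrt s) * (r j / sqrt s) - H i j)"
    proof (rule psdI)
      fix x
      have "s * qform I H x \<le> (\<Sum>i\<in>I. r i * x i)\<^sup>2" using main[of x] s rx by simp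
      then have "qform I H x \<le> (\<Sum>i\<in>I. r i * x i)\<^sup>2 / s" using sp by (simp add: field_simps)
      also have "\<dots> = (\<Sum>i\<in>I. r i / sqrt s * x i)\<^sup>2"
      proof -
        have "(\<Sum>i\<in>I. r i / sqrt s * x i) = (\<Sum>i\<in>I. r i * x i) / sqrt s"
          by (simp add: sum_divide_distrib)
        then show ?thesis using sp by (simp add: power_divide)
      qed
      finally show "0 \<le> qform I (\<lambda>i j. r i / sqrt s * (r j / sqrt s) - H i j) x"
        unfolding bform_diff_form bform_rank_one power2_eq_square by simp
    qed (use symH in auto)
    then show ?thesis using r0 row sp by (intro exI[of _ "\<lambda>i. r i / sqrt s"]) auto
  qed
qed

text \<open>Trades the existential vector for polynomial inequalities in the entries, one for each
  \<open>x\<close>. This is what makes the condition closed.\<close>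

lemma lor_iff_ones:
  assumes "finite I" "sym_on I H" "\<And>i j. i \<in> I \<Longrightarrow> j \<in> I \<Longrightarrow> 0 \<le> H i j"
  shows "lor I H \<longleftrightarrow> (\<forall>x. qform I H (\<lambda>_. 1) * qform I H x \<le> (bform I H (\<lambda>_. 1) x)\<^sup>2)"
proof
  assume "lor I H"
  moreover have "0 \<le> qform I H (\<lambda>_. 1)" unfolding qform_ones using assms(3) by (intro sum_nonneg)
  ultimately show "\<forall>x. qform I H (\<lambda>_. 1) * qform I H x \<le> (bform I H (\<lambda>_. 1) x)\<^sup>2"
    using lor_reverse_Cauchy[OF assms(2)] by blast
next
  assume "\<forall>x. qform I H (\<lambda>_. 1) * qform I H x \<le> (bform I H (\<lambda>_. 1) x)\<^sup>2"
  then show "lor I H" using lor_structure[OF assms] psd_imp_lor by blast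
qed

text \<open>The normal form behind all later estimates. Nonnegativity of the diagonal of
  \<open>H\<close> gives \<open>Q i i \<le> 1\<close>, and semidefiniteness extends the bound to all
  entries.\<close>

lemma lor_kernel:
  assumes I: "finite I" and sym: "sym_on I H" and nn: "\<And>i j. i \<in> I \<Longrightarrow> j \<in> I \<Longrightarrow> 0 \<le> H i j"
    and lor: "lor I H"
  obtains v Q where "\<And>i. i \<in> I \<Longrightarrow> 0 \<le> v i" "\<And>i. i \<in> I \<Longrightarrow> v i = 0 \<longleftrightarrow> (\<forall>j\<in>I. H i j = 0)"
    "psd I Q" "\<And>i j. i \<in> I \<Longrightarrow> j \<in> I \<Longrightarrow> H i j = v i * v j * (1 - Q i j)"
    "\<And>i j. i \<in> I \<Longrightarrow> j \<in> I \<Longrightarrow> \<bar>Q i j\<bar> \<le> 1"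
proof -
  obtain v where v: "\<And>i. i \<in> I \<Longrightarrow> 0 \<le> v i" "\<And>i. i \<in> I \<Longrightarrow> v i = 0 \<longleftrightarrow> (\<forall>j\<in>I. H i j = 0)"
      and P: "psd I (\<lambda>i j. v i * v j - H i j)"
    using lor_structure[OF I sym nn] lor lor_iff_ones[OF I sym nn] by blast
  \<comment> \<open>Where \<open>v\<close> vanishes the reciprocal is 0 and so is \<open>Q\<close>;
    the corresponding rows and columns of \<open>H\<close> vanish, so the factorisation
    persists.\<close>
  define Q where "Q i j = (1 / v i) * (1 / v j) * (v i * v j - H i j)" for i j
  have Q: "psd I Q" unfolding Q_def by (rule psd_scale[OF P])
  have H: "H i j = v i * v j * (1 - Q i j)" if "i \<in> I" "j \<in> I" for i j
  proof (cases "v i = 0 \<or> v j = 0")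
    case True
    moreover have "H i j = H j i" using sym that unfolding sym_on_def by blast
    ultimately have "H i j = 0" using v(2) that by auto
    then show ?thesis using True by auto
  next
    case False
    then show ?thesis unfolding Q_def by (simp add: field_simps)
  qed
  have "Q i i \<le> 1" if "i \<in> I" for i
  proof (cases "v i = 0")
    case False
    then have "Q i i = 1 - H i i / (v i * v i)" unfolding Q_def by (simp add: field_simps)
    then show ?thesis using nn[OF that that] by simp
  qed (simp add: Q_def)
  then have "\<bar>Q i j\<bar> \<le> 1" if "i \<in> I" "j \<in> I" for i j
    using psd_entry_bound[OF I Q that] that by blast
  then show ?thesis by (intro that[of v Q] v Q H)
qed

lemma lor_powr:
  assumes I: "finite I" and sym: "sym_on I H" and nn: "\<And>i j. i \<in> I \<Longrightarrow> j \<in> I \<Longrightarrow> 0 \<le> H i j"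
    and lor: "lor I H" and p: "0 < p" "p \<le> 1"
  shows "lor I (\<lambda>i j. H i j powr p)"
proof (cases "p = 1")
  case True
  then show ?thesis using lor lor_cong[of I H "\<lambda>i j. H i j powr p"] nn by simp
next
  case False
  then have p1: "p < 1" using p by simp
  obtain v Q where v: "\<And>i. i \<in> I \<Longrightarrow> 0 \<le> v i" and Q: "psd I Q"
    and H: "\<And>i j. i \<in> I \<Longrightarrow> j \<in> I \<Longrightarrow> H i j = v i * v j * (1 - Q i j)"
    and b: "\<And>i j. i \<in> I \<Longrightarrow> j \<in> I \<Longrightarrow> \<bar>Q i j\<bar> \<le> 1"
    using lor_kernel[OF I sym nn lor] by metis
  \<comment> \<open>The binomial tail with no term removed: the sum over \<open>{1..0}\<close> is
    empty.\<close>
  have "psd I (\<lambda>i j. v i powr p * v j powr p * (1 - (1 - Q i j) powr p - (\<Sum>k\<in>{1..0}. binom_coeff p k * Q i j ^ k)))"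
    by (intro psd_scale psd_binomial_tail I Q b p p1)
  then have "psd I (\<lambda>i j. v i powr p * v j powr p - H i j powr p)"
  proof (rule psd_cong[THEN iffD1, rotated])
    fix i j assume ij: "i \<in> I" "j \<in> I"
    have "H i j powr p = v i powr p * v j powr p * (1 - Q i j) powr p"
      using v[OF ij(1)] v[OF ij(2)] b[OF ij] unfolding H[OF ij] by (simp add: powr_mult)
    then show "v i powr p * v j powr p * (1 - (1 - Q i j) powr p - (\<Sum>k\<in>{1..0}. binom_coeff p k * Q i j ^ k)) =
        v i powr p * v j powr p - H i j powr p" by (simp add: algebra_simps)
  qed
  then show ?thesis by (rule psd_imp_lor)
qed

lemma lor_scale:
  assumes "lor I H"
  shows "lor I (\<lambda>i j. r i * r j * H i j)"
proof -
  obtain v where v: "\<And>x. qform I H x \<le> (\<Sum>i\<in>I. v i * x i)\<^sup>2" using assms unfolding lor_def by blast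
  have "qform I (\<lambda>i j. r i * r j * H i j) x \<le> (\<Sum>i\<in>I. (v i * r i) * x i)\<^sup>2" for x
  proof -
    have "qform I (\<lambda>i j. r i * r j * H i j) x = qform I H (\<lambda>i. r i * x i)"
      unfolding bform_def by (intro sum.cong refl) (simp add: ac_simps)
    then show ?thesis using v[of "\<lambda>i. r i * x i"] by (simp add: mult.assoc)
  qed
  then show ?thesis unfolding lor_def by (intro exI[of _ "\<lambda>i. v i * r i"]) blast
qed

lemma lor_decrease_diag:
  assumes I: "finite I" and lor: "lor I H"
    and off: "\<And>i j. i \<in> I \<Longrightarrow> j \<in> I \<Longrightarrow> i \<noteq> j \<Longrightarrow> G i j = H i j" and diag: "\<And>i. i \<in> I \<Longrightarrow> G i i \<le> H i i"
  shows "lor I G"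
proof -
  obtain v where v: "\<And>x. qform I H x \<le> (\<Sum>i\<in>I. v i * x i)\<^sup>2" using lor unfolding lor_def by blast
  have "qform I G x \<le> qform I H x" for x
  proof -
    have "qform I H x = qform I (\<lambda>i j. G i j + (if i = j then H i i - G i i else 0)) x"
      by (intro bform_cong) (auto simp: off)
    also have "\<dots> = qform I G x + (\<Sum>i\<in>I. (H i i - G i i) * x i * x i)"
      unfolding bform_add_form bform_diag[OF I] ..
    also have "(\<Sum>i\<in>I. (H i i - G i i) * x i * x i) \<ge> 0"
      using diag by (intro sum_nonneg) (auto simp: mult.assoc intro!: mult_nonneg_nonneg)
    ultimately show ?thesis by simp
  qed
  then show ?thesis using v unfolding lor_def by (meson order_trans)
qed

text \<open>\<open>h = 1 - Q\<close> behaves like a squared distance, and the factors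
  \<open>v\<close> occur equally in all three products, so the claim is a relaxed four-point
  condition for \<open>h\<close>.\<close>

lemma lor_four_point:
  assumes I: "finite I" and sym: "sym_on I H" and nn: "\<And>i j. i \<in> I \<Longrightarrow> j \<in> I \<Longrightarrow> 0 \<le> H i j"
    and lor: "lor I H" and ijkl: "i \<in> I" "j \<in> I" "k \<in> I" "l \<in> I"
  shows "H i j * H k l \<le> 16 * max (H i k * H j l) (H i l * H j k)"
proof -
  obtain v Q where v: "\<And>i. i \<in> I \<Longrightarrow> 0 \<le> v i" and Q: "psd I Q"
    and H: "\<And>i j. i \<in> I \<Longrightarrow> j \<in> I \<Longrightarrow> H i j = v i * v j * (1 - Q i j)"
    and b: "\<And>i j. i \<in> I \<Longrightarrow> j \<in> I \<Longrightarrow> \<bar>Q i j\<bar> \<le> 1"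
    using lor_kernel[OF I sym nn lor] by metis
  define h where "h a b = 1 - Q a b" for a b
  have h0: "0 \<le> h a b" if "a \<in> I" "b \<in> I" for a b using b[OF that] unfolding h_def by simp
  have hs: "h a b = h b a" if "a \<in> I" "b \<in> I" for a b using psd_sym[OF Q that] unfolding h_def by simp
  \<comment> \<open>Relaxed triangle inequality, from the value of \<open>Q\<close> at e_a + e_b - 2
    e_c together with the diagonal bound by 1.\<close>
  have tri: "h a b \<le> 2 * h a c + 2 * h c b" if abc: "a \<in> I" "b \<in> I" "c \<in> I" for a b c
  proof -
    let ?x = "\<lambda>i. unit_fun a i + (unit_fun b i + (- 2) * unit_fun c i)"
    have "0 \<le> qform I Q ?x" by (rule psd_nonneg[OF Q])
    also have "qform I Q ?x = Q a a + Q b b + 4 * Q c c + 2 * Q a b - 4 * Q a c - 4 * Q c b"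
      unfolding bform_add_left bform_add_right bform_scale_left bform_scale_right
      using I abc psd_sym[OF Q abc(2,1)] psd_sym[OF Q abc(3,1)] psd_sym[OF Q abc(2,3)]
      by (simp add: bform_unit)
    finally show ?thesis using b[OF abc(1,1)] b[OF abc(2,2)] b[OF abc(3,3)] unfolding h_def by simp
  qed
  \<comment> \<open>If \<open>h a c\<close> is at most both neighbours, the triangle inequality
    bounds each factor on the left by 4 times one neighbour; this is the source of 16.\<close>
  have key: "h a b * h c d \<le> 16 * (h a d * h b c)"
    if "a \<in> I" "b \<in> I" "c \<in> I" "d \<in> I" "h a c \<le> h b c" "h a c \<le> h a d" for a b c d
  proof -
    have "h a b \<le> 4 * h b c" using tri[of a b c] that hs[of c b] by simp
    moreover have "h c d \<le> 4 * h a d" using tri[of c d a] that hs[of c a] by simp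
    ultimately have "h a b * h c d \<le> (4 * h b c) * (4 * h a d)"
      using h0 that by (intro mult_mono) auto
    then show ?thesis by (simp add: mult.commute)
  qed
  have "h i j * h k l \<le> 16 * max (h i k * h j l) (h i l * h j k)"
  proof -
    have s: "h j i = h i j" "h l k = h k l" "h k i = h i k" "h l j = h j l" "h l i = h i l" "h k j = h j k"
      using hs ijkl by auto
    \<comment> \<open>The entries at ik, kj, jl, li form a cycle in which neighbours share an index;
      the smallest of the four is at most its two neighbours.\<close>
    have "h i k \<le> h j k \<and> h i k \<le> h i l \<or> h j l \<le> h i l \<and> h j l \<le> h j k \<or>
        h i l \<le> h j l \<and> h i l \<le> h i k \<or> h j k \<le> h i k \<and> h j k \<le> h j l" by arith
    then consider "h i k \<le> h j k" "h i k \<le> h i l" | "h j l \<le> h i l" "h j l \<le> h j k"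
      | "h i l \<le> h j l" "h i l \<le> h i k" | "h j k \<le> h i k" "h j k \<le> h j l" by blast
    then show ?thesis
    proof cases
      case 1
      then have "h i j * h k l \<le> 16 * (h i l * h j k)" using key[of i j k l] ijkl by auto
      then show ?thesis by simp
    next
      case 2
      then have "h j i * h l k \<le> 16 * (h j k * h i l)" using key[of j i l k] ijkl by auto
      then show ?thesis using s by (simp add: mult.commute)
    next
      case 3
      then have "h i j * h l k \<le> 16 * (h i k * h j l)" using key[of i j l k] ijkl by auto
      then show ?thesis using s by simp
    next
      case 4
      then have "h j i * h k l \<le> 16 * (h j l * h i k)" using key[of j i k l] ijkl by auto
      then show ?thesis using s by (simp add: mult.commute)
    qed
  qed
  moreover have "H i j * H k l = v i * v j * v k * v l * (h i j * h k l)"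
    "H i k * H j l = v i * v j * v k * v l * (h i k * h j l)"
    "H i l * H j k = v i * v j * v k * v l * (h i l * h j k)"
    using ijkl unfolding h_def by (simp_all add: H)
  moreover have M: "0 \<le> v i * v j * v k * v l" using v ijkl by simp
  moreover have "max (m * x) (m * y) = m * max x y" if "0 \<le> m" for m x y :: real
    using that by (simp add: max_mult_distrib_left)
  ultimately show ?thesis
    using mult_left_mono[OF _ M, of "h i j * h k l" "16 * max (h i k * h j l) (h i l * h j k)"]
    by (simp only: mult.left_commute[of 16])
qed

text \<open>The three-term relations, i.e. the case \<open>s = 2\<close> of the strong relations, for a Hessian \<open>H\<close>.\<close>

definition weak_infty :: "'a set \<Rightarrow> ('a \<Rightarrow> 'a \<Rightarrow> real) \<Rightarrow> bool" where
  "weak_infty I H \<longleftrightarrow> (\<forall>a\<in>I. \<forall>a'\<in>I. \<forall>b\<in>I. \<forall>c\<in>I. H a a' = 0 \<longrightarrow> H a b * H a' c = H a c * H a' b)"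

definition weak_zero :: "'a set \<Rightarrow> ('a \<Rightarrow> 'a \<Rightarrow> real) \<Rightarrow> bool" where
  "weak_zero I H \<longleftrightarrow> (\<forall>i\<in>I. \<forall>j\<in>I. \<forall>k\<in>I. \<forall>l\<in>I. H i j * H k l \<le> max (H i k * H j l) (H i l * H j k))"

text \<open>If \<open>H a a'\<close> is 0, one of the two products under the maximum disappears. The
  remaining inequality, used with \<open>b\<close> and \<open>c\<close> in both orders, is an
  equality.\<close>

lemma weak_zero_imp_infty:
  assumes sym: "sym_on I H" and nn: "\<And>i j. i \<in> I \<Longrightarrow> j \<in> I \<Longrightarrow> 0 \<le> H i j" and w: "weak_zero I H"
  shows "weak_infty I H"
  unfolding weak_infty_def
proof (intro ballI impI)
  fix a a' b c assume I: "a \<in> I" "a' \<in> I" "b \<in> I" "c \<in> I" and z: "H a a' = 0"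
  have le: "H a b * H a' c \<le> H a c * H a' b" if I: "b \<in> I" "c \<in> I" for b c
  proof -
    have "H a b * H a' c \<le> max (H a a' * H b c) (H a c * H b a')"
      using w I \<open>a \<in> I\<close> \<open>a' \<in> I\<close> unfolding weak_zero_def by blast
    moreover have "H b a' = H a' b" using sym I \<open>a' \<in> I\<close> unfolding sym_on_def by blast
    moreover have "0 \<le> H a c * H a' b" using nn I \<open>a \<in> I\<close> \<open>a' \<in> I\<close> by simp
    ultimately show ?thesis using z by simp
  qed
  show "H a b * H a' c = H a c * H a' b" using le[of b c] le[of c b] I by linarith
qed

text \<open>A zero entry between nonzero rows means \<open>Q a a' = 1\<close>. Then e_a - e_a' is
  isotropic for \<open>Q\<close>, the two rows of \<open>Q\<close> agree, and the two rows of
  \<open>H\<close> are proportional.\<close>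

lemma lor_imp_weak_infty:
  assumes I: "finite I" and sym: "sym_on I H" and nn: "\<And>i j. i \<in> I \<Longrightarrow> j \<in> I \<Longrightarrow> 0 \<le> H i j"
    and lor: "lor I H"
  shows "weak_infty I H"
  unfolding weak_infty_def
proof (intro ballI impI)
  fix a a' b c assume abc: "a \<in> I" "a' \<in> I" "b \<in> I" "c \<in> I" and z: "H a a' = 0"
  obtain v Q where v: "\<And>i. i \<in> I \<Longrightarrow> 0 \<le> v i" and Q: "psd I Q"
    and H: "\<And>i j. i \<in> I \<Longrightarrow> j \<in> I \<Longrightarrow> H i j = v i * v j * (1 - Q i j)"
    and bd: "\<And>i j. i \<in> I \<Longrightarrow> j \<in> I \<Longrightarrow> \<bar>Q i j\<bar> \<le> 1"
    using lor_kernel[OF I sym nn lor] by metis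
  show "H a b * H a' c = H a c * H a' b"
  proof (cases "v a = 0 \<or> v a' = 0")
    case True
    then show ?thesis using abc by (auto simp: H)
  next
    case False
    then have q: "Q a a' = 1" using z H[OF abc(1,2)] by simp
    let ?x = "\<lambda>i. unit_fun a i + (- 1) * unit_fun a' i"
    have "qform I Q ?x = Q a a + Q a' a' - 2 * Q a a'"
      unfolding bform_add_left bform_add_right bform_scale_left bform_scale_right
      using I abc psd_sym[OF Q abc(2,1)] by (simp add: bform_unit)
    also have "\<dots> \<le> 0" using q bd[OF abc(1,1)] bd[OF abc(2,2)] by simp
    finally have "qform I Q ?x = 0" using psd_nonneg[OF Q, of ?x] by simp
    from psd_zero_bform[OF Q this] have "bform I Q ?x y = 0" for y .
    then have "Q a y = Q a' y" if "y \<in> I" for y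
      using I abc that unfolding bform_add_left bform_scale_left
      by (metis (no_types, lifting) add.right_neutral bform_unit diff_add_cancel mult_minus1 uminus_add_conv_diff add.commute)
    then show ?thesis using abc by (simp add: H)
  qed
qed

text \<open>\<open>G\<close> is the pullback of \<open>H\<close> under the linear map sending e_i to
  t_i e_{\<pi> i}, and domination by a squared linear form pulls back.\<close>

lemma lor_pullback:
  assumes I: "finite I" and R: "finite R" and \<pi>: "\<pi> ` I \<subseteq> R" and lor: "lor R H"
    and G: "\<And>i j. i \<in> I \<Longrightarrow> j \<in> I \<Longrightarrow> G i j = t i * t j * H (\<pi> i) (\<pi> j)"
  shows "lor I G"
proof -
  obtain v where v: "\<And>x. qform R H x \<le> (\<Sum>i\<in>R. v i * x i)\<^sup>2" using lor unfolding lor_def by blast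
  have "qform I G x \<le> (\<Sum>i\<in>I. (v (\<pi> i) * t i) * x i)\<^sup>2" for x
  proof -
    define y where "y r = (\<Sum>i\<in>{i\<in>I. \<pi> i = r}. t i * x i)" for r
    have g: "(\<Sum>i\<in>I. h i) = (\<Sum>r\<in>R. \<Sum>i\<in>{i\<in>I. \<pi> i = r}. h i)" for h :: "'a \<Rightarrow> real"
      using sum.group[OF I R \<pi>, of h] by simp
    have "qform I G x = (\<Sum>i\<in>I. \<Sum>j\<in>I. H (\<pi> i) (\<pi> j) * (t i * x i) * (t j * x j))"
      unfolding bform_def by (intro sum.cong refl) (simp add: G)
    also have "\<dots> = (\<Sum>i\<in>I. \<Sum>s\<in>R. H (\<pi> i) s * (t i * x i) * y s)"
      by (intro sum.cong refl, subst g) (simp add: y_def sum_distrib_left)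
    also have "\<dots> = (\<Sum>r\<in>R. \<Sum>i\<in>{i\<in>I. \<pi> i = r}. \<Sum>s\<in>R. H r s * (t i * x i) * y s)"
      by (subst g) simp
    also have "\<dots> = (\<Sum>r\<in>R. \<Sum>s\<in>R. H r s * y r * y s)"
      by (intro sum.cong refl, subst sum.swap, intro sum.cong refl)
         (simp only: sum_distrib_left[symmetric] sum_distrib_right[symmetric] y_def)
    also have "\<dots> = qform R H y" unfolding bform_def ..
    also have "\<dots> \<le> (\<Sum>i\<in>R. v i * y i)\<^sup>2" by (rule v)
    also have "(\<Sum>i\<in>R. v i * y i) = (\<Sum>i\<in>I. (v (\<pi> i) * t i) * x i)"
      by (subst g) (simp add: y_def sum_distrib_left mult.assoc)
    finally show ?thesis .
  qed
  then show ?thesis unfolding lor_def by (intro exI[of _ "\<lambda>i. v (\<pi> i) * t i"]) blast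
qed

text \<open>Each index is tied by a zero entry to some element of \<open>R\<close>, so its row is a
  multiple of the row of that element. Hence \<open>G\<close> is a pullback of its restriction to
  \<open>R\<close>.\<close>

lemma lor_collapse:
  assumes I: "finite I" and sym: "sym_on I G" and w: "weak_infty I G" and R: "R \<subseteq> I"
    and rep: "\<And>i. i \<in> I \<Longrightarrow> \<exists>r\<in>R. i = r \<or> G i r = 0"
    and nz: "\<And>r. r \<in> R \<Longrightarrow> \<exists>c\<in>I. G r c \<noteq> 0"
    and lor: "lor R G"
  shows "lor I G"
proof -
  have "\<exists>r t. r \<in> R \<and> (\<forall>b\<in>I. G i b = t * G r b)" if i: "i \<in> I" for i
  proof -
    obtain r where r: "r \<in> R" "i = r \<or> G i r = 0" using rep[OF i] by blast
    show ?thesis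
    proof (cases "i = r")
      case True
      then show ?thesis using r by (intro exI[of _ r] exI[of _ 1]) auto
    next
      case False
      then have z: "G i r = 0" using r by blast
      obtain c where c: "c \<in> I" "G r c \<noteq> 0" using nz r by blast
      \<comment> \<open>The factor of proportionality is read off in a column \<open>c\<close> in
        which the row of \<open>r\<close> is nonzero.\<close>
      have "G i b = (G i c / G r c) * G r b" if "b \<in> I" for b
      proof -
        have "G i b * G r c = G i c * G r b" using w z i r(1) R c(1) that unfolding weak_infty_def by blast
        then show ?thesis using c by (simp add: field_simps)
      qed
      then show ?thesis using r by blast
    qed
  qed
  then obtain \<pi> t where \<pi>: "\<And>i. i \<in> I \<Longrightarrow> \<pi> i \<in> R" and t: "\<And>i b. i \<in> I \<Longrightarrow> b \<in> I \<Longrightarrow> G i b = t i * G (\<pi> i) b"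
    by metis
  have symG: "G i j = G j i" if "i \<in> I" "j \<in> I" for i j using sym that unfolding sym_on_def by blast
  show ?thesis
  proof (rule lor_pullback[OF I _ _ lor])
    show "finite R" using R I finite_subset by blast
    show "\<pi> ` I \<subseteq> R" using \<pi> by blast
    fix i j assume ij: "i \<in> I" "j \<in> I"
    have "\<pi> i \<in> I" "\<pi> j \<in> I" using \<pi> R ij by auto
    have "G i j = t i * G (\<pi> i) j" using t ij by blast
    also have "G (\<pi> i) j = G j (\<pi> i)" using symG \<open>\<pi> i \<in> I\<close> ij by blast
    also have "\<dots> = t j * G (\<pi> j) (\<pi> i)" using t \<open>\<pi> i \<in> I\<close> ij by blast
    also have "G (\<pi> j) (\<pi> i) = G (\<pi> i) (\<pi> j)" using symG \<open>\<pi> i \<in> I\<close> \<open>\<pi> j \<in> I\<close> by blast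
    finally show "G i j = t i * t j * G (\<pi> i) (\<pi> j)" by simp
  qed
qed

section \<open>Tropical forms\<close>

lemma psd_rank_one: "psd I (\<lambda>i j. v i * v j)"
  by (intro psdI) (simp_all add: bform_rank_one)

text \<open>The sum of the rank-one forms of the indicators of the classes. Reflexivity is not
  assumed: an index unrelated to itself has an empty class and a zero row.\<close>

lemma psd_partial_equivalence:
  assumes A: "finite A" and sym: "\<And>i j. i \<in> A \<Longrightarrow> j \<in> A \<Longrightarrow> E i j \<Longrightarrow> E j i"
    and trans: "\<And>i j k. i \<in> A \<Longrightarrow> j \<in> A \<Longrightarrow> k \<in> A \<Longrightarrow> E i j \<Longrightarrow> E j k \<Longrightarrow> E i k"
  shows "psd A (\<lambda>i j. if E i j then 1 else 0)"
proof -
  define cls where "cls i = {j \<in> A. E i j}" for i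
  have "psd A (\<lambda>i j. \<Sum>C\<in>cls ` A. indicator C i * indicator C j)"
    by (intro psd_sum psd_rank_one)
  moreover have "(\<Sum>C\<in>cls ` A. indicator C i * indicator C j) = (if E i j then 1 else 0 :: real)"
    if ij: "i \<in> A" "j \<in> A" for i j
  proof -
    have C: "cls k = cls i" if "k \<in> A" "i \<in> cls k" for k
      using that ij sym trans unfolding cls_def by blast
    show ?thesis
    proof (cases "E i j")
      case True
      then have ii: "i \<in> cls i" "j \<in> cls i" using ij sym trans unfolding cls_def by blast+
      have "(\<Sum>C\<in>cls ` A. indicator C i * indicator C j) = (\<Sum>C\<in>cls ` A. if C = cls i then 1 else 0 :: real)"
        using C ii by (intro sum.cong refl) (auto simp: indicator_def)
      then show ?thesis using True A ij by simp
    next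
      case False
      have "(\<Sum>C\<in>cls ` A. indicator C i * indicator C j) = (\<Sum>C\<in>cls ` A. 0 :: real)"
      proof (intro sum.cong refl)
        fix D assume "D \<in> cls ` A"
        then obtain k where k: "k \<in> A" "D = cls k" by blast
        show "indicator D i * indicator D j = (0::real)"
          using C[of k] k False unfolding cls_def by (auto simp: indicator_def)
      qed
      then show ?thesis using False by simp
    qed
  qed
  ultimately show ?thesis by (subst (asm) psd_cong) auto
qed

lemma psd_ultrametric:
  assumes A: "finite A" and sym: "\<And>i j. i \<in> A \<Longrightarrow> j \<in> A \<Longrightarrow> K i j = (K j i :: real)"
    and ultra: "\<And>i j k. i \<in> A \<Longrightarrow> j \<in> A \<Longrightarrow> k \<in> A \<Longrightarrow> K i j \<le> max (K i k) (K k j)"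
    and M: "\<And>i j. i \<in> A \<Longrightarrow> j \<in> A \<Longrightarrow> K i j \<le> M"
  shows "psd A (\<lambda>i j. M - K i j)"
  using sym ultra M
proof (induction "card ((\<lambda>(i,j). K i j) ` (A \<times> A))" arbitrary: K M rule: less_induct)
  case less
  let ?V = "(\<lambda>(i,j). K i j) ` (A \<times> A)"
  have fV: "finite ?V" using A by simp
  have inV: "K i j \<in> ?V" if "i \<in> A" "j \<in> A" for i j using that by blast
  show ?case
  proof (cases "A = {}")
    case True
    then show ?thesis by (intro psdI) (simp_all add: bform_def)
  next
    case False
    then have V0: "?V \<noteq> {}" by auto
    define m where "m = Max ?V"
    have mV: "m \<in> ?V" unfolding m_def using fV V0 by (rule Max_in)
    have mM: "m \<le> M" using mV less.prems(3) by auto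
    have le: "K i j \<le> m" if "i \<in> A" "j \<in> A" for i j
      unfolding m_def by (rule Max_ge[OF fV inV[OF that]])
    have top: "psd A (\<lambda>i j. (M - m) * 1)" using mM by (intro psd_cmult psd_one) simp
    show ?thesis
    proof (cases "?V - {m} = {}")
      case True
      then have "K i j = m" if "i \<in> A" "j \<in> A" for i j using inV[OF that] by blast
      then show ?thesis using top by (subst psd_cong[where H' = "\<lambda>i j. (M - m) * 1"]) auto
    next
      case False
      define m' where "m' = Max (?V - {m})"
      have m'V: "m' \<in> ?V - {m}" unfolding m'_def using fV False by (intro Max_in) auto
      have m'm: "m' < m" using m'V le by force
      have gap: "K i j \<le> m'" if "i \<in> A" "j \<in> A" "K i j \<noteq> m" for i j
        unfolding m'_def using fV inV[OF that(1,2)] that(3) by (intro Max_ge) auto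
      define K' where "K' i j = min (K i j) m'" for i j
      have "(\<lambda>(i,j). K' i j) ` (A \<times> A) \<subseteq> ?V - {m}"
      proof clarify
        fix i j assume ij: "i \<in> A" "j \<in> A"
        show "K' i j \<in> ?V - {m}"
          using gap[OF ij] inV[OF ij] m'V m'm le[OF ij] unfolding K'_def by (auto simp: min_def)
      qed
      then have "(\<lambda>(i,j). K' i j) ` (A \<times> A) \<subset> ?V" using mV by blast
      then have card: "card ((\<lambda>(i,j). K' i j) ` (A \<times> A)) < card ?V" by (rule psubset_card_mono[OF fV])
      have "psd A (\<lambda>i j. m' - K' i j)"
      proof (rule less.hyps[OF card])
        fix i j k assume "i \<in> A" "j \<in> A" "k \<in> A"
        then show "K' i j \<le> max (K' i k) (K' k j)"
          using less.prems(2)[of i j k] unfolding K'_def by (auto simp: min_def max_def split: if_splits)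
      qed (use less.prems(1) in \<open>auto simp: K'_def\<close>)
      moreover have "psd A (\<lambda>i j. (m - m') * (if K i j < m then 1 else 0))"
      proof (intro psd_cmult psd_partial_equivalence A)
        fix i j k assume ijk: "i \<in> A" "j \<in> A" "k \<in> A" "K i j < m" "K j k < m"
        then show "K i k < m" using less.prems(2)[of i k j] by (auto simp: max_def split: if_splits)
      qed (use less.prems(1) m'm in auto)
      \<comment> \<open>Where \<open>K = m\<close> only the first summand is nonzero; elsewhere
        \<open>K' = K\<close> and the sum telescopes.\<close>
      ultimately have "psd A (\<lambda>i j. (M - m) * 1 + ((m - m') * (if K i j < m then 1 else 0) + (m' - K' i j)))"
        by (intro psd_add top)
      then show ?thesis
      proof (subst (asm) psd_cong)
        fix i j assume ij: "i \<in> A" "j \<in> A"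
        show "(M - m) * 1 + ((m - m') * (if K i j < m then 1 else 0) + (m' - K' i j)) = M - K i j"
          using gap[OF ij] le[OF ij] m'm unfolding K'_def by (auto simp: min_def)
      qed auto
    qed
  qed
qed

text \<open>After normalising one row to \<open>1\<close>, the remaining entries are an ultrametric.\<close>

lemma weak_zero_imp_lor:
  assumes I: "finite I" and sym: "sym_on I H" and nn: "\<And>i j. i \<in> I \<Longrightarrow> j \<in> I \<Longrightarrow> 0 \<le> H i j"
    and w: "weak_zero I H"
  shows "lor I H"
proof (cases "\<forall>i\<in>I. \<forall>j\<in>I. H i j = 0")
  case True
  then have "qform I H x = 0" for x unfolding bform_def by simp
  then show ?thesis unfolding lor_def by auto
next
  case False
  then obtain z c where zc: "z \<in> I" "c \<in> I" "H z c \<noteq> 0" by blast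
  have symH: "H i j = H j i" if "i \<in> I" "j \<in> I" for i j using sym that unfolding sym_on_def by blast
  have wz: "H i j * H k l \<le> max (H i k * H j l) (H i l * H j k)"
    if "i \<in> I" "j \<in> I" "k \<in> I" "l \<in> I" for i j k l
    using w that unfolding weak_zero_def by blast
  \<comment> \<open>Indices outside \<open>insert z A\<close> have a zero entry with
    \<open>z\<close> and are left to the collapse at the end. On \<open>A\<close> the factors
    \<open>D\<close> normalise the entries with \<open>z\<close> to 1.\<close>
  define A where "A = {i \<in> I. H i z \<noteq> 0} - {z}"
  have AI: "A \<subseteq> I" "z \<notin> A" "finite A" using I unfolding A_def by auto
  have pos: "0 < H i z" if "i \<in> A" for i using that nn zc unfolding A_def by (auto simp: less_le)
  define D where "D i = (if i = z then 1 else 1 / H i z)" for i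
  define K where "K i j = D i * D j * H i j" for i j
  have symK: "K i j = K j i" if "i \<in> I" "j \<in> I" for i j using symH[OF that] unfolding K_def by simp
  have Kz: "K i z = 1" "K z i = 1" if "i \<in> A" for i
    using pos[OF that] that AI zc symH[of z i] unfolding K_def D_def by auto
  have K0: "0 \<le> K i j" if "i \<in> insert z A" "j \<in> insert z A" for i j
  proof -
    have "0 \<le> D k" if "k \<in> insert z A" for k using that less_imp_le[OF pos] unfolding D_def by auto
    moreover have "0 \<le> H i j" using that AI zc by (intro nn) auto
    ultimately show ?thesis using that unfolding K_def by simp
  qed
  \<comment> \<open>The tropical relation for \<open>i\<close>, \<open>j\<close>, \<open>k\<close>,
    \<open>z\<close>: after normalisation, the factors involving \<open>z\<close> become 1.\<close>
  have ultra: "K i j \<le> max (K i k) (K k j)" if ijk: "i \<in> A" "j \<in> A" "k \<in> A" for i j k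
  proof -
    have "D i * D j * D k * (H i j * H k z) \<le> D i * D j * D k * max (H i k * H j z) (H i z * H j k)"
      using wz[of i j k z] pos ijk AI zc less_imp_le[OF pos] by (intro mult_left_mono) (auto simp: D_def)
    moreover have "D i * D j * D k * (H i j * H k z) = K i j" "D i * D j * D k * (H i k * H j z) = K i k"
      "D i * D j * D k * (H i z * H j k) = K j k"
      using pos[OF ijk(1)] pos[OF ijk(2)] pos[OF ijk(3)] ijk AI unfolding K_def D_def by (auto simp: field_simps)
    moreover have "D i * D j * D k * max (H i k * H j z) (H i z * H j k) =
        max (D i * D j * D k * (H i k * H j z)) (D i * D j * D k * (H i z * H j k))"
      using pos[OF ijk(1)] pos[OF ijk(2)] pos[OF ijk(3)] ijk AI unfolding D_def
      by (subst max_mult_distrib_left) auto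
    moreover have "K j k = K k j" using symK ijk AI by blast
    ultimately show ?thesis by simp
  qed
  \<comment> \<open>The relation for \<open>z\<close>, \<open>z\<close>, \<open>i\<close>,
    \<open>j\<close>, whose right-hand products both normalise to 1. It ensures that
    \<open>K z z\<close> is compatible with the bound \<open>M\<close> chosen next.\<close>
  have Kzz: "K z z * K i j \<le> 1" if ij: "i \<in> A" "j \<in> A" for i j
  proof -
    have "D i * D j * (H z z * H i j) \<le> D i * D j * max (H z i * H z j) (H z j * H z i)"
      using wz[of z z i j] ij AI zc less_imp_le[OF pos] by (intro mult_left_mono) (auto simp: D_def)
    also have "D i * D j * max (H z i * H z j) (H z j * H z i) = 1"
    proof -
      have "i \<in> I" "j \<in> I" "i \<noteq> z" "j \<noteq> z" using ij AI by auto
      moreover from this have "H z i = H i z" "H z j = H j z" using symH zc(1) by blast+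
      ultimately show ?thesis using pos[OF ij(1)] pos[OF ij(2)] unfolding D_def
        by (simp add: mult.commute[of "H j z"])
    qed
    also have "D i * D j * (H z z * H i j) = K z z * K i j" unfolding K_def by (simp add: D_def)
    finally show ?thesis .
  qed
  \<comment> \<open>The largest entry on \<open>A\<close> works if it is positive. Otherwise every
    positive \<open>M\<close> bounds the entries, and only \<open>K z z * M \<le> 1\<close>
    restricts the choice.\<close>
  have "\<exists>M>0. (\<forall>i\<in>A. \<forall>j\<in>A. K i j \<le> M) \<and> K z z * M \<le> 1"
  proof (cases "\<exists>i\<in>A. \<exists>j\<in>A. K i j > 0")
    case True
    let ?V = "(\<lambda>(i,j). K i j) ` (A \<times> A)"
    have V: "finite ?V" "?V \<noteq> {}" using AI True by auto
    have "Max ?V \<in> ?V" using V by (rule Max_in)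
    then have "K z z * Max ?V \<le> 1" using Kzz by auto
    moreover have "K i j \<le> Max ?V" if "i \<in> A" "j \<in> A" for i j using V that by (intro Max_ge) auto
    ultimately show ?thesis using True by (intro exI[of _ "Max ?V"]) force
  next
    case False
    then have "K i j \<le> 0" if "i \<in> A" "j \<in> A" for i j using that by (meson not_le)
    moreover have M: "0 < (if K z z = 0 then 1 else 1 / K z z)" (is "0 < ?M")
      using K0[of z z] by auto
    ultimately have "K i j \<le> ?M" if "i \<in> A" "j \<in> A" for i j
      using that by (meson less_imp_le order_trans)
    then show ?thesis using M by (intro exI[of _ ?M]) auto
  qed
  then obtain M where M: "M > 0" "\<And>i j. i \<in> A \<Longrightarrow> j \<in> A \<Longrightarrow> K i j \<le> M" "K z z * M \<le> 1" by blast
  \<comment> \<open>Since \<open>v z * v i = 1 = K z i\<close> on \<open>A\<close>, row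
    \<open>z\<close> decouples: what remains is \<open>1 / M - K z z\<close> and the ultrametric
    form on \<open>A\<close>.\<close>
  define v where "v i = (if i = z then 1 / sqrt M else sqrt M)" for i
  have "psd (insert z A) (\<lambda>i j. v i * v j - K i j)"
  proof (rule psdI)
    fix x
    have "qform (insert z A) (\<lambda>i j. v i * v j - K i j) x = (1 / M - K z z) * (x z)\<^sup>2 + qform A (\<lambda>i j. M - K i j) x"
    proof -
      define Z where "Z i j = (if i = z \<and> j = z then 1 / M - K z z else if i = z \<or> j = z then 0 else M - K i j)" for i j
      have "qform (insert z A) (\<lambda>i j. v i * v j - K i j) x = qform (insert z A) Z x"
        using M(1) AI by (intro bform_cong) (auto simp: v_def Kz Z_def)
      also have "\<dots> = (1 / M - K z z) * (x z)\<^sup>2 + qform A (\<lambda>i j. M - K i j) x"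
      proof -
        have "Z z z = 1 / M - K z z" unfolding Z_def by simp
        moreover have "(\<Sum>j\<in>A. Z z j * x z * x j) = 0" "(\<Sum>i\<in>A. Z i z * x i * x z) = 0"
          using AI unfolding Z_def by (auto intro!: sum.neutral)
        moreover have "(\<Sum>i\<in>A. \<Sum>j\<in>A. Z i j * x i * x j) = (\<Sum>i\<in>A. \<Sum>j\<in>A. (M - K i j) * x i * x j)"
          using AI unfolding Z_def by (intro sum.cong refl) auto
        ultimately show ?thesis using AI unfolding bform_def by (simp add: power2_eq_square sum.distrib)
      qed
      finally show ?thesis .
    qed
    moreover have "0 \<le> 1 / M - K z z" using M by (simp add: field_simps)
    moreover have "0 \<le> qform A (\<lambda>i j. M - K i j) x"
    proof (intro psd_nonneg psd_ultrametric[OF AI(3) _ ultra M(2)])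
      fix i j assume "i \<in> A" "j \<in> A"
      then show "K i j = K j i" using AI(1) by (intro symK) auto
    qed
    ultimately show "0 \<le> qform (insert z A) (\<lambda>i j. v i * v j - K i j) x" by simp
  next
    fix i j assume "i \<in> insert z A" "j \<in> insert z A"
    then show "v i * v j - K i j = v j * v i - K j i" using symK[of i j] AI zc by auto
  qed
  then have "lor (insert z A) K" by (rule psd_imp_lor)
  from lor_scale[OF this, of "\<lambda>i. 1 / D i"] have "lor (insert z A) H"
  proof (rule lor_cong[THEN iffD1, rotated])
    fix i j assume "i \<in> insert z A" "j \<in> insert z A"
    then have "D i \<noteq> 0" "D j \<noteq> 0" using pos unfolding D_def by (auto simp: less_le)
    then show "1 / D i * (1 / D j) * K i j = H i j" unfolding K_def by simp
  qed
  then show ?thesis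
  proof (rule lor_collapse[OF I sym, rotated 4])
    show "weak_infty I H" by (rule weak_zero_imp_infty[OF sym nn w])
    show "insert z A \<subseteq> I" using AI zc by blast
    show "\<exists>r\<in>insert z A. i = r \<or> H i r = 0" if "i \<in> I" for i using that unfolding A_def by auto
    show "\<exists>c\<in>I. H r c \<noteq> 0" if "r \<in> insert z A" for r using that zc unfolding A_def by auto
  qed
qed

section \<open>Interior points\<close>

text \<open>Function spaces carry the product topology, so compactness comes from a product of
  compact intervals. Coordinates outside \<open>R\<close> are pinned to 0, which gives the sphere
  arguments below a compact set.\<close>

lemma compact_box_fun:
  "compact {x :: 'a \<Rightarrow> real. \<forall>i. x i \<in> (if i \<in> R then {-1..1} else {0})}"
proof -
  have "compactin (product_topology (\<lambda>i. euclidean) UNIV) (PiE UNIV (\<lambda>i::'a. if i \<in> R then {-1..1} else {0::real}))"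
    by (subst compactin_PiE) auto
  moreover have "PiE UNIV (\<lambda>i::'a. if i \<in> R then {-1..1} else {0::real}) =
      {x. \<forall>i. x i \<in> (if i \<in> R then {-1..1} else {0})}" by (auto simp: PiE_def Pi_def)
  ultimately show ?thesis by (simp add: euclidean_product_topology)
qed

lemma compact_l1_sphere:
  fixes C :: "('a \<Rightarrow> real) set"
  assumes R: "finite R" and C: "closed C"
  shows "compact {x \<in> C. (\<forall>i. i \<notin> R \<longrightarrow> x i = 0) \<and> (\<Sum>i\<in>R. \<bar>x i\<bar>) = 1}"
proof -
  have "closed {x :: 'a \<Rightarrow> real. (\<Sum>i\<in>R. \<bar>x i\<bar>) = 1}"
    by (intro closed_Collect_eq continuous_on_const continuous_on_sum continuous_on_rabs continuous_on_product_coordinates)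
  then have cl: "closed (C \<inter> {x. (\<Sum>i\<in>R. \<bar>x i\<bar>) = 1})" using C by blast
  have box: "\<bar>x i\<bar> \<le> 1" if "(\<Sum>i\<in>R. \<bar>x i\<bar>) = 1" "i \<in> R" for x :: "'a \<Rightarrow> real" and i
    using member_le_sum[of i R "\<lambda>i. \<bar>x i\<bar>"] that R by simp
  have "{x \<in> C. (\<forall>i. i \<notin> R \<longrightarrow> x i = 0) \<and> (\<Sum>i\<in>R. \<bar>x i\<bar>) = 1} =
    {x. \<forall>i. x i \<in> (if i \<in> R then {-1..1} else {0})} \<inter> (C \<inter> {x. (\<Sum>i\<in>R. \<bar>x i\<bar>) = 1})"
    using box by (auto simp: abs_le_iff split: if_splits)
  then show ?thesis using compact_Int_closed[OF compact_box_fun cl] by simp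
qed

lemma sphere_lower_bound:
  fixes f :: "('a \<Rightarrow> real) \<Rightarrow> real"
  assumes R: "finite R" and f: "continuous_on UNIV f" and pos: "\<And>x. (\<Sum>i\<in>R. \<bar>x i\<bar>) = 1 \<Longrightarrow> 0 < f x"
  shows "\<exists>m>0. \<forall>x. (\<forall>i. i \<notin> R \<longrightarrow> x i = 0) \<longrightarrow> (\<Sum>i\<in>R. \<bar>x i\<bar>) = 1 \<longrightarrow> m \<le> f x"
proof -
  define S where "S = {x :: 'a \<Rightarrow> real. x \<in> UNIV \<and> (\<forall>i. i \<notin> R \<longrightarrow> x i = 0) \<and> (\<Sum>i\<in>R. \<bar>x i\<bar>) = 1}"
  have S: "compact S" unfolding S_def by (rule compact_l1_sphere[OF R closed_UNIV])
  show ?thesis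
  proof (cases "S = {}")
    case True
    then show ?thesis unfolding S_def by (intro exI[of _ 1]) auto
  next
    case False
    from continuous_attains_inf[OF S False continuous_on_subset[OF f]]
    obtain x where x: "x \<in> S" "\<And>y. y \<in> S \<Longrightarrow> f x \<le> f y" by auto
    then have "0 < f x" using pos unfolding S_def by blast
    then show ?thesis using x unfolding S_def by (intro exI[of _ "f x"]) blast
  qed
qed

text \<open>If the form vanished at \<open>y\<close>, so would the diagonal correction and the form
  of every power \<open>Q^k\<close>. The correction forces \<open>Q i i = 1\<close> wherever
  \<open>y i\<close> is nonzero; in the limit of high powers only the entries equal to 1 survive,
  and these are diagonal, so \<open>y = 0\<close>.\<close>

lemma binomial_form_pos:
  assumes R: "finite R" and Q: "psd R Q" and b: "\<And>i j. i \<in> R \<Longrightarrow> j \<in> R \<Longrightarrow> \<bar>Q i j\<bar> \<le> 1"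
    and off: "\<And>i j. i \<in> R \<Longrightarrow> j \<in> R \<Longrightarrow> i \<noteq> j \<Longrightarrow> Q i j \<noteq> 1"
    and p: "0 < p" "p < 1" and \<kappa>: "\<kappa> < 1" and y: "\<exists>i\<in>R. y i \<noteq> 0"
  shows "0 < qform R (\<lambda>i j. 1 - (if i = j then \<kappa> else 1) * (1 - Q i j) powr p) y"
proof (rule ccontr)
  assume neg: "\<not> ?thesis"
  define T where "T K = (\<lambda>i j. 1 - (1 - Q i j) powr p - (\<Sum>k\<in>{1..K}. binom_coeff p k * Q i j ^ k))" for K
  define Dg where "Dg = (\<Sum>i\<in>R. (1 - \<kappa>) * (1 - Q i i) powr p * y i * y i)"
  have dg: "0 \<le> (1 - \<kappa>) * (1 - Q i i) powr p * y i * y i" for i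
    using \<kappa> by (simp add: mult.assoc)
  have split: "qform R (\<lambda>i j. 1 - (if i = j then \<kappa> else 1) * (1 - Q i j) powr p) y =
      qform R (T K) y + (\<Sum>k\<in>{1..K}. binom_coeff p k * qform R (\<lambda>i j. Q i j ^ k) y) + Dg" for K
  proof -
    have "qform R (\<lambda>i j. 1 - (if i = j then \<kappa> else 1) * (1 - Q i j) powr p) y =
        qform R (\<lambda>i j. (T K i j + (\<Sum>k\<in>{1..K}. binom_coeff p k * Q i j ^ k)) + (if i = j then (1 - \<kappa>) * (1 - Q i i) powr p else 0)) y"
      by (intro bform_cong) (auto simp: T_def algebra_simps)
    then show ?thesis unfolding bform_add_form bform_sum_form bform_scale_form bform_diag[OF R] Dg_def .
  qed
  have T0: "0 \<le> qform R (T K) y" for K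
    unfolding T_def by (intro psd_nonneg psd_binomial_tail R Q b p)
  have term0: "0 \<le> binom_coeff p k * qform R (\<lambda>i j. Q i j ^ k) y" if "1 \<le> k" for k
    using binom_coeff_pos[OF p, of k] that psd_nonneg[OF psd_power[OF R Q]] by simp
  have S0: "0 \<le> (\<Sum>k\<in>{1..K}. binom_coeff p k * qform R (\<lambda>i j. Q i j ^ k) y)" for K
    using term0 by (intro sum_nonneg) simp
  have D0: "0 \<le> Dg" unfolding Dg_def using dg by (intro sum_nonneg)
  have "Dg = 0" using neg split[of 0] T0[of 0] D0 by simp
  then have Dg: "(1 - \<kappa>) * (1 - Q i i) powr p * y i * y i = 0" if "i \<in> R" for i
    unfolding Dg_def using dg R that by (subst (asm) sum_nonneg_eq_0_iff) auto
  have pw: "qform R (\<lambda>i j. Q i j ^ k) y = 0" if k: "1 \<le> k" for k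
  proof -
    have "(\<Sum>k\<in>{1..k}. binom_coeff p k * qform R (\<lambda>i j. Q i j ^ k) y) = 0"
      using neg split[of k] T0[of k] D0 S0[of k] by linarith
    then have "binom_coeff p k * qform R (\<lambda>i j. Q i j ^ k) y = 0"
      using k term0 by (subst (asm) sum_nonneg_eq_0_iff) auto
    then show ?thesis using binom_coeff_pos[OF p, of k] k by auto
  qed
  \<comment> \<open>An even and the following odd power are added so that entries equal to -1
    cancel; entries equal to 1 contribute 2.\<close>
  have "(\<lambda>k. qform R (\<lambda>i j. Q i j ^ (2 * k + 2) + Q i j ^ (2 * k + 3)) y)
      \<longlonglongrightarrow> qform R (\<lambda>i j. if i = j then if Q i i = 1 then 2 else 0 else 0) y"
  proof (rule tendsto_bform)
    fix i j assume ij: "i \<in> R" "j \<in> R"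
    let ?q = "Q i j"
    have "(\<lambda>k. ?q ^ (2 * k + 2) + ?q ^ (2 * k + 3)) \<longlonglongrightarrow> (if ?q = 1 then 2 else 0)"
    proof -
      consider "?q = 1" | "?q = - 1" | "\<bar>?q\<bar> < 1" using b[OF ij] by linarith
      then show ?thesis
      proof cases
        case 3
        have "(\<lambda>k. (?q ^ 2) ^ k * (?q ^ 2 + ?q ^ 3)) \<longlonglongrightarrow> 0 * (?q ^ 2 + ?q ^ 3)"
          using 3 by (intro tendsto_mult tendsto_const LIMSEQ_power_zero) (simp add: abs_square_less_1)
        moreover have "(?q ^ 2) ^ k * (?q ^ 2 + ?q ^ 3) = ?q ^ (2 * k + 2) + ?q ^ (2 * k + 3)" for k
          by (simp only: power_add power_mult distrib_left)
        ultimately show ?thesis using 3 by (simp del: power_Suc)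
      qed simp_all
    qed
    then show "(\<lambda>k. ?q ^ (2 * k + 2) + ?q ^ (2 * k + 3)) \<longlonglongrightarrow> (if i = j then if Q i i = 1 then 2 else 0 else 0)"
      using off[OF ij] by (auto split: if_splits)
  qed
  moreover have "qform R (\<lambda>i j. Q i j ^ (2 * k + 2) + Q i j ^ (2 * k + 3)) y = 0" for k
    unfolding bform_add_form using pw[of "2 * k + 2"] pw[of "2 * k + 3"] by simp
  ultimately have "qform R (\<lambda>i j. if i = j then if Q i i = 1 then 2 else 0 else 0) y = 0"
    by (simp add: LIMSEQ_const_iff)
  then have "(\<Sum>i\<in>R. (if Q i i = 1 then 2 else 0) * y i * y i) = 0"
    unfolding bform_diag[OF R] .
  then have one: "(if Q i i = 1 then 2 else 0) * y i * y i = 0" if "i \<in> R" for i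
    using R that by (subst (asm) sum_nonneg_eq_0_iff) (auto simp: mult.assoc)
  have "y i = 0" if "i \<in> R" for i
    using one[OF that] Dg[OF that] \<kappa> b[OF that that] by (auto split: if_splits)
  then show False using y by blast
qed

text \<open>On a maximal set \<open>R\<close> of nonzero rows with pairwise nonzero entries the
  comparison form is positive definite, which survives small perturbations. The zero pattern and
  \<open>weak_infty\<close> carry the result from \<open>R\<close> to all of
  \<open>I\<close>.\<close>

lemma lor_interior:
  assumes I: "finite I" and sym: "sym_on I H" and nn: "\<And>i j. i \<in> I \<Longrightarrow> j \<in> I \<Longrightarrow> 0 \<le> H i j"
    and lor: "lor I H" and p: "0 < p" "p < 1" and \<kappa>: "\<kappa> < 1" and r: "\<And>i. i \<in> I \<Longrightarrow> 0 < r i"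
  shows "\<exists>e>0. \<forall>G. sym_on I G \<longrightarrow> (\<forall>i\<in>I. \<forall>j\<in>I. G i j = 0 \<longleftrightarrow> H i j = 0) \<longrightarrow> weak_infty I G \<longrightarrow>
    (\<forall>i\<in>I. \<forall>j\<in>I. \<bar>G i j - r i * r j * ((if i = j then \<kappa> else 1) * H i j powr p)\<bar> < e) \<longrightarrow> lor I G"
proof -
  obtain v Q where v: "\<And>i. i \<in> I \<Longrightarrow> 0 \<le> v i" "\<And>i. i \<in> I \<Longrightarrow> v i = 0 \<longleftrightarrow> (\<forall>j\<in>I. H i j = 0)" and Q: "psd I Q"
    and H: "\<And>i j. i \<in> I \<Longrightarrow> j \<in> I \<Longrightarrow> H i j = v i * v j * (1 - Q i j)"
    and b: "\<And>i j. i \<in> I \<Longrightarrow> j \<in> I \<Longrightarrow> \<bar>Q i j\<bar> \<le> 1"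
    using lor_kernel[OF I sym nn lor] by blast
  have symH: "H i j = H j i" if "i \<in> I" "j \<in> I" for i j using sym that unfolding sym_on_def by blast
  define F where "F = {R. R \<subseteq> {i \<in> I. v i \<noteq> 0} \<and> (\<forall>i\<in>R. \<forall>j\<in>R. i \<noteq> j \<longrightarrow> H i j \<noteq> 0)}"
  have "F \<subseteq> Pow I" "{} \<in> F" unfolding F_def by auto
  then have "finite F" "F \<noteq> {}" using finite_subset[of F "Pow I"] I by auto
  from finite_has_maximal[OF this] obtain R where R: "R \<in> F" "\<And>S. S \<in> F \<Longrightarrow> R \<subseteq> S \<Longrightarrow> R = S" by blast
  have RI: "R \<subseteq> I" using R(1) unfolding F_def by blast
  have Rf: "finite R" using finite_subset[OF RI I] .
  have vR: "0 < v i" if "i \<in> R" for i using that R(1) v(1)[of i] unfolding F_def by force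
  \<comment> \<open>By maximality no index can be added to \<open>R\<close>, so it belongs to
    \<open>R\<close> or has a zero entry with an element of \<open>R\<close>; \<open>R\<close> is
    empty only if every row vanishes.\<close>
  have rep: "(\<exists>s\<in>R. i = s \<or> H i s = 0) \<or> R = {} \<and> v i = 0" if i: "i \<in> I" for i
  proof (cases "v i = 0")
    case True
    then show ?thesis using v(2)[OF i] RI by blast
  next
    case False
    show ?thesis
    proof (rule ccontr)
      assume neg: "\<not> ?thesis"
      then have "i \<notin> R" "\<And>s. s \<in> R \<Longrightarrow> H i s \<noteq> 0" by auto
      moreover from this have "H s i \<noteq> 0" if "s \<in> R" for s using symH[of s i] i RI that by auto
      ultimately have "insert i R \<in> F" using R(1) False i unfolding F_def by auto
      then show False using R(2)[of "insert i R"] \<open>i \<notin> R\<close> by blast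
    qed
  qed
  define w where "w i = r i * v i powr p" for i
  define N where "N i j = r i * r j * ((if i = j then \<kappa> else 1) * H i j powr p)" for i j
  define f where "f x = qform R (\<lambda>i j. w i * w j - N i j) x" for x
  have NQ: "w i * w j - N i j = w i * w j * (1 - (if i = j then \<kappa> else 1) * (1 - Q i j) powr p)"
    if "i \<in> I" "j \<in> I" for i j
  proof -
    have "H i j powr p = v i powr p * v j powr p * (1 - Q i j) powr p"
      using v(1)[OF that(1)] v(1)[OF that(2)] b[OF that] unfolding H[OF that] by (simp add: powr_mult)
    then show ?thesis unfolding w_def N_def by (simp add: algebra_simps)
  qed
  have fpos: "0 < f x" if nz: "\<exists>i\<in>R. x i \<noteq> 0" for x
  proof -
    have "f x = qform R (\<lambda>i j. 1 - (if i = j then \<kappa> else 1) * (1 - Q i j) powr p) (\<lambda>i. w i * x i)"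
      unfolding f_def bform_def
    proof (intro sum.cong refl)
      fix i j assume "i \<in> R" "j \<in> R"
      then have "i \<in> I" "j \<in> I" using RI by auto
      then show "(w i * w j - N i j) * x i * x j =
        (1 - (if i = j then \<kappa> else 1) * (1 - Q i j) powr p) * (w i * x i) * (w j * x j)"
        unfolding NQ[OF \<open>i \<in> I\<close> \<open>j \<in> I\<close>] by (simp only: ac_simps)
    qed
    also have "\<dots> > 0"
    proof (rule binomial_form_pos[OF Rf _ _ _ p \<kappa>])
      show "psd R Q"
      proof (rule psdI)
        fix x
        have "qform R Q x = qform I Q (\<lambda>i. if i \<in> R then x i else 0)"
        proof -
          have s: "(\<Sum>i\<in>I. if i \<in> R then h i else 0) = (\<Sum>i\<in>R. h i)" for h :: "'a \<Rightarrow> real"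
            using I RI by (simp add: sum.inter_restrict[symmetric] Int_absorb1)
          have "qform I Q (\<lambda>i. if i \<in> R then x i else 0) =
              (\<Sum>i\<in>I. if i \<in> R then (\<Sum>j\<in>I. if j \<in> R then Q i j * x i * x j else 0) else 0)"
            unfolding bform_def by (intro sum.cong refl) (auto intro!: sum.cong)
          then show ?thesis unfolding s bform_def by simp
        qed
        then show "0 \<le> qform R Q x" using psd_nonneg[OF Q] by simp
      next
        fix i j assume "i \<in> R" "j \<in> R"
        then show "Q i j = Q j i" using RI by (intro psd_sym[OF Q]) auto
      qed
      show "\<bar>Q i j\<bar> \<le> 1" if "i \<in> R" "j \<in> R" for i j using that RI by (intro b) auto
      show "Q i j \<noteq> 1" if "i \<in> R" "j \<in> R" "i \<noteq> j" for i j
      proof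
        assume "Q i j = 1"
        moreover have "i \<in> I" "j \<in> I" using that RI by auto
        ultimately have "H i j = 0" using H by simp
        then show False using R(1) that unfolding F_def by blast
      qed
      obtain i where i: "i \<in> R" "x i \<noteq> 0" using nz by blast
      then have "w i \<noteq> 0" using vR[of i] r[of i] RI unfolding w_def by auto
      then show "\<exists>i\<in>R. w i * x i \<noteq> 0" using i by auto
    qed
    finally show ?thesis .
  qed
  have cont: "continuous_on UNIV f" unfolding f_def bform_def
    by (intro continuous_on_sum continuous_on_mult continuous_on_const continuous_on_product_coordinates)
  \<comment> \<open>The sphere is taken in the sum norm because then \<open>m\<close> is itself the
    admissible perturbation of each entry: the products of the absolute values of the coordinates
    sum to the square of that norm.\<close>
  obtain m where m: "m > 0" "\<And>x. (\<forall>i. i \<notin> R \<longrightarrow> x i = 0) \<Longrightarrow> (\<Sum>i\<in>R. \<bar>x i\<bar>) = 1 \<Longrightarrow> m \<le> f x"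
  proof -
    have "0 < f x" if "(\<Sum>i\<in>R. \<bar>x i\<bar>) = 1" for x
    proof (rule fpos, rule ccontr)
      assume "\<not> (\<exists>i\<in>R. x i \<noteq> 0)"
      then show False using that by simp
    qed
    then show thesis using sphere_lower_bound[OF Rf cont] that by blast
  qed
  have lower: "m * (\<Sum>i\<in>R. \<bar>x i\<bar>)\<^sup>2 \<le> f x" for x
  proof (cases "(\<Sum>i\<in>R. \<bar>x i\<bar>) = 0")
    case True
    then have "\<forall>i\<in>R. x i = 0" using Rf by (subst (asm) sum_nonneg_eq_0_iff) auto
    then have "f x = 0" unfolding f_def bform_def by simp
    then show ?thesis using True by simp
  next
    case False
    define s where "s = (\<Sum>i\<in>R. \<bar>x i\<bar>)"
    have s: "s > 0" using False unfolding s_def by (simp add: less_le sum_nonneg)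
    define y where "y i = (if i \<in> R then x i / s else 0)" for i
    have "(\<Sum>i\<in>R. \<bar>y i\<bar>) = (\<Sum>i\<in>R. \<bar>x i\<bar>) / s"
      unfolding sum_divide_distrib using s by (intro sum.cong refl) (simp add: y_def)
    also have "\<dots> = 1" using s unfolding s_def by simp
    finally have "m \<le> f y" by (intro m(2)) (auto simp: y_def)
    have "f x = f (\<lambda>i. s * y i)" unfolding f_def by (intro bform_cong) (use s in \<open>auto simp: y_def\<close>)
    also have "\<dots> = s * (s * f y)" unfolding f_def bform_scale_left bform_scale_right ..
    finally show ?thesis using \<open>m \<le> f y\<close> s unfolding s_def[symmetric]
      by (simp add: power2_eq_square mult.commute mult.assoc)
  qed
  show ?thesis
  proof (intro exI[of _ m] conjI allI impI)
    show "m > 0" by (rule m)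
    fix G assume G: "sym_on I G" "\<forall>i\<in>I. \<forall>j\<in>I. G i j = 0 \<longleftrightarrow> H i j = 0" "weak_infty I G"
      and close: "\<forall>i\<in>I. \<forall>j\<in>I. \<bar>G i j - r i * r j * ((if i = j then \<kappa> else 1) * H i j powr p)\<bar> < m"
    have "qform R G x \<le> (\<Sum>i\<in>R. w i * x i)\<^sup>2" for x
    proof -
      have "qform R G x - qform R N x = (\<Sum>i\<in>R. \<Sum>j\<in>R. (G i j - N i j) * x i * x j)"
        by (simp add: bform_def sum_subtractf left_diff_distrib)
      also have "\<dots> \<le> (\<Sum>i\<in>R. \<Sum>j\<in>R. m * (\<bar>x i\<bar> * \<bar>x j\<bar>))"
      proof (intro sum_mono)
        fix i j assume "i \<in> R" "j \<in> R"
        then have "\<bar>G i j - N i j\<bar> \<le> m" using close RI unfolding N_def by (meson less_imp_le subsetD)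
        then have "\<bar>G i j - N i j\<bar> * (\<bar>x i\<bar> * \<bar>x j\<bar>) \<le> m * (\<bar>x i\<bar> * \<bar>x j\<bar>)" by (intro mult_right_mono) auto
        then show "(G i j - N i j) * x i * x j \<le> m * (\<bar>x i\<bar> * \<bar>x j\<bar>)"
          by (metis abs_le_D1 abs_mult mult.assoc)
      qed
      also have "\<dots> = m * (\<Sum>i\<in>R. \<bar>x i\<bar>)\<^sup>2"
        unfolding power2_eq_square sum_product by (simp only: sum_distrib_left)
      also have "\<dots> \<le> f x" by (rule lower)
      also have "f x = (\<Sum>i\<in>R. w i * x i)\<^sup>2 - qform R N x"
        unfolding f_def bform_diff_form bform_rank_one power2_eq_square ..
      finally show ?thesis by simp
    qed
    then have lorR: "lor R G" unfolding lor_def by blast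
    show "lor I G"
    proof (cases "\<forall>i\<in>I. \<forall>j\<in>I. H i j = 0")
      case True
      then have "qform I G x = 0" for x using G(2) unfolding bform_def by simp
      then show ?thesis unfolding lor_def by auto
    next
      case False
      then obtain i0 where i0: "i0 \<in> I" "v i0 \<noteq> 0" using v(2) by blast
      show ?thesis
      proof (rule lor_collapse[OF I G(1,3) RI _ _ lorR])
        fix i assume i: "i \<in> I"
        have "R \<noteq> {}" using rep[OF i0(1)] i0(2) by auto
        then obtain s where "s \<in> R" "i = s \<or> H i s = 0" using rep[OF i] by blast
        then show "\<exists>s\<in>R. i = s \<or> G i s = 0" using G(2) i RI by blast
      next
        fix s assume "s \<in> R"
        then have "s \<in> I" "v s \<noteq> 0" using RI vR[of s] by auto
        then show "\<exists>c\<in>I. G s c \<noteq> 0" using v(2)[of s] G(2) by blast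
      qed
    qed
  qed
qed

section \<open>The spectral theorem\<close>

definition orthonormal_eigvecs :: "nat \<Rightarrow> (nat \<Rightarrow> nat \<Rightarrow> real) \<Rightarrow> nat \<Rightarrow> (nat \<Rightarrow> real) \<Rightarrow> (nat \<Rightarrow> nat \<Rightarrow> real) \<Rightarrow> bool" where
  "orthonormal_eigvecs n H m e q \<longleftrightarrow>
     (\<forall>a<m. \<forall>b<m. (\<Sum>k<n. q a k * q b k) = (if a = b then 1 else 0)) \<and>
     (\<forall>a<m. \<forall>i<n. (\<Sum>j<n. H i j * q a j) = e a * q a i)"

text \<open>The \<open>m < n\<close> conditions, padded by zero rows, form a square matrix. Its last
  row is zero, so its determinant vanishes and it has a nontrivial kernel.\<close>

lemma exists_orthogonal_vector:
  fixes q :: "nat \<Rightarrow> nat \<Rightarrow> real"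
  assumes "m < n"
  shows "\<exists>x. (\<exists>k<n. x k \<noteq> 0) \<and> (\<forall>a<m. (\<Sum>k<n. q a k * x k) = 0)"
proof -
  define M where "M = Matrix.mat n n (\<lambda>(i, k). if i = n - 1 then 0 else if i < m then q i k else 0)"
  have M: "M \<in> carrier_mat n n" unfolding M_def by simp
  have "det (mat\<^sub>r n n (\<lambda>i. if i = n - 1 then 0\<^sub>v n else Matrix.vec n (\<lambda>k. if i < m then q i k else 0))) = 0"
    using assms by (intro det_row_0) auto
  moreover have "mat\<^sub>r n n (\<lambda>i. if i = n - 1 then 0\<^sub>v n else Matrix.vec n (\<lambda>k. if i < m then q i k else 0)) = M"
    unfolding M_def by (intro eq_matI) auto
  ultimately have "det M = 0" by simp
  then obtain v where v: "v \<in> carrier_vec n" "v \<noteq> 0\<^sub>v n" "M *\<^sub>v v = 0\<^sub>v n"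
    using det_0_iff_vec_prod_zero[OF M] by blast
  have "\<exists>k<n. vec_index v k \<noteq> 0"
  proof (rule ccontr)
    assume "\<not> ?thesis"
    then have "v = 0\<^sub>v n" using v(1) by (intro eq_vecI) auto
    then show False using v(2) by simp
  qed
  moreover have "(\<Sum>k<n. q a k * vec_index v k) = 0" if a: "a < m" for a
  proof -
    have "vec_index (M *\<^sub>v v) a = (\<Sum>k<n. q a k * vec_index v k)"
    proof -
      have "a < n" "a \<noteq> n - 1" using a assms by auto
      then show ?thesis using a v(1) unfolding M_def by (simp add: scalar_prod_def atLeast0LessThan)
    qed
    then show ?thesis using v(3) a assms by simp
  qed
  ultimately show ?thesis by blast
qed

text \<open>The quadratic form attains its maximum on the compact unit sphere of the orthogonal
  complement of the given vectors; homogeneity extends the inequality to all \<open>y\<close> in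
  that complement.\<close>

lemma Rayleigh_maximizer:
  fixes H :: "nat \<Rightarrow> nat \<Rightarrow> real"
  assumes mn: "m < n"
  obtains x where "\<And>k. n \<le> k \<Longrightarrow> x k = 0" "(\<Sum>k<n. x k * x k) = 1" "\<And>a. a < m \<Longrightarrow> (\<Sum>k<n. q a k * x k) = 0"
    "\<And>y. (\<And>a. a < m \<Longrightarrow> (\<Sum>k<n. q a k * y k) = 0) \<Longrightarrow>
      qform {..<n} H y \<le> qform {..<n} H x * (\<Sum>k<n. y k * y k)"
proof -
  define U where "U = {x. (\<forall>a<m. (\<Sum>k<n. q a k * x k) = 0) \<and> (\<Sum>k<n. x k * x k) = (1::real)}"
  define S where "S = {x :: nat \<Rightarrow> real. \<forall>i. x i \<in> (if i \<in> {..<n} then {-1..1} else {0})} \<inter> U"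
  have "U = (\<Inter>a\<in>{..<m}. {x. (\<Sum>k<n. q a k * x k) = 0}) \<inter> {x. (\<Sum>k<n. x k * x k) = 1}"
    unfolding U_def by auto
  also have "closed \<dots>"
    by (intro closed_Int closed_INT ballI closed_Collect_eq continuous_on_const continuous_on_sum
        continuous_on_mult continuous_on_product_coordinates)
  finally have "closed U" .
  then have S: "compact S" unfolding S_def using compact_Int_closed[OF compact_box_fun] by blast
  have norm_in_S: "(\<lambda>k. if k < n then y k / sqrt (\<Sum>k<n. y k * y k) else 0) \<in> S"
    if y: "\<And>a. a < m \<Longrightarrow> (\<Sum>k<n. q a k * y k) = 0" "(\<Sum>k<n. y k * y k) \<noteq> 0" for y :: "nat \<Rightarrow> real"
  proof -
    define s where "s = sqrt (\<Sum>k<n. y k * y k)"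
    have sp: "(\<Sum>k<n. y k * y k) > 0" using y(2) by (simp add: less_le sum_nonneg)
    have s: "s > 0" "s\<^sup>2 = (\<Sum>k<n. y k * y k)" unfolding s_def using sp by simp_all
    define z where "z k = (if k < n then y k / s else 0)" for k
    have zz: "(\<Sum>k<n. z k * z k) = 1"
    proof -
      have "(\<Sum>k<n. z k * z k) = (\<Sum>k<n. y k * y k / s\<^sup>2)"
        by (intro sum.cong refl) (simp add: z_def power2_eq_square)
      also have "\<dots> = 1" unfolding sum_divide_distrib[symmetric] using s sp by simp
      finally show ?thesis .
    qed
    have "(\<Sum>k<n. q a k * z k) = (\<Sum>k<n. q a k * y k) / s" for a
      unfolding sum_divide_distrib by (intro sum.cong refl) (simp add: z_def)
    moreover have "z k * z k \<le> 1" if "k < n" for k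
      using member_le_sum[of k "{..<n}" "\<lambda>k. z k * z k"] zz that by simp
    then have "\<bar>z k\<bar> \<le> 1" if "k < n" for k
      using that by (metis abs_le_square_iff abs_one power2_eq_square power_one)
    then have "z k \<in> {-1..1}" if "k < n" for k using that by (auto simp: abs_le_iff)
    ultimately show ?thesis using y(1) zz unfolding S_def U_def s_def[symmetric] z_def[symmetric]
      by (auto simp: z_def)
  qed
  obtain x0 where x0: "\<exists>k<n. x0 k \<noteq> 0" "\<And>a. a < m \<Longrightarrow> (\<Sum>k<n. q a k * x0 k) = 0"
    using exists_orthogonal_vector[OF mn, of q] by blast
  have "(\<Sum>k<n. x0 k * x0 k) \<noteq> 0"
    using x0(1) by (subst sum_nonneg_eq_0_iff) auto
  then have "S \<noteq> {}" using norm_in_S x0(2) by blast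
  moreover have "continuous_on UNIV (\<lambda>x. qform {..<n} H x)" unfolding bform_def
    by (intro continuous_on_sum continuous_on_mult continuous_on_const continuous_on_product_coordinates)
  then have "continuous_on S (\<lambda>x. qform {..<n} H x)" by (rule continuous_on_subset) simp
  ultimately obtain x where x: "x \<in> S" "\<And>y. y \<in> S \<Longrightarrow> qform {..<n} H y \<le> qform {..<n} H x"
    using continuous_attains_sup[OF S] by blast
  show ?thesis
  proof (rule that[of x])
    show "x k = 0" if "n \<le> k" for k
    proof -
      have "x k \<in> (if k \<in> {..<n} then {-1..1} else {0})" using x(1) unfolding S_def by blast
      then show ?thesis using that by simp
    qed
    show "(\<Sum>k<n. x k * x k) = 1" "\<And>a. a < m \<Longrightarrow> (\<Sum>k<n. q a k * x k) = 0"
      using x(1) unfolding S_def U_def by auto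
    fix y :: "nat \<Rightarrow> real" assume y: "\<And>a. a < m \<Longrightarrow> (\<Sum>k<n. q a k * y k) = 0"
    show "qform {..<n} H y \<le> qform {..<n} H x * (\<Sum>k<n. y k * y k)"
    proof (cases "(\<Sum>k<n. y k * y k) = 0")
      case True
      then have "y k = 0" if "k < n" for k using that by (subst (asm) sum_nonneg_eq_0_iff) auto
      then have "qform {..<n} H y = 0" unfolding bform_def by simp
      then show ?thesis using True by simp
    next
      case False
      define s where "s = sqrt (\<Sum>k<n. y k * y k)"
      have sp: "(\<Sum>k<n. y k * y k) > 0" using False by (simp add: less_le sum_nonneg)
      have s: "s > 0" "s * s = (\<Sum>k<n. y k * y k)" unfolding s_def using sp by simp_all
      define z where "z k = (if k < n then y k / s else 0)" for k
      have "z \<in> S" using norm_in_S[OF y False] unfolding z_def s_def .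
      then have "qform {..<n} H z \<le> qform {..<n} H x" by (rule x(2))
      moreover have "qform {..<n} H y = qform {..<n} H (\<lambda>i. s * z i)"
        by (intro bform_cong) (use s in \<open>auto simp: z_def\<close>)
      then have "qform {..<n} H y = s * s * qform {..<n} H z"
        unfolding bform_scale_left bform_scale_right by simp
      ultimately show ?thesis using s(2)[symmetric] s(1) by (simp add: mult.commute)
    qed
  qed
qed

text \<open>The form \<open>B\<close> of \<open>l - H\<close> is nonnegative on the complement of
  the earlier eigenvectors and vanishes at the maximiser \<open>x\<close>. The residual
  \<open>y\<close> lies in that complement, so the first variation of \<open>B\<close> along it is
  0; this variation equals the squared length of \<open>y\<close>.\<close>

lemma extend_orthonormal_eigvecs:
  assumes sym: "sym_on {..<n} H" and mn: "m < n" and q: "orthonormal_eigvecs n H m e q"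
  shows "\<exists>e' q'. orthonormal_eigvecs n H (Suc m) e' q'"
proof -
  obtain x where x: "\<And>k. n \<le> k \<Longrightarrow> x k = 0" "(\<Sum>k<n. x k * x k) = 1" "\<And>a. a < m \<Longrightarrow> (\<Sum>k<n. q a k * x k) = 0"
    and max: "\<And>y. (\<And>a. a < m \<Longrightarrow> (\<Sum>k<n. q a k * y k) = 0) \<Longrightarrow>
      qform {..<n} H y \<le> qform {..<n} H x * (\<Sum>k<n. y k * y k)"
    by (rule Rayleigh_maximizer[OF mn, where q = q and H = H]) blast
  define l where "l = qform {..<n} H x"
  define B where "B i j = (if i = j then l else 0) - H i j" for i j
  have B: "bform {..<n} B u w = (\<Sum>k<n. l * u k * w k) - bform {..<n} H u w" for u w
    unfolding B_def bform_diff_form using bform_diag[of "{..<n}" "\<lambda>_. l"] by simp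
  have Bsym: "sym_on {..<n} B" using sym unfolding B_def sym_on_def by simp
  define y where "y i = l * x i - (\<Sum>j<n. H i j * x j)" for i
  have symH: "H i j = H j i" if "i < n" "j < n" for i j using sym that unfolding sym_on_def by simp
  have yq: "(\<Sum>k<n. q a k * y k) = 0" if a: "a < m" for a
  proof -
    have "(\<Sum>k<n. q a k * y k) = l * (\<Sum>k<n. q a k * x k) - (\<Sum>k<n. \<Sum>j<n. q a k * (H k j * x j))"
      unfolding y_def by (simp add: right_diff_distrib sum_subtractf sum_distrib_left mult.left_commute)
    also have "(\<Sum>k<n. \<Sum>j<n. q a k * (H k j * x j)) = (\<Sum>j<n. \<Sum>k<n. H j k * q a k * x j)"
      by (subst sum.swap, intro sum.cong refl) (simp add: symH)
    also have "\<dots> = (\<Sum>j<n. e a * q a j * x j)"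
      using q a unfolding orthonormal_eigvecs_def by (intro sum.cong refl) (simp add: sum_distrib_right[symmetric])
    also have "\<dots> = e a * (\<Sum>j<n. q a j * x j)" by (simp add: sum_distrib_left mult.assoc)
    finally show ?thesis using x(3)[OF a] by simp
  qed
  have "bform {..<n} B x y = 0"
  proof (rule nonneg_line_imp_zero)
    fix t
    let ?z = "\<lambda>k. x k + t * y k"
    have "(\<Sum>k<n. q a k * ?z k) = (\<Sum>k<n. q a k * x k) + t * (\<Sum>k<n. q a k * y k)" for a
      by (simp add: distrib_left sum.distrib sum_distrib_left mult.left_commute)
    then have "qform {..<n} H ?z \<le> l * (\<Sum>k<n. ?z k * ?z k)"
      unfolding l_def using x(3) yq by (intro max) simp
    then have "0 \<le> qform {..<n} B ?z" unfolding B by (simp add: sum_distrib_left mult.assoc)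
    also have "qform {..<n} B ?z = qform {..<n} B x + 2 * t * bform {..<n} B x y + t\<^sup>2 * qform {..<n} B y"
      by (rule qform_line[OF Bsym])
    also have "qform {..<n} B x = 0"
      unfolding B using x(2) by (simp add: mult.assoc sum_distrib_left[symmetric] l_def)
    finally show "0 \<le> 2 * t * bform {..<n} B x y + t\<^sup>2 * qform {..<n} B y" by simp
  qed
  moreover have "bform {..<n} B x y = (\<Sum>k<n. y k * y k)"
  proof -
    have "bform {..<n} B x y = bform {..<n} B y x" by (rule bform_commute[OF Bsym])
    also have "\<dots> = (\<Sum>k<n. y k * y k)"
      unfolding B by (simp add: bform_def sum_subtractf[symmetric] y_def[of k for k] right_diff_distrib sum_distrib_left algebra_simps)
    finally show ?thesis .
  qed
  ultimately have "(\<Sum>k<n. y k * y k) = 0" by simp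
  then have y0: "y k = 0" if "k < n" for k using that by (subst (asm) sum_nonneg_eq_0_iff) auto
  show ?thesis
  proof (intro exI)
    show "orthonormal_eigvecs n H (Suc m) (e(m := l)) (q(m := x))"
      unfolding orthonormal_eigvecs_def
    proof (intro conjI allI impI)
      fix a b assume "a < Suc m" "b < Suc m"
      then show "(\<Sum>k<n. (q(m := x)) a k * (q(m := x)) b k) = (if a = b then 1 else 0)"
        using q x(2,3) unfolding orthonormal_eigvecs_def
        by (auto simp: less_Suc_eq mult.commute)
    next
      fix a i assume "a < Suc m" "i < n"
      then show "(\<Sum>j<n. H i j * (q(m := x)) a j) = (e(m := l)) a * (q(m := x)) a i"
        using q y0[of i] unfolding orthonormal_eigvecs_def y_def by (auto simp: less_Suc_eq)
    qed
  qed
qed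

lemma spectral_theorem:
  assumes sym: "sym_on {..<n} H"
  obtains e q where "orthonormal_eigvecs n H n e q"
proof -
  have "m \<le> n \<Longrightarrow> \<exists>e q. orthonormal_eigvecs n H m e q" for m
  proof (induction m)
    case 0
    then show ?case by (simp add: orthonormal_eigvecs_def)
  next
    case (Suc m)
    then obtain e q where "orthonormal_eigvecs n H m e q" by auto
    then show ?case using extend_orthonormal_eigvecs[OF sym] Suc.prems by auto
  qed
  then show ?thesis using that by blast
qed

section \<open>Counting positive eigenvalues\<close>

lemma order_prod_linear:
  fixes e :: "nat \<Rightarrow> real"
  shows "(\<Prod>a<n. [:- e a, 1:]) \<noteq> 0 \<and> Polynomial.order r (\<Prod>a<n. [:- e a, 1:]) = card {a. a < n \<and> e a = r}"
proof (induction n)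
  case 0
  then show ?case by simp
next
  case (Suc n)
  define L where "L = [:- e n, 1:]"
  define P where "P = (\<Prod>a<n. [:- e a, 1:])"
  have L: "Polynomial.order r L = (if e n = r then 1 else 0)"
  proof (cases "e n = r")
    case True
    then show ?thesis using order_power_n_n[of r 1] by (simp add: L_def)
  next
    case False
    then show ?thesis by (simp add: order_0I L_def)
  qed
  have P: "P \<noteq> 0" "Polynomial.order r P = card {a. a < n \<and> e a = r}" using Suc unfolding P_def by auto
  have "{a. a < Suc n \<and> e a = r} = (if e n = r then insert n {a. a < n \<and> e a = r} else {a. a < n \<and> e a = r})"
    by (auto simp: less_Suc_eq)
  then have "card {a. a < Suc n \<and> e a = r} = card {a. a < n \<and> e a = r} + (if e n = r then 1 else 0)" by simp
  moreover have nz: "P * L \<noteq> 0" using P(1) by (intro no_zero_divisors) (simp_all add: L_def)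
  moreover have "Polynomial.order r (P * L) = card {a. a < n \<and> e a = r} + (if e n = r then 1 else 0)"
    unfolding order_mult[OF nz] L P(2) ..
  moreover have "(\<Prod>a<Suc n. [:- e a, 1:]) = P * L" unfolding P_def L_def prod.lessThan_Suc ..
  ultimately show ?case by (simp only: simp_thms)
qed

text \<open>Orthonormality says that a square matrix has its transpose as a left inverse;
  completeness says the same for a right inverse.\<close>

lemma orthonormal_eigvecs_complete:
  assumes q: "orthonormal_eigvecs n H n e q" and ij: "i < n" "j < n"
  shows "(\<Sum>a<n. q a i * q a j) = (if i = j then 1 else 0)"
proof -
  define P where "P = Matrix.mat n n (\<lambda>(i, a). q a i)"
  have P: "P \<in> carrier_mat n n" "transpose_mat P \<in> carrier_mat n n" unfolding P_def by auto
  have "transpose_mat P * P = 1\<^sub>m n"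
    using q unfolding P_def orthonormal_eigvecs_def
    by (intro eq_matI) (auto simp: scalar_prod_def atLeast0LessThan)
  then have "P * transpose_mat P = 1\<^sub>m n" using mat_mult_left_right_inverse[OF P(2,1)] by simp
  then have "(P * transpose_mat P) $$ (i, j) = (1\<^sub>m n) $$ (i, j)" by simp
  then show ?thesis using ij unfolding P_def by (simp add: scalar_prod_def atLeast0LessThan)
qed

lemma char_poly_orthonormal_eigvecs:
  assumes q: "orthonormal_eigvecs n H n e q"
  shows "char_poly (Matrix.mat n n (\<lambda>(i, j). H i j)) = (\<Prod>a<n. [:- e a, 1:])"
proof -
  define A where "A = Matrix.mat n n (\<lambda>(i, j). H i j)"
  define P where "P = Matrix.mat n n (\<lambda>(i, a). q a i)"
  define D where "D = Matrix.mat n n (\<lambda>(a, b). if a = b then e a else 0)"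
  have c: "A \<in> carrier_mat n n" "P \<in> carrier_mat n n" "transpose_mat P \<in> carrier_mat n n" "D \<in> carrier_mat n n"
    unfolding A_def P_def D_def by auto
  have 1: "transpose_mat P * P = 1\<^sub>m n"
    using q unfolding P_def orthonormal_eigvecs_def
    by (intro eq_matI) (auto simp: scalar_prod_def atLeast0LessThan)
  have 2: "P * transpose_mat P = 1\<^sub>m n" using mat_mult_left_right_inverse[OF c(3,2) 1] .
  have "A * P = P * D"
  proof (intro eq_matI)
    fix i a assume "i < dim_row (P * D)" "a < dim_col (P * D)"
    then have ia: "i < n" "a < n" using c by auto
    have "(A * P) $$ (i, a) = (\<Sum>j<n. H i j * q a j)"
      using ia unfolding A_def P_def by (simp add: scalar_prod_def atLeast0LessThan)
    also have "\<dots> = e a * q a i" using q ia unfolding orthonormal_eigvecs_def by blast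
    also have "\<dots> = (\<Sum>b<n. q b i * (if b = a then e b else 0))"
      using ia by (simp add: if_distrib cong: if_cong)
    also have "\<dots> = (P * D) $$ (i, a)"
      using ia unfolding P_def D_def by (simp add: scalar_prod_def atLeast0LessThan)
    finally show "(A * P) $$ (i, a) = (P * D) $$ (i, a)" .
  qed (use c in auto)
  then have "P * D * transpose_mat P = A * P * transpose_mat P" by simp
  also have "\<dots> = A * (P * transpose_mat P)" by (rule assoc_mult_mat[OF c(1,2,3)])
  finally have "A = P * D * transpose_mat P" using c 2 by simp
  then have "similar_mat A D" using c 1 2 by (intro similar_matI[of _ _ P "transpose_mat P" n]) auto
  then have "char_poly A = char_poly D" by (rule char_poly_similar)
  also have "\<dots> = (\<Prod>a\<leftarrow>diag_mat D. [:- a, 1:])"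
    by (rule char_poly_upper_triangular[OF c(4)]) (auto simp: D_def)
  also have "diag_mat D = map e [0..<n]" unfolding diag_mat_def D_def by (auto intro!: map_cong)
  also have "(\<Prod>a\<leftarrow>map e [0..<n]. [:- a, 1:]) = (\<Prod>a<n. [:- e a, 1:])"
    by (simp add: prod.distinct_set_conv_list[symmetric] comp_def atLeast0LessThan)
  finally show ?thesis unfolding A_def .
qed

text \<open>The order of a root of the characteristic polynomial is the number of indices carrying
  that eigenvalue, so multiplicities add up to a count of indices.\<close>

lemma at_most_one_pos_eigenvalue_iff_card:
  assumes q: "orthonormal_eigvecs n H n e q"
  shows "at_most_one_pos_eigenvalue (Matrix.mat n n (\<lambda>(i, j). H i j)) \<longleftrightarrow> card {a. a < n \<and> 0 < e a} \<le> 1"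
proof -
  let ?A = "Matrix.mat n n (\<lambda>(i, j). H i j)"
  note cp = char_poly_orthonormal_eigvecs[OF q]
  have ev: "{r. eigenvalue ?A r \<and> 0 < r} = e ` {a. a < n \<and> 0 < e a}"
    unfolding eigenvalue_root_char_poly[of ?A n, simplified] cp
    by (auto simp: poly_prod)
  have "(\<Sum>r\<in>{r. eigenvalue ?A r \<and> 0 < r}. Polynomial.order r (char_poly ?A)) =
      (\<Sum>r\<in>e ` {a. a < n \<and> 0 < e a}. card {a \<in> {a. a < n \<and> 0 < e a}. e a = r})"
    unfolding ev cp by (intro sum.cong refl) (auto simp: order_prod_linear intro!: arg_cong[of _ _ card])
  also have "\<dots> = (\<Sum>r\<in>e ` {a. a < n \<and> 0 < e a}. \<Sum>a\<in>{a \<in> {a. a < n \<and> 0 < e a}. e a = r}. 1)"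
    by simp
  also have "\<dots> = (\<Sum>a\<in>{a. a < n \<and> 0 < e a}. 1)"
    by (rule sum.group) auto
  finally show ?thesis unfolding at_most_one_pos_eigenvalue_def by simp
qed

lemma qform_spectral:
  assumes q: "orthonormal_eigvecs n H n e q"
  shows "qform {..<n} H x = (\<Sum>a<n. e a * (\<Sum>k<n. q a k * x k)\<^sup>2)"
proof -
  have H: "H i j = (\<Sum>a<n. e a * (q a i * q a j))" if ij: "i < n" "j < n" for i j
  proof -
    have "H i j = (\<Sum>k<n. H i k * (if k = j then 1 else 0))"
      using ij by (simp add: if_distrib[of "\<lambda>x. _ * x"] cong: if_cong)
    also have "\<dots> = (\<Sum>k<n. H i k * (\<Sum>a<n. q a k * q a j))"
      using ij by (intro sum.cong refl) (simp add: orthonormal_eigvecs_complete[OF q])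
    also have "\<dots> = (\<Sum>a<n. (\<Sum>k<n. H i k * q a k) * q a j)"
      unfolding sum_distrib_left sum_distrib_right by (subst sum.swap) (simp add: mult.assoc)
    also have "\<dots> = (\<Sum>a<n. e a * (q a i * q a j))"
      using q ij unfolding orthonormal_eigvecs_def by (intro sum.cong refl) simp
    finally show ?thesis .
  qed
  have "qform {..<n} H x = qform {..<n} (\<lambda>i j. \<Sum>a<n. e a * (q a i * q a j)) x"
    by (intro bform_cong) (simp_all add: H)
  then show ?thesis unfolding bform_sum_form bform_scale_form bform_rank_one power2_eq_square .
qed

text \<open>With one positive eigenvalue \<open>e a\<close>, its summand in the spectral
  decomposition is the dominating square. Conversely two orthonormal eigenvectors with positive
  eigenvalues span a plane, and that plane contains a nonzero vector annihilated by
  \<open>v\<close>.\<close>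

lemma at_most_one_pos_eigenvalue_iff_lor:
  assumes sym: "sym_on {..<n} H"
  shows "at_most_one_pos_eigenvalue (Matrix.mat n n (\<lambda>(i, j). H i j)) \<longleftrightarrow> lor {..<n} H"
proof -
  obtain e q where q: "orthonormal_eigvecs n H n e q" using spectral_theorem[OF sym] .
  note qf = qform_spectral[OF q]
  have "card {a. a < n \<and> 0 < e a} \<le> 1 \<longleftrightarrow> lor {..<n} H"
  proof
    assume "card {a. a < n \<and> 0 < e a} \<le> 1"
    then have one: "\<And>a b. a < n \<Longrightarrow> b < n \<Longrightarrow> 0 < e a \<Longrightarrow> 0 < e b \<Longrightarrow> a = b"
      using card_le_Suc0_iff_eq[of "{a. a < n \<and> 0 < e a}"] by simp
    show "lor {..<n} H"
    proof (cases "\<exists>a<n. 0 < e a")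
      case True
      then obtain a where a: "a < n" "0 < e a" by blast
      have "qform {..<n} H x \<le> (\<Sum>k<n. (sqrt (e a) * q a k) * x k)\<^sup>2" for x
      proof -
        have "qform {..<n} H x \<le> (\<Sum>b<n. if b = a then e a * (\<Sum>k<n. q a k * x k)\<^sup>2 else 0)"
          unfolding qf
        proof (intro sum_mono)
          fix b assume "b \<in> {..<n}"
          then have "e b \<le> 0" if "b \<noteq> a" using one[OF a(1), of b] a(2) that by force
          then show "e b * (\<Sum>k<n. q b k * x k)\<^sup>2 \<le> (if b = a then e a * (\<Sum>k<n. q a k * x k)\<^sup>2 else 0)"
            by (auto simp: mult_nonpos_nonneg)
        qed
        also have "\<dots> = e a * (\<Sum>k<n. q a k * x k)\<^sup>2" using a by simp
        also have "\<dots> = (sqrt (e a) * (\<Sum>k<n. q a k * x k))\<^sup>2" using a by (simp add: power_mult_distrib)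
        finally show ?thesis by (simp add: sum_distrib_left mult.assoc)
      qed
      then show ?thesis unfolding lor_def by (intro exI[of _ "\<lambda>k. sqrt (e a) * q a k"]) blast
    next
      case False
      then have "e a \<le> 0" if "a < n" for a using that by (meson not_le)
      then have "qform {..<n} H x \<le> 0" for x unfolding qf
        by (intro sum_nonpos mult_nonpos_nonneg) auto
      then show ?thesis unfolding lor_def by (intro exI[of _ "\<lambda>_. 0"]) simp
    qed
  next
    assume "lor {..<n} H"
    then obtain v where v: "\<And>x. qform {..<n} H x \<le> (\<Sum>k<n. v k * x k)\<^sup>2" unfolding lor_def by blast
    show "card {a. a < n \<and> 0 < e a} \<le> 1"
    proof (rule ccontr)
      assume "\<not> ?thesis"
      then obtain a b where ab: "a < n" "b < n" "0 < e a" "0 < e b" "a \<noteq> b"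
        using card_le_Suc0_iff_eq[of "{a. a < n \<and> 0 < e a}"] by auto
      define s where "s = (\<Sum>k<n. v k * q a k)"
      define t where "t = (\<Sum>k<n. v k * q b k)"
      have pos: "False" if c: "(\<alpha>, \<beta>) \<noteq> (0, 0)" "\<alpha> * s + \<beta> * t = 0" for \<alpha> \<beta>
      proof -
        define x where "x k = \<alpha> * q a k + \<beta> * q b k" for k
        have "(\<Sum>k<n. v k * x k) = \<alpha> * s + \<beta> * t"
          unfolding x_def s_def t_def by (simp add: distrib_left sum.distrib sum_distrib_left mult.left_commute)
        then have le: "qform {..<n} H x \<le> 0" using v[of x] c by simp
        have qx: "(\<Sum>k<n. q c k * x k) = (if c = a then \<alpha> else 0) + (if c = b then \<beta> else 0)" if "c < n" for c
        proof -
          have "(\<Sum>k<n. q c k * x k) = \<alpha> * (\<Sum>k<n. q c k * q a k) + \<beta> * (\<Sum>k<n. q c k * q b k)"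
            unfolding x_def by (simp add: distrib_left sum.distrib sum_distrib_left mult.left_commute)
          then show ?thesis using q that ab unfolding orthonormal_eigvecs_def by simp
        qed
        have "qform {..<n} H x = (\<Sum>c<n. (if c = a then e a * \<alpha>\<^sup>2 else 0) + (if c = b then e b * \<beta>\<^sup>2 else 0))"
          unfolding qf using ab by (intro sum.cong refl) (auto simp: qx)
        also have "\<dots> = e a * \<alpha>\<^sup>2 + e b * \<beta>\<^sup>2" using ab by (simp add: sum.distrib)
        also have "\<dots> > 0" using c ab by (auto intro: add_pos_nonneg add_nonneg_pos)
        finally show False using le by simp
      qed
      \<comment> \<open>The annihilated vector has coefficients (t, -s), which is nonzero unless
        \<open>s = 0\<close>; in that case \<open>q a\<close> itself is annihilated.\<close>
      show False
      proof (cases "s = 0")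
        case True
        then show ?thesis using pos[of 1 0] by simp
      next
        case False
        then show ?thesis using pos[of "t" "- s"] by simp
      qed
    qed
  qed
  then show ?thesis using at_most_one_pos_eigenvalue_iff_card[OF q] by simp
qed

section \<open>Exchange properties\<close>

declare One_nat_def [simp del]

abbreviation (input) lk :: "expo \<Rightarrow> nat \<Rightarrow> nat" where "lk \<equiv> Poly_Mapping.lookup"

lemmas lk_simps = lookup_add lookup_minus lookup_single when_def

lemma simplex_pts_iff: "\<alpha> \<in> simplex_pts n d \<longleftrightarrow> (\<forall>k. n \<le> k \<longrightarrow> lk \<alpha> k = 0) \<and> (\<Sum>k<n. lk \<alpha> k) = d"
  unfolding simplex_pts_def by (auto simp: in_keys_iff not_less[symmetric] subset_iff)

lemma sum_unit_expo: "(\<Sum>k<n. lk (unit_expo i) k) = (if i < n then 1 else 0)"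
proof -
  have "(\<Sum>k<n. lk (unit_expo i) k) = (\<Sum>k<n. if i = k then 1 else 0)"
    by (intro sum.cong refl) (simp add: lk_simps)
  then show ?thesis by simp
qed

lemma simplex_add_unit:
  "\<alpha> + unit_expo i \<in> simplex_pts n d \<longleftrightarrow> i < n \<and> 0 < d \<and> \<alpha> \<in> simplex_pts n (d - 1)"
proof -
  have "(\<Sum>k<n. lk (\<alpha> + unit_expo i) k) = (\<Sum>k<n. lk \<alpha> k) + (if i < n then 1 else 0)"
    by (simp add: lookup_add sum.distrib sum_unit_expo)
  moreover have "(\<forall>k. n \<le> k \<longrightarrow> lk (\<alpha> + unit_expo i) k = 0) \<longleftrightarrow> i < n \<and> (\<forall>k. n \<le> k \<longrightarrow> lk \<alpha> k = 0)"
  proof -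
    have "lk (\<alpha> + unit_expo i) k = lk \<alpha> k + (if i = k then 1 else 0)" for k by (simp add: lk_simps)
    then show ?thesis by (auto simp: not_less split: if_splits)
  qed
  ultimately show ?thesis unfolding simplex_pts_iff by auto
qed

lemma simplex_lookup_less: "\<alpha> \<in> simplex_pts n d \<Longrightarrow> 0 < lk \<alpha> k \<Longrightarrow> k < n"
  unfolding simplex_pts_iff by (metis not_less less_numeral_extra(3))

lemma expo_split: "0 < lk y u \<Longrightarrow> \<exists>\<alpha>. y = \<alpha> + unit_expo u"
  by (intro exI[of _ "y - unit_expo u"] poly_mapping_eqI) (auto simp: lk_simps)

text \<open>Truncated subtraction at a zero coordinate would return \<beta> itself, which has degree
  d + 1 and is not in \<open>J\<close>.\<close>

lemma expo_diff_unit_iff: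
  assumes J: "J \<subseteq> simplex_pts n d" and \<beta>: "\<beta> \<in> simplex_pts n (Suc d)" and i: "\<beta> - unit_expo i \<in> J"
  shows "0 < lk \<beta> i"
proof (rule ccontr)
  assume "\<not> ?thesis"
  then have "\<beta> - unit_expo i = \<beta>" by (intro poly_mapping_eqI) (auto simp: lk_simps)
  then have "\<beta> \<in> simplex_pts n d" using i J by auto
  then show False using \<beta> unfolding simplex_pts_iff by simp
qed

lemma simplex_eq_if_le:
  assumes "x \<in> simplex_pts n d" "y \<in> simplex_pts n d" "\<And>k. k < n \<Longrightarrow> lk x k \<le> lk y k"
  shows "x = y"
proof (rule poly_mapping_eqI)
  fix k
  show "lk x k = lk y k"
  proof (cases "k < n")
    case True
    have "(\<Sum>k<n. lk x k) = (\<Sum>k<n. lk y k)" using assms unfolding simplex_pts_iff by simp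
    then show ?thesis using sum_mono_inv[of "lk x" "{..<n}" "lk y" k] assms(3) True by simp
  next
    case False
    then show ?thesis using assms(1,2) unfolding simplex_pts_iff by simp
  qed
qed

lemma finite_simplex_pts: "finite (simplex_pts n d)"
proof -
  have "Poly_Mapping.lookup ` simplex_pts n d \<subseteq> {f. \<forall>k. (k \<in> {..<n} \<longrightarrow> f k \<in> {..d}) \<and> (k \<notin> {..<n} \<longrightarrow> f k = 0)}"
  proof (rule image_subsetI)
    fix \<alpha> assume \<alpha>: "\<alpha> \<in> simplex_pts n d"
    have "lk \<alpha> k \<le> (\<Sum>k<n. lk \<alpha> k)" if "k < n" for k using that by (intro member_le_sum) auto
    then show "lk \<alpha> \<in> {f. \<forall>k. (k \<in> {..<n} \<longrightarrow> f k \<in> {..d}) \<and> (k \<notin> {..<n} \<longrightarrow> f k = 0)}"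
      using \<alpha> unfolding simplex_pts_iff by auto
  qed
  then have "finite (Poly_Mapping.lookup ` simplex_pts n d)" by (rule finite_subset) (intro finite_set_of_finite_funs; simp)
  then show ?thesis by (rule finite_imageD) (simp add: Poly_Mapping.lookup_inject inj_on_def)
qed

text \<open>Fixes the values at all exponent vectors, also off degree \<open>d\<close>, where a
  strong representation leaves them free.\<close>

definition supp_on :: "expo set \<Rightarrow> (expo \<Rightarrow> real) \<Rightarrow> bool" where
  "supp_on J \<rho> \<longleftrightarrow> (\<forall>\<alpha>. 0 \<le> \<rho> \<alpha> \<and> (\<rho> \<alpha> \<noteq> 0 \<longleftrightarrow> \<alpha> \<in> J))"

text \<open>If \<rho>(\<beta>) is \<beta>! times the coefficient of \<beta> in f, this is the
  Hessian of the partial derivative of f of order \<alpha>.\<close>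

definition hess :: "(expo \<Rightarrow> real) \<Rightarrow> expo \<Rightarrow> nat \<Rightarrow> nat \<Rightarrow> real" where
  "hess \<rho> \<alpha> i j = \<rho> (\<alpha> + unit_expo i + unit_expo j)"

definition hess_all :: "(nat set \<Rightarrow> (nat \<Rightarrow> nat \<Rightarrow> real) \<Rightarrow> bool) \<Rightarrow> nat \<Rightarrow> nat \<Rightarrow> (expo \<Rightarrow> real) \<Rightarrow> bool" where
  "hess_all P n d \<rho> \<longleftrightarrow> (2 \<le> d \<longrightarrow> (\<forall>\<alpha>\<in>simplex_pts n (d - 2). P {..<n} (hess \<rho> \<alpha>)))"

lemma hess_sym: "hess \<rho> \<alpha> i j = hess \<rho> \<alpha> j i"
  unfolding hess_def by (simp add: ac_simps)

lemma hess_sym_on: "sym_on I (hess \<rho> \<alpha>)"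
  unfolding sym_on_def using hess_sym by blast

lemma M_convexD:
  assumes "M_convex J" "x \<in> J" "y \<in> J" "lk x i < lk y i"
  obtains j where "lk y j < lk x j" "x + unit_expo i - unit_expo j \<in> J" "y - unit_expo i + unit_expo j \<in> J"
  using assms unfolding M_convex_def by blast

text \<open>Murota's passage from the local to the global exchange property: in a violating pair of minimal
  distance, \<open>y\<close> can be moved towards \<open>x\<close> so that the violation persists. The weights \<open>p\<close> play the
  role of a linear potential that makes the exchanges of \<open>x\<close> tight.\<close>

lemma exchange_weak_zero:
  assumes J: "J \<subseteq> simplex_pts n d" and M: "M_convex J" and \<rho>: "supp_on J \<rho>" and w: "hess_all weak_zero n d \<rho>"
    and x: "x \<in> J"
  shows "y \<in> J \<Longrightarrow> lk x i < lk y i \<Longrightarrow>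
    \<exists>j. lk y j < lk x j \<and> \<rho> x * \<rho> y \<le> \<rho> (x + unit_expo i - unit_expo j) * \<rho> (y - unit_expo i + unit_expo j)"
proof (induction "\<Sum>k<n. lk y k - lk x k" arbitrary: y rule: less_induct)
  case less
  note y = less.prems(1) and xy = less.prems(2)
  have nn: "0 \<le> \<rho> a" and nz: "\<rho> a \<noteq> 0 \<longleftrightarrow> a \<in> J" for a using \<rho> unfolding supp_on_def by auto
  have pos: "0 < \<rho> a" if "a \<in> J" for a using nn[of a] nz[of a] that by linarith
  show ?case
  proof (rule ccontr)
    assume "\<not> ?thesis"
    then have neg: "\<rho> (x + unit_expo i - unit_expo k) * \<rho> (y - unit_expo i + unit_expo k) < \<rho> x * \<rho> y"
      if "lk y k < lk x k" for k using that by (meson not_le)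
    define S where "S = {k. lk y k < lk x k}"
    have "S \<subseteq> {..<n}"
    proof
      fix k assume "k \<in> S"
      then have "0 < lk x k" unfolding S_def by simp
      then show "k \<in> {..<n}" using simplex_lookup_less[of x n d k] x J by auto
    qed
    then have fS: "finite S" by (rule finite_subset) simp
    \<comment> \<open>If x + e_i - e_k lies in \<open>J\<close>, then \<open>p k\<close> is chosen
      to make the exchange tight. Otherwise only \<open>py\<close> has to hold, whence the factor 2,
      which makes it strict, and the default 1.\<close>
    define p where "p k = (if \<rho> (x + unit_expo i - unit_expo k) \<noteq> 0 then \<rho> (x + unit_expo i - unit_expo k) / \<rho> x
       else if \<rho> (y - unit_expo i + unit_expo k) \<noteq> 0 then \<rho> y / (2 * \<rho> (y - unit_expo i + unit_expo k)) else 1)" for k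
    have p0: "0 < p k" for k
      unfolding p_def using pos[OF x] pos[OF y] nn by (auto simp: less_le)
    have py: "p k * \<rho> (y - unit_expo i + unit_expo k) < \<rho> y" if "k \<in> S" for k
      using neg[of k] that pos[OF x] pos[OF y] nn[of "y - unit_expo i + unit_expo k"]
      unfolding p_def S_def by (auto simp: field_simps)
    \<comment> \<open>A unit of \<open>y\<close> that can be removed while \<open>y\<close> still
      exceeds \<open>x\<close> at \<open>i\<close>. Without one, \<open>y\<close> would be x + e_i -
      e_j, and the exchange at \<open>j\<close> would merely swap \<open>x\<close> and
      \<open>y\<close>, with equality.\<close>
    have "\<exists>u. lk x u < lk y u \<and> (u \<noteq> i \<or> lk x i + 2 \<le> lk y i)"
    proof (rule ccontr)
      assume neg2: "\<not> ?thesis"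
      obtain j where j: "lk y j < lk x j" using M_convexD[OF M x y xy] by blast
      have ij: "i \<noteq> j" using j xy by auto
      have inx: "i < n" "j < n" using simplex_lookup_less[of y n d i] simplex_lookup_less[of x n d j] x y J xy j by auto
      have "y + unit_expo j = x + unit_expo i"
      proof (rule simplex_eq_if_le[of _ n "Suc d"])
        show "y + unit_expo j \<in> simplex_pts n (Suc d)" "x + unit_expo i \<in> simplex_pts n (Suc d)"
          using x y J inx by (auto simp: simplex_add_unit)
        fix k
        have "\<not> (lk x k < lk y k \<and> (k \<noteq> i \<or> lk x i + 2 \<le> lk y i))" for k using neg2 by blast
        from this[of k] this[of i] have "k \<noteq> i \<Longrightarrow> lk y k \<le> lk x k" "lk y i \<le> lk x i + 1"
          using xy by linarith+
        then show "lk (y + unit_expo j) k \<le> lk (x + unit_expo i) k"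
          using j ij by (auto simp: lk_simps)
      qed
      note e = this
      obtain z where z: "y = z + unit_expo i" using expo_split[of y i] xy by auto
      have "z + unit_expo j + unit_expo i = x + unit_expo i" using e unfolding z by (simp add: ac_simps)
      then have "z + unit_expo j = x" by simp
      then have "y - unit_expo i + unit_expo j = x" unfolding z by simp
      moreover have "x + unit_expo i - unit_expo j = y" unfolding e[symmetric] by simp
      ultimately show False using neg[OF j] by (simp add: mult.commute)
    qed
    then obtain u where u: "lk x u < lk y u" "u \<noteq> i \<or> lk x i + 2 \<le> lk y i" by blast
    obtain k0 where k0: "k0 \<in> S" "y - unit_expo u + unit_expo k0 \<in> J"
      using M_convexD[OF M x y u(1)] unfolding S_def by blast
    let ?g = "\<lambda>k. p k * \<rho> (y - unit_expo u + unit_expo k)"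
    \<comment> \<open>The unit taken from \<open>u\<close> is put where the weighted value is
      largest; this maximality decides one of the two cases of the local relation.\<close>
    obtain v where v: "v \<in> S" "\<And>k. k \<in> S \<Longrightarrow> ?g k \<le> ?g v"
    proof -
      have "Max (?g ` S) \<in> ?g ` S" using fS k0 by (intro Max_in) auto
      then obtain v where "v \<in> S" "Max (?g ` S) = ?g v" by blast
      moreover have "?g k \<le> Max (?g ` S)" if "k \<in> S" for k using that fS by (intro Max_ge) auto
      ultimately show thesis by (intro that[of v]) auto
    qed
    define y' where "y' = y - unit_expo u + unit_expo v"
    have "0 < ?g k0" using p0 pos k0 by simp
    then have "0 < ?g v" using v(2)[OF k0(1)] by linarith
    then have y'J: "y' \<in> J" using p0[of v] nz unfolding y'_def by (metis less_irrefl mult_zero_right)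
    have uv: "u \<noteq> v" using u v unfolding S_def by auto
    have vi: "v \<noteq> i" using v xy unfolding S_def by auto
    have xy': "lk x i < lk y' i" using u xy vi unfolding y'_def by (auto simp: lk_simps)
    have "(\<Sum>k<n. lk y' k - lk x k) < (\<Sum>k<n. lk y k - lk x k)"
    proof (rule sum_strict_mono_ex1)
      show "\<forall>k\<in>{..<n}. lk y' k - lk x k \<le> lk y k - lk x k"
        using v uv unfolding y'_def S_def by (auto simp: lk_simps)
      show "\<exists>k\<in>{..<n}. lk y' k - lk x k < lk y k - lk x k"
        using u uv simplex_lookup_less[of y n d u] y J unfolding y'_def
        by (intro bexI[of _ u]) (auto simp: lk_simps)
    qed simp
    from less.hyps[OF this y'J xy'] obtain j where j: "lk y' j < lk x j"
      and le: "\<rho> x * \<rho> y' \<le> \<rho> (x + unit_expo i - unit_expo j) * \<rho> (y' - unit_expo i + unit_expo j)" by blast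
    have ju: "j \<noteq> u" using j u uv unfolding y'_def by (auto simp: lk_simps)
    have jS: "j \<in> S" using j ju unfolding y'_def S_def by (auto simp: lk_simps split: if_splits)
    have ji: "j \<noteq> i" using jS xy unfolding S_def by auto
    \<comment> \<open>The induction hypothesis makes the exchanged point of \<open>x\<close>
      nonzero, so the first clause in the definition of \<open>p\<close> applies.\<close>
    have xp: "\<rho> (x + unit_expo i - unit_expo j) = p j * \<rho> x"
    proof -
      have "0 < \<rho> x * \<rho> y'" using pos x y'J by simp
      then have "\<rho> (x + unit_expo i - unit_expo j) \<noteq> 0" using le by (metis leD mult_zero_left)
      then show ?thesis unfolding p_def using pos[OF x] by simp
    qed
    define \<alpha> where "\<alpha> = y - unit_expo u - unit_expo i"
    have y\<alpha>: "y = \<alpha> + unit_expo u + unit_expo i"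
      unfolding \<alpha>_def using u xy by (intro poly_mapping_eqI) (auto simp: lk_simps)
    define y'' where "y'' = y' - unit_expo i + unit_expo j"
    have e: "y'' = \<alpha> + unit_expo v + unit_expo j" "y' = \<alpha> + unit_expo v + unit_expo i"
      "y - unit_expo i + unit_expo v = \<alpha> + unit_expo v + unit_expo u"
      "y - unit_expo i + unit_expo j = \<alpha> + unit_expo j + unit_expo u"
      "y - unit_expo u + unit_expo j = \<alpha> + unit_expo j + unit_expo i"
      unfolding y''_def y'_def y\<alpha> using uv vi ji ju
      by (intro poly_mapping_eqI; auto simp: lk_simps)+
    have "\<alpha> + unit_expo u + unit_expo i \<in> simplex_pts n d" using y J y\<alpha> by auto
    then have d: "2 \<le> d" "\<alpha> \<in> simplex_pts n (d - 2)" "u < n" "i < n"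
      by (auto simp: simplex_add_unit numeral_2_eq_2)
    have jv: "j < n" "v < n" using jS v(1) \<open>S \<subseteq> {..<n}\<close> by auto
    have "weak_zero {..<n} (hess \<rho> \<alpha>)" using w d unfolding hess_all_def by blast
    \<comment> \<open>The three-term relation at y - e_u - e_i for the indices u, i, v, j. Both
      alternatives contradict the induction hypothesis: one by maximality of \<open>v\<close> and
      \<open>py\<close> at \<open>v\<close>, the other by \<open>py\<close> at
      \<open>j\<close>.\<close>
    then have local: "\<rho> y'' * \<rho> y \<le> max (\<rho> (y - unit_expo i + unit_expo v) * \<rho> (y - unit_expo u + unit_expo j))
        (\<rho> y' * \<rho> (y - unit_expo i + unit_expo j))"
      unfolding weak_zero_def hess_def e y\<alpha>[symmetric] using d jv y\<alpha>
      by (metis lessThan_iff)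
    have "\<rho> y' \<le> p j * \<rho> y''" using le pos[OF x] unfolding xp y''_def[symmetric] by simp
    then have ge: "\<rho> y' * \<rho> y \<le> p j * (\<rho> y'' * \<rho> y)" using nn[of y] by (metis mult.assoc mult_right_mono)
    from local have "p j * (\<rho> y'' * \<rho> y) < \<rho> y' * \<rho> y"
    proof (cases "\<rho> y'' * \<rho> y \<le> \<rho> (y - unit_expo i + unit_expo v) * \<rho> (y - unit_expo u + unit_expo j)")
      case True
      then have "p j * (\<rho> y'' * \<rho> y) \<le> \<rho> (y - unit_expo i + unit_expo v) * (p j * \<rho> (y - unit_expo u + unit_expo j))"
        using p0[of j] by (simp add: mult.left_commute)
      also have "\<dots> \<le> \<rho> (y - unit_expo i + unit_expo v) * (p v * \<rho> y')"
        using v(2)[OF jS] nn unfolding y'_def by (intro mult_left_mono) auto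
      also have "\<dots> = (p v * \<rho> (y - unit_expo i + unit_expo v)) * \<rho> y'" by (simp add: ac_simps)
      also have "\<dots> < \<rho> y * \<rho> y'" using py[OF v(1)] pos[OF y'J] by (intro mult_strict_right_mono)
      finally show ?thesis by (simp add: mult.commute)
    next
      case False
      then have "p j * (\<rho> y'' * \<rho> y) \<le> p j * (\<rho> y' * \<rho> (y - unit_expo i + unit_expo j))"
        using local p0[of j] by simp
      also have "\<dots> = \<rho> y' * (p j * \<rho> (y - unit_expo i + unit_expo j))" by (simp add: ac_simps)
      also have "\<dots> < \<rho> y' * \<rho> y" using py[OF jS] pos[OF y'J] by (intro mult_strict_left_mono)
      finally show ?thesis .
    qed
    then show False using ge by simp
  qed
qed

section \<open>Two-term relations from three-term ones\<close>

lemma hess_all_weak_inftyD: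
  assumes w: "hess_all weak_infty n d \<rho>" and \<alpha>: "\<alpha> + unit_expo a + unit_expo a' \<in> simplex_pts n d"
    and b: "b < n" "c < n" and z: "\<rho> (\<alpha> + unit_expo a + unit_expo a') = 0"
  shows "\<rho> (\<alpha> + unit_expo a + unit_expo b) * \<rho> (\<alpha> + unit_expo a' + unit_expo c) =
    \<rho> (\<alpha> + unit_expo a + unit_expo c) * \<rho> (\<alpha> + unit_expo a' + unit_expo b)"
proof -
  have d: "2 \<le> d" "\<alpha> \<in> simplex_pts n (d - 2)" "a < n" "a' < n"
    using \<alpha> by (auto simp: simplex_add_unit numeral_2_eq_2)
  then have "weak_infty {..<n} (hess \<rho> \<alpha>)" using w unfolding hess_all_def by blast
  then show ?thesis using d b z unfolding weak_infty_def hess_def by blast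
qed

text \<open>Chains two proportions through the common ratio x : y without division; the factor
  \<open>y\<close> is kept, to be cancelled where it is known to be nonzero.\<close>

lemma mult_cross_trans:
  fixes a b p q x y :: real
  assumes "a * x = b * y" "p * y = q * x"
  shows "a * p * y = b * q * y"
proof -
  have "a * p * y = a * (p * y)" by (simp only: mult.assoc)
  also have "\<dots> = q * (a * x)" unfolding assms(2) by (simp only: mult.left_commute)
  also have "\<dots> = b * q * y" unfolding assms(1) by (simp only: ac_simps)
  finally show ?thesis .
qed

text \<open>The set \<open>{k. \<gamma> + e\<^sub>k \<notin> J}\<close> behaves like a hyperplane of a matroid: it does not change when \<open>\<gamma>\<close> moves
  inside it. Dually for \<open>{k. \<beta> - e\<^sub>k \<notin> J}\<close>.\<close>

lemma M_convex_hyperplane_move: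
  assumes M: "M_convex J" and i: "\<gamma> + unit_expo i \<in> J" and a: "\<gamma> + unit_expo a \<notin> J"
    and k: "\<gamma>' + unit_expo k \<in> J" and \<gamma>': "\<gamma>' + unit_expo b = \<gamma> + unit_expo a"
  shows "\<gamma> + unit_expo k \<in> J"
proof (rule ccontr)
  assume neg: "\<gamma> + unit_expo k \<notin> J"
  let ?x = "\<gamma> + unit_expo i" and ?y = "\<gamma>' + unit_expo k"
  have l: "lk \<gamma>' m + (if b = m then 1 else 0) = lk \<gamma> m + (if a = m then 1 else 0)" for m
    using arg_cong[OF \<gamma>', of "\<lambda>z. lk z m"] by (simp add: lk_simps)
  have ai: "a \<noteq> i" "k \<noteq> i" using i a neg by auto
  have ab: "a \<noteq> b" using \<gamma>' neg k by auto
  have "lk ?x a < lk ?y a" using l[of a] ai ab by (auto simp: lk_simps)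
  \<comment> \<open>Only \<open>i\<close> or \<open>b\<close> can be returned, and then the exchange
    puts \<gamma> + e_a or \<gamma> + e_k into \<open>J\<close>, both excluded.\<close>
  then obtain c where c: "lk ?y c < lk ?x c" "?x + unit_expo a - unit_expo c \<in> J" "?y - unit_expo a + unit_expo c \<in> J"
    using M_convexD[OF M i k] by blast
  have "c = i \<or> c = b" using c(1) l[of c] by (auto simp: lk_simps split: if_splits)
  then show False
  proof
    assume "c = i"
    then have "?x + unit_expo a - unit_expo c = \<gamma> + unit_expo a"
      by (intro poly_mapping_eqI) (auto simp: lk_simps)
    then show False using c(2) a by simp
  next
    assume cb: "c = b"
    have "?y - unit_expo a + unit_expo c = \<gamma> + unit_expo k"
    proof (rule poly_mapping_eqI)
      fix m
      show "lk (?y - unit_expo a + unit_expo c) m = lk (\<gamma> + unit_expo k) m"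
        using l[of m] cb ab by (auto simp: lk_simps split: if_splits)
    qed
    then show False using c(3) neg by simp
  qed
qed

lemma M_convex_circuit_move:
  assumes M: "M_convex J" and i: "\<beta> - unit_expo i \<in> J" "0 < lk \<beta> i" and a: "\<beta> - unit_expo a \<notin> J" "0 < lk \<beta> a"
    and k: "\<beta>' - unit_expo k \<in> J" "0 < lk \<beta>' k" and \<beta>': "\<beta>' + unit_expo a = \<beta> + unit_expo b" and k0: "0 < lk \<beta> k"
  shows "\<beta> - unit_expo k \<in> J"
proof (rule ccontr)
  assume neg: "\<beta> - unit_expo k \<notin> J"
  let ?x = "\<beta> - unit_expo i" and ?y = "\<beta>' - unit_expo k"
  have l: "lk \<beta>' m + (if a = m then 1 else 0) = lk \<beta> m + (if b = m then 1 else 0)" for m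
    using arg_cong[OF \<beta>', of "\<lambda>z. lk z m"] by (simp add: lk_simps)
  have ai: "a \<noteq> i" "k \<noteq> i" using i a neg by auto
  have ab: "a \<noteq> b"
  proof
    assume "a = b"
    then have "\<beta>' = \<beta>" using \<beta>' by simp
    then show False using neg k by simp
  qed
  have "lk ?y a < lk ?x a" using l[of a] ai ab a by (auto simp: lk_simps)
  \<comment> \<open>As in the dual statement, only \<open>i\<close> or \<open>b\<close> is possible,
    and then \<beta> - e_a or \<beta> - e_k would lie in \<open>J\<close>.\<close>
  then obtain c where c: "lk ?x c < lk ?y c" "?y + unit_expo a - unit_expo c \<in> J" "?x - unit_expo a + unit_expo c \<in> J"
    using M_convexD[OF M k(1) i(1)] by blast
  have "c = i \<or> c = b" using c(1) l[of c] by (auto simp: lk_simps split: if_splits)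
  then show False
  proof
    assume "c = i"
    then have "?x - unit_expo a + unit_expo c = \<beta> - unit_expo a"
      using i(2) ai by (intro poly_mapping_eqI) (auto simp: lk_simps)
    then show False using c(3) a by simp
  next
    assume cb: "c = b"
    have "?y + unit_expo a - unit_expo c = \<beta> - unit_expo k"
    proof (rule poly_mapping_eqI)
      fix m
      show "lk (?y + unit_expo a - unit_expo c) m = lk (\<beta> - unit_expo k) m"
        using l[of m] cb ab k(2) by (auto simp: lk_simps split: if_splits)
    qed
    then show False using c(2) neg by simp
  qed
qed

text \<open>Exchanging \<beta> - e_j with \<gamma> + e_j in coordinate \<open>j\<close> returns
  another index at which \<beta> exceeds \<gamma> and both factors are nonzero. By assumption
  \<open>K\<close> this can only be \<open>i\<close>.\<close>

lemma two_term_balance: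
  assumes J: "J \<subseteq> simplex_pts n d" and M: "M_convex J" and i: "\<beta> - unit_expo i \<in> J" "\<gamma> + unit_expo i \<in> J"
    and j: "\<beta> - unit_expo j \<in> J" "\<gamma> + unit_expo j \<in> J" and ij: "i \<noteq> j" and \<beta>: "\<beta> \<in> simplex_pts n (Suc d)"
    and le: "lk \<beta> i \<le> lk \<gamma> i + 1" "lk \<beta> j \<le> lk \<gamma> j + 1"
    and K: "\<And>k. k \<noteq> i \<Longrightarrow> k \<noteq> j \<Longrightarrow> lk \<gamma> k < lk \<beta> k \<Longrightarrow> \<beta> - unit_expo k \<notin> J \<or> \<gamma> + unit_expo k \<notin> J"
  shows "lk \<beta> i = lk \<gamma> i + 1"
proof (rule ccontr)
  assume neg: "\<not> ?thesis"
  have b0: "0 < lk \<beta> i" "0 < lk \<beta> j" using expo_diff_unit_iff[OF J \<beta>] i j by auto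
  have ex: "\<exists>c. c \<noteq> m \<and> lk \<gamma> c < lk \<beta> c \<and> \<beta> - unit_expo c \<in> J \<and> \<gamma> + unit_expo c \<in> J"
    if m: "\<beta> - unit_expo m \<in> J" "\<gamma> + unit_expo m \<in> J" "lk \<beta> m \<le> lk \<gamma> m + 1" "0 < lk \<beta> m" for m
  proof -
    have "lk (\<beta> - unit_expo m) m < lk (\<gamma> + unit_expo m) m" using m by (auto simp: lk_simps)
    then obtain c where c: "lk (\<gamma> + unit_expo m) c < lk (\<beta> - unit_expo m) c"
      "\<beta> - unit_expo m + unit_expo m - unit_expo c \<in> J" "\<gamma> + unit_expo m - unit_expo m + unit_expo c \<in> J"
      using M_convexD[OF M m(1,2)] by blast
    moreover have "\<beta> - unit_expo m + unit_expo m = \<beta>"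
      using m(4) by (intro poly_mapping_eqI) (auto simp: lk_simps)
    ultimately show ?thesis using m(3) by (intro exI[of _ c]) (auto simp: lk_simps split: if_splits)
  qed
  obtain c where c: "c \<noteq> i" "lk \<gamma> c < lk \<beta> c" "\<beta> - unit_expo c \<in> J" "\<gamma> + unit_expo c \<in> J"
    using ex[OF i le(1) b0(1)] by blast
  obtain c' where c': "c' \<noteq> j" "lk \<gamma> c' < lk \<beta> c'" "\<beta> - unit_expo c' \<in> J" "\<gamma> + unit_expo c' \<in> J"
    using ex[OF j le(2) b0(2)] by blast
  then have "c' = i" using K by blast
  then show False using c' le neg by simp
qed

text \<open>Each step moves \<open>\<gamma>\<close> or \<open>\<beta>\<close> inside the hyperplane (resp. circuit) determined by \<open>i\<close> and \<open>j\<close>, which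
  preserves the ratio \<open>\<rho>(\<gamma> + e\<^sub>i) / \<rho>(\<gamma> + e\<^sub>j)\<close> (resp. its dual) by a three-term relation.\<close>

lemma two_term_relation:
  assumes J: "J \<subseteq> simplex_pts n d" and M: "M_convex J" and \<rho>: "supp_on J \<rho>" and w: "hess_all weak_infty n d \<rho>"
    and ij: "i \<noteq> j"
  shows "\<beta> \<in> simplex_pts n (Suc d) \<Longrightarrow> \<gamma> + unit_expo i \<in> J \<Longrightarrow> \<gamma> + unit_expo j \<in> J \<Longrightarrow>
    \<beta> - unit_expo i \<in> J \<Longrightarrow> \<beta> - unit_expo j \<in> J \<Longrightarrow> lk \<beta> i \<le> lk \<gamma> i + 1 \<Longrightarrow> lk \<beta> j \<le> lk \<gamma> j + 1 \<Longrightarrow>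
    (\<And>k. k \<noteq> i \<Longrightarrow> k \<noteq> j \<Longrightarrow> lk \<gamma> k < lk \<beta> k \<Longrightarrow> \<beta> - unit_expo k \<notin> J \<or> \<gamma> + unit_expo k \<notin> J) \<Longrightarrow>
    \<rho> (\<beta> - unit_expo i) * \<rho> (\<gamma> + unit_expo i) = \<rho> (\<beta> - unit_expo j) * \<rho> (\<gamma> + unit_expo j)"
proof (induction "\<Sum>k<n. lk \<beta> k - lk \<gamma> k" arbitrary: \<beta> \<gamma> rule: less_induct)
  case less
  note \<beta> = less.prems(1) and gi = less.prems(2) and gj = less.prems(3) and bi = less.prems(4) and bj = less.prems(5)
  note K = less.prems(8)
  have nn: "0 \<le> \<rho> a" and nz: "\<rho> a \<noteq> 0 \<longleftrightarrow> a \<in> J" for a using \<rho> unfolding supp_on_def by auto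
  have z: "\<rho> a = 0" if "a \<notin> J" for a using nz[of a] that by blast
  have li: "lk \<beta> i = lk \<gamma> i + 1"
    by (rule two_term_balance[OF J M bi gi bj gj ij \<beta> less.prems(6,7) K])
  have lj: "lk \<beta> j = lk \<gamma> j + 1"
    by (rule two_term_balance[OF J M bj gj bi gi ij[symmetric] \<beta> less.prems(7,6)]) (use K in blast)
  have inx: "i < n" "j < n" using gi gj J by (auto simp: simplex_add_unit)
  show ?case
  proof (cases "\<exists>a. a \<noteq> i \<and> a \<noteq> j \<and> lk \<gamma> a < lk \<beta> a")
    case False
    \<comment> \<open>With no excess outside \<open>i\<close> and \<open>j\<close>, equality of
      degrees determines \<beta>, and the two products have the same factors.\<close>
    have "\<beta> = \<gamma> + unit_expo i + unit_expo j"
    proof (rule simplex_eq_if_le[OF \<beta>])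
      have "\<gamma> + unit_expo i \<in> simplex_pts n d" using gi J by blast
      then show "\<gamma> + unit_expo i + unit_expo j \<in> simplex_pts n (Suc d)"
        by (subst simplex_add_unit) (use inx in simp)
      fix k
      have "k = i \<or> k = j \<or> lk \<beta> k \<le> lk \<gamma> k" using False by (meson not_less)
      then show "lk \<beta> k \<le> lk (\<gamma> + unit_expo i + unit_expo j) k" using li lj by (auto simp: lk_simps)
    qed
    then have "\<beta> - unit_expo i = \<gamma> + unit_expo j" "\<beta> - unit_expo j = \<gamma> + unit_expo i"
      by (auto intro!: poly_mapping_eqI simp: lk_simps)
    then show ?thesis by (simp add: mult.commute)
  next
    case True
    then obtain a where a: "a \<noteq> i" "a \<noteq> j" "lk \<gamma> a < lk \<beta> a" by blast
    have an: "a < n" using simplex_lookup_less[OF \<beta>, of a] a by auto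
    have b_add: "\<beta> - unit_expo i + unit_expo i = \<beta>"
      using li by (intro poly_mapping_eqI) (auto simp: lk_simps)
    have "lk (\<gamma> + unit_expo i) a < lk (\<beta> - unit_expo i) a" using a by (auto simp: lk_simps)
    \<comment> \<open>Exchanging a surplus coordinate \<open>a\<close> of \<beta> against a deficit
      coordinate \<open>b\<close> stays in \<open>J\<close> and lowers the induction measure on
      whichever side it is carried out.\<close>
    then obtain b where b: "lk (\<beta> - unit_expo i) b < lk (\<gamma> + unit_expo i) b"
      "\<gamma> + unit_expo i + unit_expo a - unit_expo b \<in> J" "\<beta> - unit_expo i - unit_expo a + unit_expo b \<in> J"
      using M_convexD[OF M gi bi] by blast
    have ba: "b \<noteq> a" using b(1) a by (auto simp: lk_simps)
    have bjne: "b \<noteq> j" using b(1) lj ij by (auto simp: lk_simps)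
    have bine: "b \<noteq> i"
    proof
      assume "b = i"
      moreover have "\<gamma> + unit_expo i + unit_expo a - unit_expo i = \<gamma> + unit_expo a"
        by (intro poly_mapping_eqI) (auto simp: lk_simps)
      moreover have "\<beta> - unit_expo i - unit_expo a + unit_expo i = \<beta> - unit_expo a"
        using li a by (intro poly_mapping_eqI) (auto simp: lk_simps)
      ultimately show False using b(2,3) K[OF a] by auto
    qed
    have lb: "lk \<beta> b < lk \<gamma> b" using b(1) bine by (auto simp: lk_simps)
    have bn: "b < n" using simplex_lookup_less[of "\<gamma> + unit_expo i" n d b] gi J lb by (auto simp: lk_simps)
    \<comment> \<open>\<open>K\<close> says that at least one factor at \<open>a\<close> vanishes,
      and the vanishing one decides which side moves: a three-term relation with a zero term is an
      equality of the other two.\<close>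
    consider "\<gamma> + unit_expo a \<notin> J" | "\<beta> - unit_expo a \<notin> J" using K[OF a] by blast
    then show ?thesis
    proof cases
      case 1
      define \<alpha> where "\<alpha> = \<gamma> - unit_expo b"
      have \<gamma>: "\<gamma> = \<alpha> + unit_expo b" unfolding \<alpha>_def using lb by (intro poly_mapping_eqI) (auto simp: lk_simps)
      \<comment> \<open>Moving \<gamma> to \<gamma> - e_b + e_a keeps the set of k with \<gamma> +
        e_k outside \<open>J\<close>, so the hypotheses survive for the new pair.\<close>
      define g where "g = \<alpha> + unit_expo a"
      have gg: "g + unit_expo b = \<gamma> + unit_expo a" "\<gamma> + unit_expo a = g + unit_expo b" unfolding g_def \<gamma> by (simp_all add: ac_simps)
      have "\<gamma> + unit_expo i + unit_expo a - unit_expo b = g + unit_expo i"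
        unfolding g_def \<gamma> by (intro poly_mapping_eqI) (auto simp: lk_simps)
      then have ggi: "g + unit_expo i \<in> J" using b(2) by simp
      have gb: "g + unit_expo b \<notin> J" using 1 gg(1) by simp
      have fwd: "g + unit_expo k \<in> J \<Longrightarrow> \<gamma> + unit_expo k \<in> J" for k
        by (rule M_convex_hyperplane_move[OF M gi 1 _ gg(1)])
      have bwd: "\<gamma> + unit_expo k \<in> J \<Longrightarrow> g + unit_expo k \<in> J" for k
        by (rule M_convex_hyperplane_move[OF M ggi gb _ gg(2)])
      have ggj: "g + unit_expo j \<in> J" using bwd[OF gj] .
      have lg: "lk g k = (if k = a then lk \<gamma> k + 1 else if k = b then lk \<gamma> k - 1 else lk \<gamma> k)" for k
        unfolding g_def \<gamma> using ba by (auto simp: lk_simps)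
      have dec: "(\<Sum>k<n. lk \<beta> k - lk g k) < (\<Sum>k<n. lk \<beta> k - lk \<gamma> k)"
      proof (rule sum_strict_mono_ex1)
        show "\<forall>k\<in>{..<n}. lk \<beta> k - lk g k \<le> lk \<beta> k - lk \<gamma> k" using lb by (auto simp: lg)
        show "\<exists>k\<in>{..<n}. lk \<beta> k - lk g k < lk \<beta> k - lk \<gamma> k" using an a by (intro bexI[of _ a]) (auto simp: lg)
      qed simp
      have IH: "\<rho> (\<beta> - unit_expo i) * \<rho> (g + unit_expo i) = \<rho> (\<beta> - unit_expo j) * \<rho> (g + unit_expo j)"
      proof (rule less.hyps[OF dec \<beta> ggi ggj bi bj])
        show "lk \<beta> i \<le> lk g i + 1" "lk \<beta> j \<le> lk g j + 1" using li lj a bine bjne by (auto simp: lg)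
        fix k assume k: "k \<noteq> i" "k \<noteq> j" "lk g k < lk \<beta> k"
        show "\<beta> - unit_expo k \<notin> J \<or> g + unit_expo k \<notin> J"
        proof (cases "k = b")
          case True
          then show ?thesis using gb by blast
        next
          case False
          then have "lk \<gamma> k < lk \<beta> k" using k(3) by (auto simp: lg split: if_splits)
          then show ?thesis using K[OF k(1,2)] fwd by blast
        qed
      qed
      have "\<rho> (\<alpha> + unit_expo b + unit_expo i) * \<rho> (\<alpha> + unit_expo a + unit_expo j) =
          \<rho> (\<alpha> + unit_expo b + unit_expo j) * \<rho> (\<alpha> + unit_expo a + unit_expo i)"
      proof (rule hess_all_weak_inftyD[OF w _ inx])
        have "\<gamma> + unit_expo i \<in> simplex_pts n d" using gi J by blast
        then show "\<alpha> + unit_expo b + unit_expo a \<in> simplex_pts n d"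
          unfolding \<gamma> using an by (auto simp: simplex_add_unit)
        show "\<rho> (\<alpha> + unit_expo b + unit_expo a) = 0" using z[OF 1] unfolding \<gamma> .
      qed
      then have R: "\<rho> (\<gamma> + unit_expo i) * \<rho> (g + unit_expo j) = \<rho> (\<gamma> + unit_expo j) * \<rho> (g + unit_expo i)"
        unfolding \<gamma> g_def .
      have "\<rho> (\<beta> - unit_expo i) * \<rho> (\<gamma> + unit_expo i) * \<rho> (g + unit_expo j) =
          \<rho> (\<beta> - unit_expo j) * \<rho> (\<gamma> + unit_expo j) * \<rho> (g + unit_expo j)"
        using IH R by (rule mult_cross_trans)
      then show ?thesis using nz[of "g + unit_expo j"] ggj by simp
    next
      case 2
      define \<alpha> where "\<alpha> = \<beta> - unit_expo i - unit_expo j - unit_expo a"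
      have \<beta>\<alpha>: "\<beta> = \<alpha> + unit_expo i + unit_expo j + unit_expo a"
        unfolding \<alpha>_def using a li lj ij by (intro poly_mapping_eqI) (auto simp: lk_simps)
      \<comment> \<open>The dual move: \<beta> becomes \<beta> - e_a + e_b.\<close>
      define h where "h = \<alpha> + unit_expo i + unit_expo j + unit_expo b"
      have hh: "h + unit_expo a = \<beta> + unit_expo b" "\<beta> + unit_expo b = h + unit_expo a" unfolding h_def \<beta>\<alpha> by (simp_all add: ac_simps)
      have ld: "0 < lk \<beta> i" "0 < lk \<beta> j" "0 < lk \<beta> a" using li lj a by auto
      have lh: "0 < lk h i" "0 < lk h j" "0 < lk h b" unfolding h_def by (auto simp: lk_simps)
      have "\<beta> - unit_expo i - unit_expo a + unit_expo b = h - unit_expo i"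
        unfolding h_def \<beta>\<alpha> by (intro poly_mapping_eqI) (auto simp: lk_simps)
      then have hi: "h - unit_expo i \<in> J" using b(3) by simp
      have "h - unit_expo b = \<beta> - unit_expo a" unfolding h_def \<beta>\<alpha> by simp
      then have hb: "h - unit_expo b \<notin> J" using 2 by simp
      have hS: "h \<in> simplex_pts n (Suc d)" using \<beta> bn unfolding h_def \<beta>\<alpha> by (auto simp: simplex_add_unit)
      have fwd: "h - unit_expo k \<in> J \<Longrightarrow> 0 < lk \<beta> k \<Longrightarrow> \<beta> - unit_expo k \<in> J" for k
        by (rule M_convex_circuit_move[OF M bi ld(1) 2 ld(3) _ _ hh(1)]) (use expo_diff_unit_iff[OF J hS] in auto)
      have hj: "h - unit_expo j \<in> J"
        by (rule M_convex_circuit_move[OF M hi lh(1) hb lh(3) bj ld(2) hh(2) lh(2)])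
      have lhk: "lk h k = (if k = a then lk \<beta> k - 1 else if k = b then lk \<beta> k + 1 else lk \<beta> k)" for k
        unfolding h_def \<beta>\<alpha> using ba by (auto simp: lk_simps)
      have dec: "(\<Sum>k<n. lk h k - lk \<gamma> k) < (\<Sum>k<n. lk \<beta> k - lk \<gamma> k)"
      proof (rule sum_strict_mono_ex1)
        show "\<forall>k\<in>{..<n}. lk h k - lk \<gamma> k \<le> lk \<beta> k - lk \<gamma> k" using lb by (auto simp: lhk)
        show "\<exists>k\<in>{..<n}. lk h k - lk \<gamma> k < lk \<beta> k - lk \<gamma> k" using an a by (intro bexI[of _ a]) (auto simp: lhk)
      qed simp
      have IH: "\<rho> (h - unit_expo i) * \<rho> (\<gamma> + unit_expo i) = \<rho> (h - unit_expo j) * \<rho> (\<gamma> + unit_expo j)"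
      proof (rule less.hyps[OF dec hS gi gj hi hj])
        show "lk h i \<le> lk \<gamma> i + 1" "lk h j \<le> lk \<gamma> j + 1" using li lj a bine bjne by (auto simp: lhk)
        fix k assume k: "k \<noteq> i" "k \<noteq> j" "lk \<gamma> k < lk h k"
        then have "lk \<gamma> k < lk \<beta> k" using lb by (auto simp: lhk split: if_splits)
        then show "h - unit_expo k \<notin> J \<or> \<gamma> + unit_expo k \<notin> J"
          using K[OF k(1,2)] fwd[of k] by auto
      qed
      have "\<rho> (\<alpha> + unit_expo i + unit_expo a) * \<rho> (\<alpha> + unit_expo j + unit_expo b) =
          \<rho> (\<alpha> + unit_expo i + unit_expo b) * \<rho> (\<alpha> + unit_expo j + unit_expo a)"
      proof (rule hess_all_weak_inftyD[OF w _ an bn])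
        show "\<alpha> + unit_expo i + unit_expo j \<in> simplex_pts n d"
          using \<beta> unfolding \<beta>\<alpha> by (auto simp: simplex_add_unit)
        have "\<alpha> + unit_expo i + unit_expo j = \<beta> - unit_expo a" unfolding \<beta>\<alpha> by simp
        then show "\<rho> (\<alpha> + unit_expo i + unit_expo j) = 0" using z[OF 2] by simp
      qed
      moreover have "\<alpha> + unit_expo i + unit_expo a = \<beta> - unit_expo j" "\<alpha> + unit_expo j + unit_expo b = h - unit_expo i"
        "\<alpha> + unit_expo i + unit_expo b = h - unit_expo j" "\<alpha> + unit_expo j + unit_expo a = \<beta> - unit_expo i"
        unfolding \<beta>\<alpha> h_def by (auto intro!: poly_mapping_eqI simp: lk_simps)
      ultimately have R: "\<rho> (\<beta> - unit_expo j) * \<rho> (h - unit_expo i) = \<rho> (h - unit_expo j) * \<rho> (\<beta> - unit_expo i)" by simp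
      have "\<rho> (\<gamma> + unit_expo i) * \<rho> (\<beta> - unit_expo i) * \<rho> (h - unit_expo j) =
          \<rho> (\<gamma> + unit_expo j) * \<rho> (\<beta> - unit_expo j) * \<rho> (h - unit_expo j)"
        by (rule mult_cross_trans[where x = "\<rho> (h - unit_expo i)"])
          (use IH R in \<open>simp_all only: mult.commute\<close>)
      then show ?thesis using nz[of "h - unit_expo j"] hj by (simp add: mult.commute)
    qed
  qed
qed

section \<open>Strong relations and three-term relations\<close>

lemma simplex_add_sum:
  assumes "finite A" "\<And>m. m \<in> A \<Longrightarrow> i m < n" "\<alpha> \<in> simplex_pts n c"
  shows "\<alpha> + (\<Sum>m\<in>A. unit_expo (i m)) \<in> simplex_pts n (c + card A)"
  using assms
proof (induction A rule: finite_induct)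
  case empty
  then show ?case by simp
next
  case (insert a A)
  then have "\<alpha> + (\<Sum>m\<in>A. unit_expo (i m)) + unit_expo (i a) \<in> simplex_pts n (c + card (insert a A))"
    by (subst simplex_add_unit) auto
  then show ?case using insert.hyps by (simp add: ac_simps)
qed

lemma lookup_sum_unit:
  "finite A \<Longrightarrow> lk (\<Sum>m\<in>A. unit_expo (i m)) k = card {m \<in> A. i m = k}"
proof (induction A rule: finite_induct)
  case (insert a A)
  have "{m \<in> insert a A. i m = k} = (if i a = k then insert a {m \<in> A. i m = k} else {m \<in> A. i m = k})" by auto
  then show ?case using insert by (simp add: lk_simps)
qed simp

text \<open>Both factors of every term have degree (d - s) + s = d, so the relations see only values
  on degree \<open>d\<close>.\<close>

lemma strong_rep_cong:
  assumes eq: "\<And>\<alpha>. \<alpha> \<in> simplex_pts n d \<Longrightarrow> \<rho> \<alpha> = \<rho>' \<alpha>" and r: "strong_rep null n d J \<rho>"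
  shows "strong_rep null n d J \<rho>'"
  unfolding strong_rep_def
proof (intro conjI allI impI)
  show "\<forall>\<alpha>\<in>simplex_pts n d. 0 \<le> \<rho>' \<alpha>" "{\<alpha> \<in> simplex_pts n d. \<rho>' \<alpha> \<noteq> 0} = J"
    using r eq unfolding strong_rep_def by auto
  fix s \<alpha> i j
  assume h: "2 \<le> s \<and> s \<le> d \<and> \<alpha> \<in> simplex_pts n (d - s) \<and>
        (\<forall>k<n. delta_minus J k \<le> Poly_Mapping.lookup \<alpha> k) \<and>
        i ` {0..s} \<subseteq> {..<n} \<and> mono_on {0..s} i \<and>
        j ` {2..s} \<subseteq> {..<n} \<and> mono_on {2..s} j \<and>
        (\<forall>k<n. Poly_Mapping.lookup
           (\<alpha> + (\<Sum>m=0..s. unit_expo (i m)) + (\<Sum>m=2..s. unit_expo (j m))) k \<le> delta_plus J k)"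
  then have "null (map (\<lambda>k. \<rho> (\<alpha> + (\<Sum>m\<in>{0..s} - {k}. unit_expo (i m))) *
                            \<rho> (\<alpha> + unit_expo (i k) + (\<Sum>m=2..s. unit_expo (j m)))) [0..<Suc s])"
    using r unfolding strong_rep_def by blast
  moreover have "map (\<lambda>k. \<rho> (\<alpha> + (\<Sum>m\<in>{0..s} - {k}. unit_expo (i m))) *
                            \<rho> (\<alpha> + unit_expo (i k) + (\<Sum>m=2..s. unit_expo (j m)))) [0..<Suc s] =
     map (\<lambda>k. \<rho>' (\<alpha> + (\<Sum>m\<in>{0..s} - {k}. unit_expo (i m))) *
                            \<rho>' (\<alpha> + unit_expo (i k) + (\<Sum>m=2..s. unit_expo (j m)))) [0..<Suc s]"
  proof (rule map_cong[OF refl])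
    fix k assume "k \<in> set [0..<Suc s]"
    then have k: "k \<in> {0..s}" by auto
    have i: "\<And>m. m \<in> {0..s} \<Longrightarrow> i m < n" and j: "\<And>m. m \<in> {2..s} \<Longrightarrow> j m < n"
      using h by (auto simp: image_subset_iff)
    have "\<alpha> + (\<Sum>m\<in>{0..s} - {k}. unit_expo (i m)) \<in> simplex_pts n (d - s + card ({0..s} - {k}))"
      using h i by (intro simplex_add_sum) auto
    moreover have "\<alpha> + (\<Sum>m\<in>{2..s}. unit_expo (j m)) + unit_expo (i k) \<in> simplex_pts n (Suc (d - s + card {2..s}))"
    proof -
      have "\<alpha> + (\<Sum>m\<in>{2..s}. unit_expo (j m)) \<in> simplex_pts n (d - s + card {2..s})"
        using h j by (intro simplex_add_sum) auto
      then show ?thesis by (subst simplex_add_unit) (use i[OF k] in simp)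
    qed
    ultimately show "\<rho> (\<alpha> + (\<Sum>m\<in>{0..s} - {k}. unit_expo (i m))) * \<rho> (\<alpha> + unit_expo (i k) + (\<Sum>m=2..s. unit_expo (j m))) =
      \<rho>' (\<alpha> + (\<Sum>m\<in>{0..s} - {k}. unit_expo (i m))) * \<rho>' (\<alpha> + unit_expo (i k) + (\<Sum>m=2..s. unit_expo (j m)))"
      using h k by (intro arg_cong2[where f = "(*)"] eq) (auto simp: ac_simps Suc_diff_le)
  qed
  ultimately show "null (map (\<lambda>k. \<rho>' (\<alpha> + (\<Sum>m\<in>{0..s} - {k}. unit_expo (i m))) *
                            \<rho>' (\<alpha> + unit_expo (i k) + (\<Sum>m=2..s. unit_expo (j m)))) [0..<Suc s])"
    by (simp only:)
qed

lemma exchange_index: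
  fixes i :: "nat \<Rightarrow> nat"
  assumes \<beta>: "\<beta> = \<alpha> + (\<Sum>m=0..s. unit_expo (i m))" and \<gamma>: "\<And>c. lk \<alpha> c \<le> lk \<gamma> c" and c: "lk \<gamma> c < lk \<beta> c"
  shows "\<exists>m\<le>s. i m = c"
proof (rule ccontr)
  assume "\<not> ?thesis"
  then have "{m \<in> {0..s}. i m = c} = {}" by auto
  then have "lk \<beta> c = lk \<alpha> c" unfolding \<beta> lookup_add by (simp add: lookup_sum_unit)
  then show False using \<gamma>[of c] c by simp
qed

lemma unique_index:
  fixes i :: "nat \<Rightarrow> nat"
  assumes \<beta>: "\<beta> = \<alpha> + (\<Sum>m=0..s. unit_expo (i m))" and k: "k \<le> s" and u: "\<And>l. l \<le> s \<Longrightarrow> i l = i k \<Longrightarrow> l = k"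
  shows "lk \<beta> (i k) = lk \<alpha> (i k) + 1"
proof -
  have "{m \<in> {0..s}. i m = i k} = {k}" using k u by auto
  then show ?thesis unfolding \<beta> lookup_add by (simp add: lookup_sum_unit)
qed

text \<open>In the notation of the relations, \<open>\<beta> = \<alpha> + \<Sum>e\<^bsub>i\<^sub>m\<^esub>\<close> and \<open>\<gamma> = \<alpha> + \<Sum>e\<^bsub>j\<^sub>m\<^esub>\<close>, so that the terms are
  \<open>\<rho>(\<beta> - e\<^bsub>i\<^sub>k\<^esub>) \<rho>(\<gamma> + e\<^bsub>i\<^sub>k\<^esub>)\<close>.\<close>

lemma strong_repI:
  assumes J: "J \<subseteq> simplex_pts n d" and \<rho>: "supp_on J \<rho>"
    and null: "\<And>s \<alpha> \<beta> \<gamma> i. \<beta> \<in> simplex_pts n (Suc d) \<Longrightarrow> \<beta> = \<alpha> + (\<Sum>m=0..s. unit_expo (i m)) \<Longrightarrow>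
      (\<And>c. lk \<alpha> c \<le> lk \<gamma> c) \<Longrightarrow>
      null (map (\<lambda>k. \<rho> (\<beta> - unit_expo (i k)) * \<rho> (\<gamma> + unit_expo (i k))) [0..<Suc s])"
  shows "strong_rep null n d J \<rho>"
  unfolding strong_rep_def
proof (intro conjI allI impI)
  show "\<forall>\<alpha>\<in>simplex_pts n d. 0 \<le> \<rho> \<alpha>" "{\<alpha> \<in> simplex_pts n d. \<rho> \<alpha> \<noteq> 0} = J"
    using \<rho> J unfolding supp_on_def by auto
  fix s \<alpha> i j
  assume h: "2 \<le> s \<and> s \<le> d \<and> \<alpha> \<in> simplex_pts n (d - s) \<and>
        (\<forall>k<n. delta_minus J k \<le> Poly_Mapping.lookup \<alpha> k) \<and>
        i ` {0..s} \<subseteq> {..<n} \<and> mono_on {0..s} i \<and>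
        j ` {2..s} \<subseteq> {..<n} \<and> mono_on {2..s} j \<and>
        (\<forall>k<n. Poly_Mapping.lookup
           (\<alpha> + (\<Sum>m=0..s. unit_expo (i m)) + (\<Sum>m=2..s. unit_expo (j m))) k \<le> delta_plus J k)"
  define \<beta> where "\<beta> = \<alpha> + (\<Sum>m=0..s. unit_expo (i m))"
  define \<gamma> where "\<gamma> = \<alpha> + (\<Sum>m=2..s. unit_expo (j m))"
  have "\<beta> \<in> simplex_pts n (d - s + card {0..s})" unfolding \<beta>_def
    using h by (intro simplex_add_sum) (auto simp: image_subset_iff)
  then have "\<beta> \<in> simplex_pts n (Suc d)" using h by (simp add: Suc_diff_le)
  moreover have "lk \<alpha> c \<le> lk \<gamma> c" for c unfolding \<gamma>_def lookup_add by simp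
  ultimately have "null (map (\<lambda>k. \<rho> (\<beta> - unit_expo (i k)) * \<rho> (\<gamma> + unit_expo (i k))) [0..<Suc s])"
    using \<beta>_def by (intro null) auto
  moreover have "\<beta> - unit_expo (i k) = \<alpha> + (\<Sum>m\<in>{0..s} - {k}. unit_expo (i m))" if "k \<in> {0..s}" for k
  proof -
    have "\<beta> = \<alpha> + (\<Sum>m\<in>{0..s} - {k}. unit_expo (i m)) + unit_expo (i k)"
      unfolding \<beta>_def sum.remove[OF finite_atLeastAtMost that, of "\<lambda>m. unit_expo (i m)"] by (simp only: ac_simps)
    then show ?thesis by simp
  qed
  moreover have "\<gamma> + unit_expo (i k) = \<alpha> + unit_expo (i k) + (\<Sum>m=2..s. unit_expo (j m))" for k
    unfolding \<gamma>_def by (simp add: ac_simps)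
  ultimately have "null (map (\<lambda>k. \<rho> (\<beta> - unit_expo (i k)) * \<rho> (\<gamma> + unit_expo (i k))) [0..<Suc s])"
    and "map (\<lambda>k. \<rho> (\<beta> - unit_expo (i k)) * \<rho> (\<gamma> + unit_expo (i k))) [0..<Suc s] =
      map (\<lambda>k. \<rho> (\<alpha> + (\<Sum>m\<in>{0..s} - {k}. unit_expo (i m))) *
                            \<rho> (\<alpha> + unit_expo (i k) + (\<Sum>m=2..s. unit_expo (j m)))) [0..<Suc s]"
    by (simp_all add: less_Suc_eq_le del: upt_Suc)
  then show "null (map (\<lambda>k. \<rho> (\<alpha> + (\<Sum>m\<in>{0..s} - {k}. unit_expo (i m))) *
                            \<rho> (\<alpha> + unit_expo (i k) + (\<Sum>m=2..s. unit_expo (j m)))) [0..<Suc s])"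
    by (simp only:)
qed

lemma max_index:
  fixes T :: "nat \<Rightarrow> real"
  shows "\<exists>k\<le>s. \<forall>l\<le>s. T l \<le> T k"
proof -
  have "Max (T ` {..s}) \<in> T ` {..s}" by (intro Max_in) auto
  then obtain k where "k \<in> {..s}" "Max (T ` {..s}) = T k" by blast
  moreover have "T l \<le> Max (T ` {..s})" if "l \<le> s" for l using that by (intro Max_ge) auto
  ultimately show ?thesis by auto
qed

lemma max_attained_twice_map:
  fixes T :: "nat \<Rightarrow> real"
  assumes "k \<le> s" "l \<le> s" "k \<noteq> l" "T k = T l" "\<And>m. m \<le> s \<Longrightarrow> T m \<le> T k"
  shows "max_attained_twice (map T [0..<Suc s])"
proof -
  have e: "map T [0..<Suc s] ! m = T m" if "m < Suc s" for m using that by (simp del: upt_Suc)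
  show ?thesis unfolding max_attained_twice_def
    by (intro exI[of _ k] conjI exI[of _ l] allI impI)
      (use assms e in \<open>auto simp del: upt_Suc simp: less_Suc_eq_le\<close>)
qed

lemma supp_onD:
  assumes "supp_on J \<rho>"
  shows "0 \<le> \<rho> a" "\<rho> a \<noteq> 0 \<longleftrightarrow> a \<in> J" "a \<in> J \<Longrightarrow> 0 < \<rho> a"
  using assms unfolding supp_on_def by (auto simp: less_le)

text \<open>Take a largest term. If its index is repeated, so is the term; otherwise the global
  exchange inequality for its two arguments produces another term at least as large.\<close>

lemma weak_zero_imp_strong_rep:
  assumes J: "J \<subseteq> simplex_pts n d" and M: "M_convex J" and \<rho>: "supp_on J \<rho>" and w: "hess_all weak_zero n d \<rho>"
  shows "strong_rep null_zero n d J \<rho>"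
proof (rule strong_repI[OF J \<rho>])
  fix s \<alpha> \<beta> \<gamma> and i :: "nat \<Rightarrow> nat"
  assume \<beta>S: "\<beta> \<in> simplex_pts n (Suc d)" and \<beta>: "\<beta> = \<alpha> + (\<Sum>m=0..s. unit_expo (i m))"
    and \<gamma>: "\<And>c. lk \<alpha> c \<le> lk \<gamma> c"
  define T where "T k = \<rho> (\<beta> - unit_expo (i k)) * \<rho> (\<gamma> + unit_expo (i k))" for k
  have T0: "0 \<le> T k" for k unfolding T_def using supp_onD(1)[OF \<rho>] by simp
  obtain k where k: "k \<le> s" "\<And>l. l \<le> s \<Longrightarrow> T l \<le> T k" using max_index[of s T] by blast
  have "null_zero (map T [0..<Suc s])"
  proof (cases "T k = 0")
    case True
    then have "T l = 0" if "l < Suc s" for l using k(2)[of l] T0[of l] that by simp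
    then show ?thesis unfolding null_zero_def by (auto simp del: upt_Suc)
  next
    case False
    have "\<exists>l\<le>s. l \<noteq> k \<and> T l = T k"
    proof (cases "\<exists>l\<le>s. l \<noteq> k \<and> i l = i k")
      case True
      then show ?thesis unfolding T_def by auto
    next
      case u: False
      have x: "\<beta> - unit_expo (i k) \<in> J" and y: "\<gamma> + unit_expo (i k) \<in> J"
        using False supp_onD(2)[OF \<rho>] unfolding T_def by auto
      have lb: "lk \<beta> (i k) = lk \<alpha> (i k) + 1" by (rule unique_index[OF \<beta> k(1)]) (use u in blast)
      then have "lk (\<beta> - unit_expo (i k)) (i k) < lk (\<gamma> + unit_expo (i k)) (i k)"
        using \<gamma>[of "i k"] by (simp add: lk_simps)
      from exchange_weak_zero[OF J M \<rho> w x y this]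
      obtain c where c: "lk (\<gamma> + unit_expo (i k)) c < lk (\<beta> - unit_expo (i k)) c"
        "T k \<le> \<rho> (\<beta> - unit_expo (i k) + unit_expo (i k) - unit_expo c) * \<rho> (\<gamma> + unit_expo (i k) - unit_expo (i k) + unit_expo c)"
        unfolding T_def by blast
      have "lk \<gamma> c < lk \<beta> c" using c(1) by (auto simp: lk_simps split: if_splits)
      then obtain m where m: "m \<le> s" "i m = c" using exchange_index[OF \<beta> \<gamma>] by blast
      have "\<beta> - unit_expo (i k) + unit_expo (i k) = \<beta>"
        using lb by (intro poly_mapping_eqI) (auto simp: lk_simps)
      then have "T k \<le> T m" using c(2) m unfolding T_def by simp
      moreover have "m \<noteq> k" using c(1) m \<gamma>[of "i k"] lb by (auto simp: lk_simps)
      ultimately show ?thesis using k(2)[OF m(1)] m(1) by (intro exI[of _ m]) auto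
    qed
    then obtain l where "l \<le> s" "l \<noteq> k" "T l = T k" by blast
    then show ?thesis unfolding null_zero_def using k by (intro disjI2 max_attained_twice_map[of k s l]) auto
  qed
  then show "null_zero (map (\<lambda>k. \<rho> (\<beta> - unit_expo (i k)) * \<rho> (\<gamma> + unit_expo (i k))) [0..<Suc s])"
    unfolding T_def .
qed

text \<open>A nonzero term with unrepeated index has a nonzero companion by M-convexity. Either a
  third nonzero term exists, or the two-term relation makes the two equal.\<close>

lemma weak_infty_imp_strong_rep:
  assumes J: "J \<subseteq> simplex_pts n d" and M: "M_convex J" and \<rho>: "supp_on J \<rho>" and w: "hess_all weak_infty n d \<rho>"
  shows "strong_rep null_infty n d J \<rho>"
proof (rule strong_repI[OF J \<rho>])
  fix s \<alpha> \<beta> \<gamma> and i :: "nat \<Rightarrow> nat"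
  assume \<beta>S: "\<beta> \<in> simplex_pts n (Suc d)" and \<beta>: "\<beta> = \<alpha> + (\<Sum>m=0..s. unit_expo (i m))"
    and \<gamma>: "\<And>c. lk \<alpha> c \<le> lk \<gamma> c"
  define T where "T k = \<rho> (\<beta> - unit_expo (i k)) * \<rho> (\<gamma> + unit_expo (i k))" for k
  have T0: "0 \<le> T k" for k unfolding T_def using supp_onD(1)[OF \<rho>] by simp
  have TJ: "T k \<noteq> 0 \<longleftrightarrow> \<beta> - unit_expo (i k) \<in> J \<and> \<gamma> + unit_expo (i k) \<in> J" for k
    unfolding T_def using supp_onD(2)[OF \<rho>] by auto
  obtain k where k: "k \<le> s" "\<And>l. l \<le> s \<Longrightarrow> T l \<le> T k" using max_index[of s T] by blast
  have "null_infty (map T [0..<Suc s])"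
  proof (cases "T k = 0")
    case True
    then have "T l = 0" if "l < Suc s" for l using k(2)[of l] T0[of l] that by simp
    then show ?thesis unfolding null_infty_def by (auto simp del: upt_Suc)
  next
    case False
    show ?thesis
    proof (cases "\<exists>l\<le>s. l \<noteq> k \<and> i l = i k")
      case True
      then obtain l where l: "l \<le> s" "l \<noteq> k" "i l = i k" by blast
      then have "T l = T k" unfolding T_def by simp
      then show ?thesis unfolding null_infty_def using k l
        by (intro disjI2 disjI1 max_attained_twice_map[of k s l]) auto
    next
      case u: False
      have x: "\<beta> - unit_expo (i k) \<in> J" and y: "\<gamma> + unit_expo (i k) \<in> J" using False TJ by auto
      have lb: "lk \<beta> (i k) = lk \<alpha> (i k) + 1" by (rule unique_index[OF \<beta> k(1)]) (use u in blast)
      then have "lk (\<beta> - unit_expo (i k)) (i k) < lk (\<gamma> + unit_expo (i k)) (i k)"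
        using \<gamma>[of "i k"] by (simp add: lk_simps)
      then obtain c where c: "lk (\<gamma> + unit_expo (i k)) c < lk (\<beta> - unit_expo (i k)) c"
        "\<beta> - unit_expo (i k) + unit_expo (i k) - unit_expo c \<in> J" "\<gamma> + unit_expo (i k) - unit_expo (i k) + unit_expo c \<in> J"
        using M_convexD[OF M x y] by blast
      have "lk \<gamma> c < lk \<beta> c" using c(1) by (auto simp: lk_simps split: if_splits)
      then obtain m where m: "m \<le> s" "i m = c" using exchange_index[OF \<beta> \<gamma>] by blast
      have "\<beta> - unit_expo (i k) + unit_expo (i k) = \<beta>"
        using lb by (intro poly_mapping_eqI) (auto simp: lk_simps)
      then have Tm: "T m \<noteq> 0" using c(2,3) m TJ by simp
      have ikm: "i m \<noteq> i k" using c(1) m \<gamma>[of "i k"] lb by (auto simp: lk_simps)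
      show ?thesis
      proof (cases "\<exists>l\<le>s. l \<noteq> k \<and> l \<noteq> m \<and> T l \<noteq> 0")
        case True
        then obtain l where l: "l \<le> s" "l \<noteq> k" "l \<noteq> m" "T l \<noteq> 0" by blast
        have "{k, l, m} \<subseteq> {k. k < length (map T [0..<Suc s]) \<and> map T [0..<Suc s] ! k \<noteq> 0}"
          using k l m Tm False by (auto simp del: upt_Suc simp: less_Suc_eq_le)
        then have "card {k, l, m} \<le> card {k. k < length (map T [0..<Suc s]) \<and> map T [0..<Suc s] ! k \<noteq> 0}"
          by (intro card_mono) auto
        moreover have "k \<noteq> m" using ikm by auto
        then have "card {k, l, m} = 3" using l by simp
        ultimately show ?thesis unfolding null_infty_def by simp
      next
        case two: False
        have lm: "lk \<beta> (i m) = lk \<alpha> (i m) + 1"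
        proof (rule unique_index[OF \<beta> m(1)])
          fix l assume l: "l \<le> s" "i l = i m"
          then have "T l \<noteq> 0" using Tm unfolding T_def by simp
          then show "l = m" using two l ikm by metis
        qed
        have "T k = T m" unfolding T_def
        proof (rule two_term_relation[OF J M \<rho> w ikm[symmetric] \<beta>S])
          show "\<gamma> + unit_expo (i k) \<in> J" "\<gamma> + unit_expo (i m) \<in> J" "\<beta> - unit_expo (i k) \<in> J" "\<beta> - unit_expo (i m) \<in> J"
            using TJ Tm False by auto
          show "lk \<beta> (i k) \<le> lk \<gamma> (i k) + 1" "lk \<beta> (i m) \<le> lk \<gamma> (i m) + 1" using lb lm \<gamma> by simp_all
          fix c assume c: "c \<noteq> i k" "c \<noteq> i m" "lk \<gamma> c < lk \<beta> c"
          then obtain l where l: "l \<le> s" "i l = c" using exchange_index[OF \<beta> \<gamma>] by blast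
          then have "T l = 0" using two c by blast
          then show "\<beta> - unit_expo c \<notin> J \<or> \<gamma> + unit_expo c \<notin> J" using TJ l by auto
        qed
        then show ?thesis unfolding null_infty_def using k m ikm
          by (intro disjI2 disjI1 max_attained_twice_map[of k s m]) auto
      qed
    qed
  qed
  then show "null_infty (map (\<lambda>k. \<rho> (\<beta> - unit_expo (i k)) * \<rho> (\<gamma> + unit_expo (i k))) [0..<Suc s])"
    unfolding T_def .
qed

lemma strong_rep_three:
  assumes r: "strong_rep null n d J \<rho>" and d: "2 \<le> d" and \<alpha>: "\<alpha> \<in> simplex_pts n (d - 2)"
    and lo: "\<And>k. k < n \<Longrightarrow> delta_minus J k \<le> lk \<alpha> k"
    and hi: "\<And>k. k < n \<Longrightarrow> lk (\<alpha> + unit_expo a + unit_expo b + unit_expo c + unit_expo e) k \<le> delta_plus J k"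
    and abc: "a \<le> b" "b \<le> c" "c < n" "e < n"
  shows "null [hess \<rho> \<alpha> b c * hess \<rho> \<alpha> a e, hess \<rho> \<alpha> a c * hess \<rho> \<alpha> b e, hess \<rho> \<alpha> a b * hess \<rho> \<alpha> c e]"
proof -
  define i where "i m = (if m = 0 then a else if m = 1 then b else c)" for m :: nat
  define j where "j m = e" for m :: nat
  have s3: "{0..2::nat} = {0, 1, 2}" by auto
  have s1: "{2..2::nat} = {2}" by simp
  have "null (map (\<lambda>k. \<rho> (\<alpha> + (\<Sum>m\<in>{0..2} - {k}. unit_expo (i m))) *
                            \<rho> (\<alpha> + unit_expo (i k) + (\<Sum>m=2..2. unit_expo (j m)))) [0..<Suc 2])"
  proof -
    have "2 \<le> (2::nat) \<and> 2 \<le> d \<and> \<alpha> \<in> simplex_pts n (d - 2) \<and>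
        (\<forall>k<n. delta_minus J k \<le> Poly_Mapping.lookup \<alpha> k) \<and>
        i ` {0..2} \<subseteq> {..<n} \<and> mono_on {0..2} i \<and>
        j ` {2..2} \<subseteq> {..<n} \<and> mono_on {2..2} j \<and>
        (\<forall>k<n. Poly_Mapping.lookup
           (\<alpha> + (\<Sum>m=0..2. unit_expo (i m)) + (\<Sum>m=2..2. unit_expo (j m))) k \<le> delta_plus J k)"
      using d \<alpha> lo hi abc unfolding s3 s1 by (auto simp: i_def j_def mono_on_def ac_simps)
    then show ?thesis using r unfolding strong_rep_def by blast
  qed
  moreover have "[0..<Suc 2] = [0, 1, 2]" by (simp add: upt_rec)
  moreover have "{0..2} - {0} = {1, 2::nat}" "{0..2} - {1} = {0, 2::nat}" "{0..2} - {2} = {0, 1::nat}" by auto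
  ultimately show ?thesis by (simp add: i_def j_def hess_def ac_simps)
qed

text \<open>The strong relations ask for a nondecreasing \<open>i\<close>. Passing to a consequence
  \<open>R\<close> that is symmetric in its three arguments removes the ordering of
  \<open>a\<close>, \<open>b\<close>, \<open>c\<close>.\<close>

lemma strong_rep_three_any:
  assumes r: "strong_rep null n d J \<rho>" and d: "2 \<le> d" and \<alpha>: "\<alpha> \<in> simplex_pts n (d - 2)"
    and lo: "\<And>k. k < n \<Longrightarrow> delta_minus J k \<le> lk \<alpha> k"
    and hi: "\<And>k. k < n \<Longrightarrow> lk (\<alpha> + unit_expo a + unit_expo b + unit_expo c + unit_expo e) k \<le> delta_plus J k"
    and abc: "a < n" "b < n" "c < n" "e < n" and \<rho>: "\<And>\<alpha>. 0 \<le> \<rho> \<alpha>"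
    and R: "\<And>x y z. 0 \<le> x \<Longrightarrow> 0 \<le> y \<Longrightarrow> 0 \<le> z \<Longrightarrow> null [x, y, z] \<Longrightarrow> R x y z"
    and sw: "\<And>x y z. R x y z \<Longrightarrow> R y x z" "\<And>x y z. R x y z \<Longrightarrow> R x z y"
  shows "R (hess \<rho> \<alpha> b c * hess \<rho> \<alpha> a e) (hess \<rho> \<alpha> a c * hess \<rho> \<alpha> b e) (hess \<rho> \<alpha> a b * hess \<rho> \<alpha> c e)"
proof -
  have *: "R (hess \<rho> \<alpha> b c * hess \<rho> \<alpha> a e) (hess \<rho> \<alpha> a c * hess \<rho> \<alpha> b e) (hess \<rho> \<alpha> a b * hess \<rho> \<alpha> c e)"
    if "a \<le> b" "b \<le> c" "c < n"
      "\<And>k. k < n \<Longrightarrow> lk (\<alpha> + unit_expo a + unit_expo b + unit_expo c + unit_expo e) k \<le> delta_plus J k" for a b c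
    using strong_rep_three[OF r d \<alpha> lo that(4,1,2,3) abc(4)] \<rho> by (intro R) (auto simp: hess_def)
  have h: "\<And>x y. hess \<rho> \<alpha> x y = hess \<rho> \<alpha> y x" by (rule hess_sym)
  consider "a \<le> b" "b \<le> c" | "a \<le> c" "c \<le> b" | "b \<le> a" "a \<le> c" | "b \<le> c" "c \<le> a" | "c \<le> a" "a \<le> b" | "c \<le> b" "b \<le> a"
    by linarith
  then show ?thesis
  proof cases
    case 1
    then show ?thesis using * hi abc by blast
  next
    case 2
    have "R (hess \<rho> \<alpha> c b * hess \<rho> \<alpha> a e) (hess \<rho> \<alpha> a b * hess \<rho> \<alpha> c e) (hess \<rho> \<alpha> a c * hess \<rho> \<alpha> b e)"
      by (rule *[OF 2 abc(2)]) (use hi in \<open>simp add: ac_simps\<close>)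
    then show ?thesis using sw h by metis
  next
    case 3
    have "R (hess \<rho> \<alpha> a c * hess \<rho> \<alpha> b e) (hess \<rho> \<alpha> b c * hess \<rho> \<alpha> a e) (hess \<rho> \<alpha> b a * hess \<rho> \<alpha> c e)"
      by (rule *[OF 3 abc(3)]) (use hi in \<open>simp add: ac_simps\<close>)
    then show ?thesis using sw h by metis
  next
    case 4
    have "R (hess \<rho> \<alpha> c a * hess \<rho> \<alpha> b e) (hess \<rho> \<alpha> b a * hess \<rho> \<alpha> c e) (hess \<rho> \<alpha> b c * hess \<rho> \<alpha> a e)"
      by (rule *[OF 4 abc(1)]) (use hi in \<open>simp add: ac_simps\<close>)
    then show ?thesis using sw h by metis
  next
    case 5
    have "R (hess \<rho> \<alpha> a b * hess \<rho> \<alpha> c e) (hess \<rho> \<alpha> c b * hess \<rho> \<alpha> a e) (hess \<rho> \<alpha> c a * hess \<rho> \<alpha> b e)"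
      by (rule *[OF 5 abc(2)]) (use hi in \<open>simp add: ac_simps\<close>)
    then show ?thesis using sw h by metis
  next
    case 6
    have "R (hess \<rho> \<alpha> b a * hess \<rho> \<alpha> c e) (hess \<rho> \<alpha> c a * hess \<rho> \<alpha> b e) (hess \<rho> \<alpha> c b * hess \<rho> \<alpha> a e)"
      by (rule *[OF 6 abc(1)]) (use hi in \<open>simp add: ac_simps\<close>)
    then show ?thesis using sw h by metis
  qed
qed

lemma delta_bounds:
  assumes "finite J" "x \<in> J"
  shows "delta_minus J k \<le> lk x k" "lk x k \<le> delta_plus J k"
  unfolding delta_minus_def delta_plus_def using assms by (auto intro!: Min_le Max_ge)

text \<open>For disjoint pairs, \<alpha> is the coordinatewise minimum and the full sum the
  coordinatewise maximum of two points of \<open>J\<close>. Thus the bounds on \<alpha> in the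
  strong relations exclude no relation with a nonzero product.\<close>

lemma delta_bounds_pair:
  assumes J: "finite J" and x: "\<alpha> + unit_expo a + unit_expo b \<in> J" and y: "\<alpha> + unit_expo c + unit_expo e \<in> J"
    and dis: "a \<noteq> c" "a \<noteq> e" "b \<noteq> c" "b \<noteq> e"
  shows "delta_minus J k \<le> lk \<alpha> k"
    "lk (\<alpha> + unit_expo a + unit_expo b + unit_expo c + unit_expo e) k \<le> delta_plus J k"
proof -
  have "lk \<alpha> k = min (lk (\<alpha> + unit_expo a + unit_expo b) k) (lk (\<alpha> + unit_expo c + unit_expo e) k)"
    using dis by (auto simp: lk_simps)
  then show "delta_minus J k \<le> lk \<alpha> k" using delta_bounds(1)[OF J x, of k] delta_bounds(1)[OF J y, of k] by simp
  have "lk (\<alpha> + unit_expo a + unit_expo b + unit_expo c + unit_expo e) k =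
      max (lk (\<alpha> + unit_expo a + unit_expo b) k) (lk (\<alpha> + unit_expo c + unit_expo e) k)"
    using dis by (auto simp: lk_simps)
  then show "lk (\<alpha> + unit_expo a + unit_expo b + unit_expo c + unit_expo e) k \<le> delta_plus J k"
    using delta_bounds(2)[OF J x, of k] delta_bounds(2)[OF J y, of k] by simp
qed

lemma less_three_cases: "k < 3 \<Longrightarrow> k = 0 \<or> k = 1 \<or> k = (2::nat)"
  by linarith

lemma max_attained_twice_three:
  assumes "max_attained_twice [x, y, z]"
  shows "x = y \<and> z \<le> x \<or> x = z \<and> y \<le> x \<or> y = z \<and> x \<le> y"
proof -
  obtain k l where kl: "k < 3" "l < 3" "k \<noteq> l" "[x, y, z] ! k = [x, y, z] ! l" "\<And>m. m < 3 \<Longrightarrow> [x, y, z] ! m \<le> [x, y, z] ! k"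
    using assms unfolding max_attained_twice_def by (auto simp: numeral_3_eq_3)
  show ?thesis
    using less_three_cases[OF kl(1)] less_three_cases[OF kl(2)] kl(3,4) kl(5)[of 0] kl(5)[of 1] kl(5)[of 2]
    by auto
qed

lemma null_zero_three:
  assumes "null_zero [x, y, z]" "0 \<le> x" "0 \<le> y" "0 \<le> z"
  shows "x \<le> max y z \<and> y \<le> max x z \<and> z \<le> max x y"
proof (cases "\<forall>k<length [x, y, z]. [x, y, z] ! k = 0")
  case True
  from True[rule_format, of 0] True[rule_format, of 1] True[rule_format, of 2] show ?thesis by simp
next
  case False
  then show ?thesis using assms max_attained_twice_three unfolding null_zero_def by force
qed

lemma null_infty_three:
  assumes "null_infty [x, y, z]" "0 \<le> x" "0 \<le> y" "0 \<le> z"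
  shows "(x = 0 \<longrightarrow> y = z) \<and> (y = 0 \<longrightarrow> x = z) \<and> (z = 0 \<longrightarrow> x = y)"
proof -
  consider "\<forall>k<length [x, y, z]. [x, y, z] ! k = 0" | "max_attained_twice [x, y, z]"
    | "3 \<le> card {k. k < length [x, y, z] \<and> [x, y, z] ! k \<noteq> 0}"
    using assms(1) unfolding null_infty_def by blast
  then show ?thesis
  proof cases
    case 1
    from 1[rule_format, of 0] 1[rule_format, of 1] 1[rule_format, of 2] show ?thesis by simp
  next
    case 2
    then show ?thesis using assms(2-4) max_attained_twice_three by force
  next
    case 3
    have "{k. k < length [x, y, z] \<and> [x, y, z] ! k \<noteq> 0} = {..<3}"
    proof (rule card_subset_eq)
      show "{k. k < length [x, y, z] \<and> [x, y, z] ! k \<noteq> 0} \<subseteq> {..<3}" by auto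
      then have "card {k. k < length [x, y, z] \<and> [x, y, z] ! k \<noteq> 0} \<le> card {..<3::nat}"
        by (intro card_mono) auto
      then show "card {k. k < length [x, y, z] \<and> [x, y, z] ! k \<noteq> 0} = card {..<3::nat}" using 3 by simp
    qed simp
    then have "[x, y, z] ! k \<noteq> 0" if "k < 3" for k using that by blast
    from this[of 0] this[of 1] this[of 2] show ?thesis by simp
  qed
qed

text \<open>Only nonzero products need an argument. If the pairs {i, j} and {k, l} meet, a product
  on the right equals the left one; if they are disjoint, the bounds by the extreme coordinates of
  \<open>J\<close> hold automatically.\<close>

lemma strong_rep_imp_weak_zero:
  assumes J: "J \<subseteq> simplex_pts n d" and \<rho>: "supp_on J \<rho>" and r: "strong_rep null_zero n d J \<rho>"
  shows "hess_all weak_zero n d \<rho>"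
  unfolding hess_all_def weak_zero_def
proof (intro impI ballI)
  fix \<alpha> i j k l assume d: "2 \<le> d" and \<alpha>: "\<alpha> \<in> simplex_pts n (d - 2)"
    and ijkl: "i \<in> {..<n}" "j \<in> {..<n}" "k \<in> {..<n}" "l \<in> {..<n}"
  have fJ: "finite J" using J finite_simplex_pts finite_subset by blast
  have h0: "0 \<le> hess \<rho> \<alpha> a b" for a b unfolding hess_def using supp_onD(1)[OF \<rho>] .
  show "hess \<rho> \<alpha> i j * hess \<rho> \<alpha> k l \<le> max (hess \<rho> \<alpha> i k * hess \<rho> \<alpha> j l) (hess \<rho> \<alpha> i l * hess \<rho> \<alpha> j k)"
  proof (cases "hess \<rho> \<alpha> i j * hess \<rho> \<alpha> k l = 0")
    case True
    show ?thesis unfolding True using h0 by (simp add: le_max_iff_disj)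
  next
    case False
    then have x: "\<alpha> + unit_expo i + unit_expo j \<in> J" and y: "\<alpha> + unit_expo k + unit_expo l \<in> J"
      using supp_onD(2)[OF \<rho>] unfolding hess_def by auto
    show ?thesis
    proof (cases "i = k \<or> i = l \<or> j = k \<or> j = l")
      case True
      then consider "i = k" | "i = l" | "j = k" | "j = l" by blast
      then show ?thesis
        by cases (simp_all add: le_max_iff_disj hess_sym[of \<rho> \<alpha> k j] hess_sym[of \<rho> \<alpha> l j] hess_sym[of \<rho> \<alpha> k l] mult.commute)
    next
      case dis: False
      then have dis: "i \<noteq> k" "i \<noteq> l" "j \<noteq> k" "j \<noteq> l" by auto
      have "(\<lambda>x y z. x \<le> max y z \<and> y \<le> max x z \<and> z \<le> max x y) (hess \<rho> \<alpha> j k * hess \<rho> \<alpha> i l) (hess \<rho> \<alpha> i k * hess \<rho> \<alpha> j l) (hess \<rho> \<alpha> i j * hess \<rho> \<alpha> k l)"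
      proof (rule strong_rep_three_any[OF r d \<alpha> delta_bounds_pair[OF fJ x y dis]])
        show "i < n" "j < n" "k < n" "l < n" using ijkl by auto
      qed (use supp_onD(1)[OF \<rho>] null_zero_three in \<open>auto simp: max.commute\<close>)
      then show ?thesis by (simp add: max.commute mult.commute)
    qed
  qed
qed

lemma strong_rep_imp_weak_infty:
  assumes J: "J \<subseteq> simplex_pts n d" and \<rho>: "supp_on J \<rho>" and r: "strong_rep null_infty n d J \<rho>"
  shows "hess_all weak_infty n d \<rho>"
  unfolding hess_all_def weak_infty_def
proof (intro impI ballI)
  fix \<alpha> a a' b c assume d: "2 \<le> d" and \<alpha>: "\<alpha> \<in> simplex_pts n (d - 2)"
    and abc: "a \<in> {..<n}" "a' \<in> {..<n}" "b \<in> {..<n}" "c \<in> {..<n}" and z: "hess \<rho> \<alpha> a a' = 0"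
  have fJ: "finite J" using J finite_simplex_pts finite_subset by blast
  \<comment> \<open>Proved for a nonzero left side; interchanging \<open>b\<close> and
    \<open>c\<close> covers a nonzero right side, and otherwise both sides are 0.\<close>
  have *: "hess \<rho> \<alpha> a b * hess \<rho> \<alpha> a' c = hess \<rho> \<alpha> a c * hess \<rho> \<alpha> a' b"
    if bc: "b < n" "c < n" and nz: "hess \<rho> \<alpha> a b * hess \<rho> \<alpha> a' c \<noteq> 0" for b c
  proof (cases "a = a' \<or> b = c")
    case True
    then show ?thesis by (auto simp: mult.commute)
  next
    case False
    have x: "\<alpha> + unit_expo a + unit_expo b \<in> J" and y: "\<alpha> + unit_expo a' + unit_expo c \<in> J"
      using nz supp_onD(2)[OF \<rho>] unfolding hess_def by auto
    have "b \<noteq> a'" using nz z by auto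
    moreover have "a \<noteq> c" using nz z hess_sym[of \<rho> \<alpha> a' a] by auto
    ultimately have dis: "a \<noteq> a'" "a \<noteq> c" "b \<noteq> a'" "b \<noteq> c" using False by auto
    have "(\<lambda>x y z. (x = 0 \<longrightarrow> y = z) \<and> (y = 0 \<longrightarrow> x = z) \<and> (z = 0 \<longrightarrow> x = y))
        (hess \<rho> \<alpha> b a' * hess \<rho> \<alpha> a c) (hess \<rho> \<alpha> a a' * hess \<rho> \<alpha> b c) (hess \<rho> \<alpha> a b * hess \<rho> \<alpha> a' c)"
    proof (rule strong_rep_three_any[OF r d \<alpha> delta_bounds_pair[OF fJ x y dis]])
      show "a < n" "b < n" "a' < n" "c < n" using abc bc by auto
      show "0 \<le> \<rho> \<alpha>" for \<alpha> by (rule supp_onD(1)[OF \<rho>])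
      fix x y z :: real
      assume "0 \<le> x" "0 \<le> y" "0 \<le> z" "null_infty [x, y, z]"
      then show "(x = 0 \<longrightarrow> y = z) \<and> (y = 0 \<longrightarrow> x = z) \<and> (z = 0 \<longrightarrow> x = y)" by (intro null_infty_three)
    next
      fix x y z :: real
      assume "(x = 0 \<longrightarrow> y = z) \<and> (y = 0 \<longrightarrow> x = z) \<and> (z = 0 \<longrightarrow> x = y)"
      then show "(y = 0 \<longrightarrow> x = z) \<and> (x = 0 \<longrightarrow> y = z) \<and> (z = 0 \<longrightarrow> y = x)"
        "(x = 0 \<longrightarrow> z = y) \<and> (z = 0 \<longrightarrow> x = y) \<and> (y = 0 \<longrightarrow> x = z)" by metis+
    qed
    then have "hess \<rho> \<alpha> b a' * hess \<rho> \<alpha> a c = hess \<rho> \<alpha> a b * hess \<rho> \<alpha> a' c" using z by simp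
    then show ?thesis unfolding hess_sym[of \<rho> \<alpha> b a'] by (simp only: mult.commute)
  qed
  show "hess \<rho> \<alpha> a b * hess \<rho> \<alpha> a' c = hess \<rho> \<alpha> a c * hess \<rho> \<alpha> a' b"
    using *[of b c] *[of c b] abc by (metis lessThan_iff)
qed

section \<open>Logarithmic coordinates\<close>

definition supported :: "expo set \<Rightarrow> (expo \<Rightarrow> real) set" where
  "supported J = {v. \<forall>\<alpha>. \<alpha> \<notin> J \<longrightarrow> v \<alpha> = 0}"

definition exp_on :: "expo set \<Rightarrow> (expo \<Rightarrow> real) \<Rightarrow> expo \<Rightarrow> real" where
  "exp_on J v \<alpha> = (if \<alpha> \<in> J then exp (v \<alpha>) else 0)"

text \<open>One definition serves for V_J (\<open>weak_infty\<close>), for the normalised logarithms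
  of Lorentzian polynomials (\<open>lor\<close>) and for the Dressian
  (\<open>weak_zero\<close>).\<close>

definition log_set :: "(nat set \<Rightarrow> (nat \<Rightarrow> nat \<Rightarrow> real) \<Rightarrow> bool) \<Rightarrow> nat \<Rightarrow> nat \<Rightarrow> expo set \<Rightarrow> (expo \<Rightarrow> real) set" where
  "log_set P n d J = {v \<in> supported J. hess_all P n d (exp_on J v)}"

lemma supp_on_exp_on: "supp_on J (exp_on J v)"
  unfolding supp_on_def exp_on_def by auto

lemma exp_on_nonneg: "0 \<le> exp_on J v \<alpha>"
  unfolding exp_on_def by simp

lemma exp_on_eq_0_iff: "exp_on J v \<alpha> = 0 \<longleftrightarrow> \<alpha> \<notin> J"
  unfolding exp_on_def by simp

lemma hess_nonneg: "0 \<le> hess (exp_on J v) \<alpha> i j"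
  unfolding hess_def by (rule exp_on_nonneg)

lemma log_vec_strong_rep:
  assumes J: "J \<subseteq> simplex_pts n d"
  shows "log_vec J ` {\<rho>. strong_rep null n d J \<rho>} = {v \<in> supported J. strong_rep null n d J (exp_on J v)}"
proof (intro subset_antisym subsetI)
  fix v assume "v \<in> log_vec J ` {\<rho>. strong_rep null n d J \<rho>}"
  then obtain \<rho> where \<rho>: "strong_rep null n d J \<rho>" and v: "v = log_vec J \<rho>" by blast
  have pos: "\<forall>\<alpha>\<in>simplex_pts n d. 0 \<le> \<rho> \<alpha>" and supp: "{\<alpha> \<in> simplex_pts n d. \<rho> \<alpha> \<noteq> 0} = J"
    using \<rho> unfolding strong_rep_def by blast+
  have "strong_rep null n d J (exp_on J v)"
  proof (rule strong_rep_cong[OF _ \<rho>])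
    fix \<alpha> assume \<alpha>: "\<alpha> \<in> simplex_pts n d"
    show "\<rho> \<alpha> = exp_on J v \<alpha>"
    proof (cases "\<alpha> \<in> J")
      case True
      then have "0 < \<rho> \<alpha>" using supp pos \<alpha> by (force simp: less_le)
      then show ?thesis using True by (simp add: v log_vec_def exp_on_def)
    next
      case False
      then have "\<rho> \<alpha> = 0" using supp \<alpha> by blast
      then show ?thesis using False by (simp add: exp_on_def)
    qed
  qed
  then show "v \<in> {v \<in> supported J. strong_rep null n d J (exp_on J v)}"
    unfolding v supported_def log_vec_def by simp
next
  fix v assume v: "v \<in> {v \<in> supported J. strong_rep null n d J (exp_on J v)}"
  then have "log_vec J (exp_on J v) = v" unfolding log_vec_def exp_on_def supported_def by auto
  then show "v \<in> log_vec J ` {\<rho>. strong_rep null n d J \<rho>}" using v by force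
qed

lemma V_space_eq:
  assumes "J \<subseteq> simplex_pts n d" "M_convex J"
  shows "V_space n d J = log_set weak_infty n d J"
  unfolding V_space_def log_vec_strong_rep[OF assms(1)] log_set_def
  using strong_rep_imp_weak_infty[OF assms(1) supp_on_exp_on] weak_infty_imp_strong_rep[OF assms supp_on_exp_on] by blast

lemma strong_rep_zero_eq:
  assumes "J \<subseteq> simplex_pts n d" "M_convex J"
  shows "log_vec J ` {\<rho>. strong_rep null_zero n d J \<rho>} = log_set weak_zero n d J"
  unfolding log_vec_strong_rep[OF assms(1)] log_set_def
  using strong_rep_imp_weak_zero[OF assms(1) supp_on_exp_on] weak_zero_imp_strong_rep[OF assms supp_on_exp_on] by blast

lemma log_set_lor_subset: "log_set lor n d J \<subseteq> log_set weak_infty n d J"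
  unfolding log_set_def hess_all_def
  using lor_imp_weak_infty[OF finite_lessThan hess_sym_on hess_nonneg] by blast

lemma log_set_weak_zero_subset: "log_set weak_zero n d J \<subseteq> log_set lor n d J"
  unfolding log_set_def hess_all_def
  using weak_zero_imp_lor[OF finite_lessThan hess_sym_on hess_nonneg] by blast

text \<open>For the indicator of \<open>J\<close> the tropical relation is the exchange property
  between two points of \<open>J\<close> that share the part \<alpha>: the index returned can only
  be \<open>i\<close> or \<open>j\<close>.\<close>

lemma zero_in_log_set:
  assumes M: "M_convex J"
  shows "(\<lambda>_. 0) \<in> log_set weak_zero n d J"
proof -
  have "weak_zero I (hess (exp_on J (\<lambda>_. 0)) \<alpha>)" for I \<alpha>
    unfolding weak_zero_def
  proof (intro ballI)
    fix i j k l
    let ?h = "hess (exp_on J (\<lambda>_. 0)) \<alpha>"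
    have h: "?h a b = (if \<alpha> + unit_expo a + unit_expo b \<in> J then 1 else 0)" for a b
      unfolding hess_def exp_on_def by simp
    show "?h i j * ?h k l \<le> max (?h i k * ?h j l) (?h i l * ?h j k)"
    proof (cases "\<alpha> + unit_expo i + unit_expo j \<in> J \<and> \<alpha> + unit_expo k + unit_expo l \<in> J")
      case False
      then show ?thesis by (auto simp: h)
    next
      case True
      then have x: "\<alpha> + unit_expo i + unit_expo j \<in> J" and y: "\<alpha> + unit_expo k + unit_expo l \<in> J" by auto
      show ?thesis
      proof (cases "i = k \<or> i = l \<or> j = k \<or> j = l")
        case True
        then consider "i = k" | "i = l" | "j = k" | "j = l" by blast
        then show ?thesis
          by cases (simp_all add: le_max_iff_disj hess_sym[of _ \<alpha> k j] hess_sym[of _ \<alpha> l j] hess_sym[of _ \<alpha> k l] mult.commute)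
      next
        case False
        then have dis: "i \<noteq> k" "i \<noteq> l" "j \<noteq> k" "j \<noteq> l" by auto
        have "lk (\<alpha> + unit_expo i + unit_expo j) k < lk (\<alpha> + unit_expo k + unit_expo l) k"
          using dis by (simp add: lk_simps)
        from M_convexD[OF M x y this] obtain c where
          c: "lk (\<alpha> + unit_expo k + unit_expo l) c < lk (\<alpha> + unit_expo i + unit_expo j) c"
            "\<alpha> + unit_expo i + unit_expo j + unit_expo k - unit_expo c \<in> J"
            "\<alpha> + unit_expo k + unit_expo l - unit_expo k + unit_expo c \<in> J" .
        have "c = i \<or> c = j" using c(1) by (auto simp: lk_simps split: if_splits)
        then show ?thesis
        proof
          assume ci: "c = i"
          have "\<alpha> + unit_expo i + unit_expo j + unit_expo k - unit_expo c = \<alpha> + unit_expo j + unit_expo k"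
            "\<alpha> + unit_expo k + unit_expo l - unit_expo k + unit_expo c = \<alpha> + unit_expo i + unit_expo l"
            unfolding ci by (auto intro!: poly_mapping_eqI simp: lk_simps)
          then have "?h i l * ?h j k = 1" using c(2,3) by (simp add: h)
          then show ?thesis by (simp add: h le_max_iff_disj)
        next
          assume cj: "c = j"
          have "\<alpha> + unit_expo i + unit_expo j + unit_expo k - unit_expo c = \<alpha> + unit_expo i + unit_expo k"
            "\<alpha> + unit_expo k + unit_expo l - unit_expo k + unit_expo c = \<alpha> + unit_expo j + unit_expo l"
            unfolding cj by (auto intro!: poly_mapping_eqI simp: lk_simps)
          then have "?h i k * ?h j l = 1" using c(2,3) by (simp add: h)
          then show ?thesis by (simp add: h le_max_iff_disj)
        qed
      qed
    qed
  qed
  then show ?thesis unfolding log_set_def hess_all_def supported_def by simp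
qed

text \<open>The multiplicative relation becomes a linear equation under the logarithm, provided that
  both of its sides vanish together. Whether they vanish depends on \<open>J\<close> alone, so this
  is checked on the indicator of \<open>J\<close>. Linearity and scalar stability of V_J
  follow.\<close>

lemma log_set_infty_iff:
  assumes M: "M_convex J"
  shows "v \<in> log_set weak_infty n d J \<longleftrightarrow> v \<in> supported J \<and> (2 \<le> d \<longrightarrow>
    (\<forall>\<alpha>\<in>simplex_pts n (d - 2). \<forall>a<n. \<forall>a'<n. \<forall>b<n. \<forall>c<n.
      \<alpha> + unit_expo a + unit_expo a' \<notin> J \<longrightarrow>
      \<alpha> + unit_expo a + unit_expo b \<in> J \<longrightarrow> \<alpha> + unit_expo a' + unit_expo c \<in> J \<longrightarrow>
      v (\<alpha> + unit_expo a + unit_expo b) + v (\<alpha> + unit_expo a' + unit_expo c) =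
      v (\<alpha> + unit_expo a + unit_expo c) + v (\<alpha> + unit_expo a' + unit_expo b)))"
    (is "_ \<longleftrightarrow> ?R")
proof -
  have z: "(\<lambda>_. 0) \<in> log_set weak_infty n d J"
    using zero_in_log_set[OF M] log_set_weak_zero_subset log_set_lor_subset by blast
  have supp: "\<alpha> + unit_expo a + unit_expo b \<in> J \<and> \<alpha> + unit_expo a' + unit_expo c \<in> J \<longleftrightarrow>
     \<alpha> + unit_expo a + unit_expo c \<in> J \<and> \<alpha> + unit_expo a' + unit_expo b \<in> J"
    if d: "2 \<le> d" "\<alpha> \<in> simplex_pts n (d - 2)" and I: "a < n" "a' < n" "b < n" "c < n"
      and nJ: "\<alpha> + unit_expo a + unit_expo a' \<notin> J" for \<alpha> a a' b c
  proof -
    let ?h = "hess (exp_on J (\<lambda>_. 0)) \<alpha>"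
    have "weak_infty {..<n} ?h" using z d unfolding log_set_def hess_all_def by blast
    moreover have "?h a a' = 0" using nJ by (simp add: hess_def exp_on_eq_0_iff)
    ultimately have "?h a b * ?h a' c = ?h a c * ?h a' b" using I unfolding weak_infty_def by blast
    then show ?thesis unfolding hess_def exp_on_def by (auto split: if_splits)
  qed
  show ?thesis
  proof
    assume v: "v \<in> log_set weak_infty n d J"
    show ?R
    proof (intro conjI impI ballI allI)
      show "v \<in> supported J" using v unfolding log_set_def by blast
      fix \<alpha> a a' b c assume h: "2 \<le> d" "\<alpha> \<in> simplex_pts n (d - 2)" "a < n" "a' < n" "b < n" "c < n"
        "\<alpha> + unit_expo a + unit_expo a' \<notin> J" "\<alpha> + unit_expo a + unit_expo b \<in> J" "\<alpha> + unit_expo a' + unit_expo c \<in> J"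
      let ?h = "hess (exp_on J v) \<alpha>"
      have "weak_infty {..<n} ?h" using v h unfolding log_set_def hess_all_def by blast
      moreover have "?h a a' = 0" using h by (simp add: hess_def exp_on_eq_0_iff)
      ultimately have "?h a b * ?h a' c = ?h a c * ?h a' b" using h unfolding weak_infty_def by blast
      then show "v (\<alpha> + unit_expo a + unit_expo b) + v (\<alpha> + unit_expo a' + unit_expo c) =
        v (\<alpha> + unit_expo a + unit_expo c) + v (\<alpha> + unit_expo a' + unit_expo b)"
        using h supp[OF h(1-7)] by (simp add: hess_def exp_on_def exp_add[symmetric])
    qed
  next
    assume R: ?R
    show "v \<in> log_set weak_infty n d J"
      unfolding log_set_def hess_all_def weak_infty_def
    proof (intro CollectI conjI impI ballI)
      show "v \<in> supported J" using R by blast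
      fix \<alpha> a a' b c
      let ?h = "hess (exp_on J v) \<alpha>"
      assume h: "2 \<le> d" "\<alpha> \<in> simplex_pts n (d - 2)" "a \<in> {..<n}" "a' \<in> {..<n}" "b \<in> {..<n}" "c \<in> {..<n}" "?h a a' = 0"
      have nJ: "\<alpha> + unit_expo a + unit_expo a' \<notin> J" using h(7) by (simp add: hess_def exp_on_eq_0_iff)
      show "?h a b * ?h a' c = ?h a c * ?h a' b"
      proof (cases "\<alpha> + unit_expo a + unit_expo b \<in> J \<and> \<alpha> + unit_expo a' + unit_expo c \<in> J")
        case True
        then have "v (\<alpha> + unit_expo a + unit_expo b) + v (\<alpha> + unit_expo a' + unit_expo c) =
          v (\<alpha> + unit_expo a + unit_expo c) + v (\<alpha> + unit_expo a' + unit_expo b)"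
          using R h(1,2) h(3-6)[unfolded lessThan_iff] nJ by blast
        moreover have "\<alpha> + unit_expo a + unit_expo c \<in> J \<and> \<alpha> + unit_expo a' + unit_expo b \<in> J"
          using supp[OF h(1,2) _ _ _ _ nJ] h True by auto
        ultimately show ?thesis using True by (simp add: hess_def exp_on_def exp_add[symmetric])
      next
        case False
        then have "\<not> (\<alpha> + unit_expo a + unit_expo c \<in> J \<and> \<alpha> + unit_expo a' + unit_expo b \<in> J)"
          using supp[OF h(1,2) _ _ _ _ nJ] h by auto
        then show ?thesis using False unfolding hess_def exp_on_def by auto
      qed
    qed
  qed
qed

lemma log_set_infty_lincomb:
  assumes M: "M_convex J" and v: "v \<in> log_set weak_infty n d J" and w: "w \<in> log_set weak_infty n d J"
  shows "(\<lambda>\<alpha>. a * v \<alpha> + b * w \<alpha>) \<in> log_set weak_infty n d J"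
  unfolding log_set_infty_iff[OF M]
proof (intro conjI impI ballI allI)
  note V = v[unfolded log_set_infty_iff[OF M]] and W = w[unfolded log_set_infty_iff[OF M]]
  show "(\<lambda>\<alpha>. a * v \<alpha> + b * w \<alpha>) \<in> supported J" using V W unfolding supported_def by simp
  fix \<alpha> p q r s assume h: "2 \<le> d" "\<alpha> \<in> simplex_pts n (d - 2)" "p < n" "q < n" "r < n" "s < n"
    "\<alpha> + unit_expo p + unit_expo q \<notin> J" "\<alpha> + unit_expo p + unit_expo r \<in> J" "\<alpha> + unit_expo q + unit_expo s \<in> J"
  let ?A = "\<alpha> + unit_expo p + unit_expo r" and ?B = "\<alpha> + unit_expo q + unit_expo s"
    and ?C = "\<alpha> + unit_expo p + unit_expo s" and ?D = "\<alpha> + unit_expo q + unit_expo r"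
  have 1: "v ?A + v ?B = v ?C + v ?D" using V h by blast
  have 2: "w ?A + w ?B = w ?C + w ?D" using W h by blast
  have "a * v ?A + b * w ?A + (a * v ?B + b * w ?B) = a * (v ?A + v ?B) + b * (w ?A + w ?B)"
    by (simp only: distrib_left ac_simps)
  also have "\<dots> = a * v ?C + b * w ?C + (a * v ?D + b * w ?D)" unfolding 1 2
    by (simp only: distrib_left ac_simps)
  finally show "a * v ?A + b * w ?A + (a * v ?B + b * w ?B) = a * v ?C + b * w ?C + (a * v ?D + b * w ?D)" .
qed

lemma sum_lookup_linear:
  fixes c :: "nat \<Rightarrow> real"
  assumes "i < n" "j < n"
  shows "(\<Sum>k<n. c k * real (lk (\<alpha> + unit_expo i + unit_expo j) k)) = (\<Sum>k<n. c k * real (lk \<alpha> k)) + c i + c j"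
proof -
  have "(\<Sum>k<n. c k * real (lk (\<alpha> + unit_expo i + unit_expo j) k)) =
      (\<Sum>k<n. c k * real (lk \<alpha> k) + (if k = i then c k else 0) + (if k = j then c k else 0))"
    by (intro sum.cong refl) (auto simp: lk_simps algebra_simps)
  then show ?thesis using assms by (simp add: sum.distrib)
qed

text \<open>Adding an element of W_J to the zero vector scales rows and columns of the Hessians of
  the indicator of \<open>J\<close>, and the relations are homogeneous under such scaling.\<close>

lemma W_space_subset:
  assumes M: "M_convex J" shows "W_space n J \<subseteq> log_set weak_infty n d J"
proof
  fix w assume "w \<in> W_space n J"
  then obtain c where w: "w = (\<lambda>\<alpha>. if \<alpha> \<in> J then \<Sum>i<n. c i * real (lk \<alpha> i) else 0)"
    unfolding W_space_def by blast
  have z: "(\<lambda>_. 0) \<in> log_set weak_infty n d J"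
    using zero_in_log_set[OF M] log_set_weak_zero_subset log_set_lor_subset by blast
  show "w \<in> log_set weak_infty n d J"
    unfolding log_set_def hess_all_def weak_infty_def
  proof (intro CollectI conjI impI ballI)
    show "w \<in> supported J" unfolding w supported_def by simp
    fix \<alpha> a a' b c'
    let ?h = "hess (exp_on J w) \<alpha>" and ?z = "hess (exp_on J (\<lambda>_. 0)) \<alpha>"
    assume h: "2 \<le> d" "\<alpha> \<in> simplex_pts n (d - 2)" "a \<in> {..<n}" "a' \<in> {..<n}" "b \<in> {..<n}" "c' \<in> {..<n}" "?h a a' = 0"
    define K where "K = exp (\<Sum>k<n. c k * real (lk \<alpha> k))"
    have hh: "?h i j = K * exp (c i) * exp (c j) * ?z i j" if "i < n" "j < n" for i j
    proof (cases "\<alpha> + unit_expo i + unit_expo j \<in> J")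
      case True
      then have "w (\<alpha> + unit_expo i + unit_expo j) = (\<Sum>k<n. c k * real (lk \<alpha> k)) + c i + c j"
        using sum_lookup_linear[OF that, of c \<alpha>] by (simp add: w)
      then show ?thesis using True by (simp add: hess_def exp_on_def K_def exp_add)
    qed (simp add: hess_def exp_on_def)
    have "weak_infty {..<n} ?z" using z h unfolding log_set_def hess_all_def by blast
    moreover have "?z a a' = 0" using h(7) by (simp add: hess_def exp_on_eq_0_iff)
    ultimately have "?z a b * ?z a' c' = ?z a c' * ?z a' b" using h unfolding weak_infty_def by blast
    then show "?h a b * ?h a' c' = ?h a c' * ?h a' b" using h by (simp add: hh)
  qed
qed

text \<open>In a Hessian, adding \<open>- s \<Sum>\<alpha>\<^sub>k\<^sup>2\<close> to the logarithms rescales rows and columns and multiplies the diagonal by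
  \<open>exp (- 2 s) < 1\<close>. This makes \<open>- \<Sum>\<alpha>\<^sub>k\<^sup>2\<close> a star centre for the logarithms of Lorentzian polynomials.\<close>

definition quad_center :: "nat \<Rightarrow> expo set \<Rightarrow> expo \<Rightarrow> real" where
  "quad_center n J = (\<lambda>\<alpha>. if \<alpha> \<in> J then - (\<Sum>k<n. (real (lk \<alpha> k))\<^sup>2) else 0)"

lemma sum_lookup_square:
  assumes "i < n" "j < n"
  shows "(\<Sum>k<n. (real (lk (\<alpha> + unit_expo i + unit_expo j) k))\<^sup>2) =
    (\<Sum>k<n. (real (lk \<alpha> k))\<^sup>2) + 2 + 2 * real (lk \<alpha> i) + 2 * real (lk \<alpha> j) + (if i = j then 2 else 0)"
proof -
  have "(\<Sum>k<n. (real (lk (\<alpha> + unit_expo i + unit_expo j) k))\<^sup>2) =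
      (\<Sum>k<n. (real (lk \<alpha> k))\<^sup>2 + (if k = i then 2 * real (lk \<alpha> k) + 1 else 0) + (if k = j then 2 * real (lk \<alpha> k) + 1 else 0)
         + (if k = i then if i = j then 2 else 0 else 0))"
    by (intro sum.cong refl) (auto simp: lk_simps algebra_simps power2_eq_square)
  then show ?thesis using assms by (simp add: sum.distrib)
qed

lemma hess_exp_on_transform:
  assumes w: "w \<in> W_space n J"
  shows "\<exists>r. (\<forall>i<n. 0 < r i) \<and> (\<forall>i<n. \<forall>j<n. hess (exp_on J (\<lambda>\<beta>. p * v \<beta> + s * quad_center n J \<beta> + w \<beta>)) \<alpha> i j =
    r i * r j * ((if i = j then exp (- 2 * s) else 1) * hess (exp_on J v) \<alpha> i j powr p))"
proof -
  obtain c where w: "w = (\<lambda>\<alpha>. if \<alpha> \<in> J then \<Sum>i<n. c i * real (lk \<alpha> i) else 0)"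
    using w unfolding W_space_def by blast
  define S where "S = (\<Sum>k<n. (real (lk \<alpha> k))\<^sup>2)"
  define C where "C = (\<Sum>k<n. c k * real (lk \<alpha> k))"
  \<comment> \<open>The part of the exponent common to all entries is split evenly between the row
    and the column factor. The only inseparable part is the extra 2 that a sum of squares acquires
    when \<open>i = j\<close>.\<close>
  define r where "r i = exp ((- s * (S + 2) + C) / 2 - 2 * s * real (lk \<alpha> i) + c i)" for i
  show ?thesis
  proof (intro exI[of _ r] conjI allI impI)
    show "0 < r i" for i unfolding r_def by simp
    fix i j assume ij: "i < n" "j < n"
    let ?b = "\<alpha> + unit_expo i + unit_expo j"
    show "hess (exp_on J (\<lambda>\<beta>. p * v \<beta> + s * quad_center n J \<beta> + w \<beta>)) \<alpha> i j =
      r i * r j * ((if i = j then exp (- 2 * s) else 1) * hess (exp_on J v) \<alpha> i j powr p)"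
    proof (cases "?b \<in> J")
      case True
      have "p * v ?b + s * quad_center n J ?b + w ?b =
        ((- s * (S + 2) + C) / 2 - 2 * s * real (lk \<alpha> i) + c i) + ((- s * (S + 2) + C) / 2 - 2 * s * real (lk \<alpha> j) + c j)
         + ((if i = j then - 2 * s else 0) + p * v ?b)"
      proof -
        have q: "quad_center n J ?b = - (S + 2 + 2 * real (lk \<alpha> i) + 2 * real (lk \<alpha> j) + (if i = j then 2 else 0))"
          using True unfolding quad_center_def S_def sum_lookup_square[OF ij, symmetric] by simp
        have wb: "w ?b = C + c i + c j"
          using True unfolding C_def sum_lookup_linear[OF ij, symmetric] by (simp add: w)
        show ?thesis unfolding q wb by (cases "i = j") (simp_all add: field_simps)
      qed
      then show ?thesis using True unfolding hess_def exp_on_def r_def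
        by (simp only: exp_add if_True) (auto simp: powr_def)
    next
      case False
      then show ?thesis unfolding hess_def exp_on_def by simp
    qed
  qed
qed

text \<open>The end values matter as well: \<open>p = 1\<close>, \<open>s = 0\<close> is invariance
  under W_J, and the zero vector with \<open>p = s = 1\<close> yields the star centre.\<close>

lemma log_set_lor_contract:
  assumes v: "v \<in> log_set lor n d J" and w: "w \<in> W_space n J" and p: "0 < p" "p \<le> 1" and s: "0 \<le> s"
  shows "(\<lambda>\<beta>. p * v \<beta> + s * quad_center n J \<beta> + w \<beta>) \<in> log_set lor n d J"
proof -
  have "lor {..<n} (hess (exp_on J (\<lambda>\<beta>. p * v \<beta> + s * quad_center n J \<beta> + w \<beta>)) \<alpha>)"
    if h: "lor {..<n} (hess (exp_on J v) \<alpha>)" for \<alpha>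
  proof -
    obtain r where r: "\<And>i j. i < n \<Longrightarrow> j < n \<Longrightarrow> hess (exp_on J (\<lambda>\<beta>. p * v \<beta> + s * quad_center n J \<beta> + w \<beta>)) \<alpha> i j =
      r i * r j * ((if i = j then exp (- 2 * s) else 1) * hess (exp_on J v) \<alpha> i j powr p)"
      using hess_exp_on_transform[OF w, of p v s \<alpha>] by blast
    have "lor {..<n} (\<lambda>i j. hess (exp_on J v) \<alpha> i j powr p)"
      by (rule lor_powr[OF finite_lessThan hess_sym_on hess_nonneg h p])
    then have "lor {..<n} (\<lambda>i j. (if i = j then exp (- 2 * s) else 1) * hess (exp_on J v) \<alpha> i j powr p)"
      by (rule lor_decrease_diag[OF finite_lessThan]) (use s in \<open>auto simp: mult_left_le_one_le\<close>)
    from lor_scale[OF this, of r] show ?thesis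
      by (subst lor_cong) (auto simp: r)
  qed
  moreover have "(\<lambda>\<beta>. p * v \<beta> + s * quad_center n J \<beta> + w \<beta>) \<in> supported J"
    using v w unfolding log_set_def supported_def quad_center_def W_space_def by auto
  ultimately show ?thesis using v unfolding log_set_def hess_all_def by blast
qed

section \<open>Interior points, closedness and recession directions\<close>

lemma continuous_on_exp_on: "continuous_on UNIV (\<lambda>v. exp_on J v \<beta>)"
  unfolding exp_on_def by (cases "\<beta> \<in> J") (auto intro!: continuous_on_exp continuous_on_product_coordinates)

text \<open>Only finitely many Hessians occur and their entries are continuous in the logarithms, so
  the entrywise tolerances for the individual Hessians combine to one open set. The zero pattern is
  the same throughout V_J.\<close>

lemma log_set_lor_interior:
  assumes v: "v \<in> log_set lor n d J" and w: "w \<in> W_space n J" and p: "0 < p" "p < 1" and s: "0 < s"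
  shows "\<exists>T. open T \<and> (\<lambda>\<beta>. p * v \<beta> + s * quad_center n J \<beta> + w \<beta>) \<in> T \<and>
    T \<inter> log_set weak_infty n d J \<subseteq> log_set lor n d J"
proof -
  let ?u = "\<lambda>\<beta>. p * v \<beta> + s * quad_center n J \<beta> + w \<beta>"
  define Q where "Q \<alpha> e \<longleftrightarrow> 0 < e \<and> (\<forall>g. weak_infty {..<n} (hess (exp_on J g) \<alpha>) \<longrightarrow>
      (\<forall>i\<in>{..<n}. \<forall>j\<in>{..<n}. \<bar>hess (exp_on J g) \<alpha> i j - hess (exp_on J ?u) \<alpha> i j\<bar> < e) \<longrightarrow> lor {..<n} (hess (exp_on J g) \<alpha>))"
    for \<alpha> and e :: real
  have "\<exists>e. Q \<alpha> e"
    if h: "lor {..<n} (hess (exp_on J v) \<alpha>)" for \<alpha>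
  proof -
    obtain r where r0: "\<And>i. i < n \<Longrightarrow> 0 < r i" and r: "\<And>i j. i < n \<Longrightarrow> j < n \<Longrightarrow> hess (exp_on J ?u) \<alpha> i j =
      r i * r j * ((if i = j then exp (- 2 * s) else 1) * hess (exp_on J v) \<alpha> i j powr p)"
      using hess_exp_on_transform[OF w, of p v s \<alpha>] by blast
    have "exp (- 2 * s) < 1" using s by simp
    from lor_interior[OF finite_lessThan hess_sym_on hess_nonneg h p this, of r] r0
    obtain e where e: "e > 0" "\<And>G. sym_on {..<n} G \<Longrightarrow> (\<forall>i\<in>{..<n}. \<forall>j\<in>{..<n}. G i j = 0 \<longleftrightarrow> hess (exp_on J v) \<alpha> i j = 0) \<Longrightarrow>
        weak_infty {..<n} G \<Longrightarrow>
        (\<forall>i\<in>{..<n}. \<forall>j\<in>{..<n}. \<bar>G i j - r i * r j * ((if i = j then exp (- 2 * s) else 1) * hess (exp_on J v) \<alpha> i j powr p)\<bar> < e) \<Longrightarrow> lor {..<n} G"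
      by auto
    show ?thesis unfolding Q_def
    proof (intro exI[of _ e] conjI allI impI e)
      fix g
      show "sym_on {..<n} (hess (exp_on J g) \<alpha>)" by (rule hess_sym_on)
      show "\<forall>i\<in>{..<n}. \<forall>j\<in>{..<n}. hess (exp_on J g) \<alpha> i j = 0 \<longleftrightarrow> hess (exp_on J v) \<alpha> i j = 0"
        by (simp add: hess_def exp_on_eq_0_iff)
    qed (auto simp: r)
  qed
  then have "\<exists>e. \<forall>\<alpha>. lor {..<n} (hess (exp_on J v) \<alpha>) \<longrightarrow> Q \<alpha> (e \<alpha>)"
    by (intro choice) blast
  then obtain e where "\<And>\<alpha>. lor {..<n} (hess (exp_on J v) \<alpha>) \<Longrightarrow> Q \<alpha> (e \<alpha>)" by blast
  note e = this[unfolded Q_def]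
  \<comment> \<open>In degree below 2 there is no Hessian condition; \<open>I\<close> is empty and
    \<open>T\<close> is the whole space.\<close>
  define I where "I = (if 2 \<le> d then simplex_pts n (d - 2) else {})"
  have lorI: "lor {..<n} (hess (exp_on J v) \<alpha>)" if "\<alpha> \<in> I" for \<alpha>
    using v that unfolding log_set_def hess_all_def I_def by (auto split: if_splits)
  define T where "T = (\<Inter>\<alpha>\<in>I. \<Inter>i\<in>{..<n}. \<Inter>j\<in>{..<n}. {g. \<bar>hess (exp_on J g) \<alpha> i j - hess (exp_on J ?u) \<alpha> i j\<bar> < e \<alpha>})"
  have "finite I" unfolding I_def using finite_simplex_pts by auto
  then have "open T" unfolding T_def hess_def
    by (intro open_INT finite_lessThan ballI open_Collect_less continuous_on_rabs continuous_on_diff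
        continuous_on_exp_on continuous_on_const)
  moreover have "?u \<in> T" unfolding T_def using e lorI by auto
  moreover have "T \<inter> log_set weak_infty n d J \<subseteq> log_set lor n d J"
  proof
    fix g assume g: "g \<in> T \<inter> log_set weak_infty n d J"
    have "lor {..<n} (hess (exp_on J g) \<alpha>)" if d: "2 \<le> d" "\<alpha> \<in> simplex_pts n (d - 2)" for \<alpha>
    proof -
      have I: "\<alpha> \<in> I" using d unfolding I_def by simp
      have "weak_infty {..<n} (hess (exp_on J g) \<alpha>)" using g d unfolding log_set_def hess_all_def by blast
      moreover have "\<forall>i\<in>{..<n}. \<forall>j\<in>{..<n}. \<bar>hess (exp_on J g) \<alpha> i j - hess (exp_on J ?u) \<alpha> i j\<bar> < e \<alpha>"
        using g I unfolding T_def by blast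
      ultimately show ?thesis using e[OF lorI[OF I]] by blast
    qed
    then show "g \<in> log_set lor n d J" using g unfolding log_set_def hess_all_def by blast
  qed
  ultimately show ?thesis by blast
qed

lemma closed_supported: "closed (supported J)"
proof -
  have "closed {v :: expo \<Rightarrow> real. v \<alpha> = 0}" for \<alpha>
    by (intro closed_Collect_eq continuous_on_const continuous_on_product_coordinates)
  then have "closed (\<Inter>\<alpha>\<in>- J. {v :: expo \<Rightarrow> real. v \<alpha> = 0})" by blast
  moreover have "supported J = (\<Inter>\<alpha>\<in>- J. {v. v \<alpha> = 0})" unfolding supported_def by auto
  ultimately show ?thesis by simp
qed

lemma closed_log_set_lor: "closed (log_set lor n d J)"
proof -
  have l: "closed {v. lor {..<n} (hess (exp_on J v) \<alpha>)}" for \<alpha>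
  proof -
    have "{v. lor {..<n} (hess (exp_on J v) \<alpha>)} =
      (\<Inter>x. {v. qform {..<n} (hess (exp_on J v) \<alpha>) (\<lambda>_. 1) * qform {..<n} (hess (exp_on J v) \<alpha>) x \<le> (bform {..<n} (hess (exp_on J v) \<alpha>) (\<lambda>_. 1) x)\<^sup>2})"
      using lor_iff_ones[OF finite_lessThan hess_sym_on hess_nonneg] by auto
    also have "closed \<dots>" unfolding bform_def hess_def
      by (intro closed_INT ballI closed_Collect_le continuous_on_mult continuous_on_power continuous_on_sum continuous_on_exp_on continuous_on_const)
    finally show ?thesis .
  qed
  have "log_set lor n d J = supported J \<inter> (\<Inter>\<alpha>\<in>(if 2 \<le> d then simplex_pts n (d - 2) else {}). {v. lor {..<n} (hess (exp_on J v) \<alpha>)})"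
    unfolding log_set_def hess_all_def by auto
  also have "closed \<dots>" by (intro closed_Int closed_supported closed_INT ballI l)
  finally show ?thesis .
qed

text \<open>Which entries of a Hessian vanish is decided by \<open>J\<close>, so the implications in
  \<open>weak_infty\<close> amount to a family of equations between continuous functions.\<close>

lemma closed_log_set_infty:
  assumes M: "M_convex J"
  shows "closed (log_set weak_infty n d J)"
proof -
  have "closed {v. weak_infty {..<n} (hess (exp_on J v) \<alpha>)}" for \<alpha>
  proof -
    have "{v. weak_infty {..<n} (hess (exp_on J v) \<alpha>)} =
       (\<Inter>q\<in>{q. fst q < n \<and> fst (snd q) < n \<and> fst (snd (snd q)) < n \<and> snd (snd (snd q)) < n \<and>
          \<alpha> + unit_expo (fst q) + unit_expo (fst (snd q)) \<notin> J}.
       {v. hess (exp_on J v) \<alpha> (fst q) (fst (snd (snd q))) * hess (exp_on J v) \<alpha> (fst (snd q)) (snd (snd (snd q))) =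
          hess (exp_on J v) \<alpha> (fst q) (snd (snd (snd q))) * hess (exp_on J v) \<alpha> (fst (snd q)) (fst (snd (snd q)))})"
      unfolding weak_infty_def by (fastforce simp: hess_def[of _ _ _ "_ :: nat"] exp_on_eq_0_iff)
    also have "closed \<dots>" unfolding hess_def
      by (intro closed_INT ballI closed_Collect_eq continuous_on_mult continuous_on_exp_on)
    finally show ?thesis .
  qed
  moreover note closed_supported[of J]
  moreover have "log_set weak_infty n d J = supported J \<inter> (\<Inter>\<alpha>\<in>(if 2 \<le> d then simplex_pts n (d - 2) else {}). {v. weak_infty {..<n} (hess (exp_on J v) \<alpha>)})"
    unfolding log_set_def hess_all_def by auto
  ultimately show ?thesis by (auto intro!: closed_Int closed_INT)
qed

text \<open>Dequantisation: the four-point inequality for \<open>u + t v\<close> becomes the tropical one as \<open>t \<rightarrow> \<infinity>\<close>, since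
  its constant disappears in the limit.\<close>

lemma powr_dominance:
  fixes a b u c :: real
  assumes u: "0 < u" and a: "0 < a" and b: "0 \<le> b" and h: "\<And>t. 0 < t \<Longrightarrow> u * a powr t \<le> c * b powr t"
  shows "a \<le> b"
proof (rule ccontr)
  assume "\<not> a \<le> b"
  then have ab: "b < a" by simp
  have bp: "0 < b"
  proof (rule ccontr)
    assume "\<not> 0 < b"
    then have "b = 0" using b by simp
    then show False using h[of 1] mult_pos_pos[OF u a] a by simp
  qed
  then have q: "1 < a / b" using ab by simp
  then obtain k where k: "c / u < (a / b) ^ k" using real_arch_pow by blast
  have "u * a powr real (Suc k) \<le> c * b powr real (Suc k)" by (rule h) simp
  then have "u * a ^ Suc k \<le> c * b ^ Suc k" unfolding powr_realpow[OF a] powr_realpow[OF bp] .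
  then have "a ^ Suc k / b ^ Suc k \<le> c / u" using u bp by (simp add: field_simps del: power_Suc)
  then have "(a / b) ^ Suc k \<le> c / u" by (simp only: power_divide)
  moreover have "(a / b) ^ k \<le> (a / b) ^ Suc k" using q by (intro power_increasing) auto
  ultimately show False using k by linarith
qed

text \<open>Tropical relations survive positive powers, hence multiples of \<open>v\<close> stay
  Lorentzian and the centre may be added. Conversely the four-point inequality holds along the ray
  with coefficients that do not depend on \<open>t\<close>.\<close>

lemma log_set_weak_zero_iff_recession:
  assumes M: "M_convex J" and w: "w \<in> W_space n J" and s: "0 \<le> s" and v: "v \<in> supported J"
  shows "v \<in> log_set weak_zero n d J \<longleftrightarrow>
    (\<forall>t\<ge>0. (\<lambda>\<beta>. t * v \<beta> + s * quad_center n J \<beta> + w \<beta>) \<in> log_set lor n d J)"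
proof
  assume vz: "v \<in> log_set weak_zero n d J"
  show "\<forall>t\<ge>0. (\<lambda>\<beta>. t * v \<beta> + s * quad_center n J \<beta> + w \<beta>) \<in> log_set lor n d J"
  proof (intro allI impI)
    fix t :: real assume t: "0 \<le> t"
    have "(\<lambda>\<beta>. t * v \<beta>) \<in> log_set weak_zero n d J"
    proof (cases "t = 0")
      case True
      then show ?thesis using zero_in_log_set[OF M] by simp
    next
      case False
      then have t: "0 < t" using t by simp
      have h: "hess (exp_on J (\<lambda>\<beta>. t * v \<beta>)) \<alpha> i j = hess (exp_on J v) \<alpha> i j powr t" for \<alpha> i j
        unfolding hess_def exp_on_def by (simp add: powr_def)
      have "weak_zero {..<n} (hess (exp_on J (\<lambda>\<beta>. t * v \<beta>)) \<alpha>)" if z: "weak_zero {..<n} (hess (exp_on J v) \<alpha>)" for \<alpha>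
        unfolding weak_zero_def
      proof (intro ballI)
        fix i j k l
        let ?h = "hess (exp_on J v) \<alpha>"
        assume "i \<in> {..<n}" "j \<in> {..<n}" "k \<in> {..<n}" "l \<in> {..<n}"
        then have "?h i j * ?h k l \<le> max (?h i k * ?h j l) (?h i l * ?h j k)" using z unfolding weak_zero_def by blast
        then have "?h i j * ?h k l \<le> ?h i k * ?h j l \<or> ?h i j * ?h k l \<le> ?h i l * ?h j k" by (simp add: le_max_iff_disj)
        then have "(?h i j * ?h k l) powr t \<le> (?h i k * ?h j l) powr t \<or> (?h i j * ?h k l) powr t \<le> (?h i l * ?h j k) powr t"
          using t hess_nonneg[of J v \<alpha>] by (auto intro: powr_mono2)
        then show "hess (exp_on J (\<lambda>\<beta>. t * v \<beta>)) \<alpha> i j * hess (exp_on J (\<lambda>\<beta>. t * v \<beta>)) \<alpha> k l \<le>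
          max (hess (exp_on J (\<lambda>\<beta>. t * v \<beta>)) \<alpha> i k * hess (exp_on J (\<lambda>\<beta>. t * v \<beta>)) \<alpha> j l)
              (hess (exp_on J (\<lambda>\<beta>. t * v \<beta>)) \<alpha> i l * hess (exp_on J (\<lambda>\<beta>. t * v \<beta>)) \<alpha> j k)"
          unfolding h le_max_iff_disj by (simp add: powr_mult hess_nonneg)
      qed
      then show ?thesis using vz unfolding log_set_def hess_all_def supported_def by simp
    qed
    then have "(\<lambda>\<beta>. t * v \<beta>) \<in> log_set lor n d J" using log_set_weak_zero_subset by blast
    from log_set_lor_contract[OF this w, of 1 s] s
    show "(\<lambda>\<beta>. t * v \<beta> + s * quad_center n J \<beta> + w \<beta>) \<in> log_set lor n d J" by simp
  qed
next
  assume rec: "\<forall>t\<ge>0. (\<lambda>\<beta>. t * v \<beta> + s * quad_center n J \<beta> + w \<beta>) \<in> log_set lor n d J"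
  let ?u = "\<lambda>\<beta>. s * quad_center n J \<beta> + w \<beta>"
  show "v \<in> log_set weak_zero n d J"
    unfolding log_set_def hess_all_def weak_zero_def
  proof (intro CollectI conjI impI ballI v)
    fix \<alpha> i j k l
    assume d: "2 \<le> d" "\<alpha> \<in> simplex_pts n (d - 2)" and ijkl: "i \<in> {..<n}" "j \<in> {..<n}" "k \<in> {..<n}" "l \<in> {..<n}"
    let ?h = "hess (exp_on J v) \<alpha>" and ?g = "hess (exp_on J ?u) \<alpha>"
    have hg: "hess (exp_on J (\<lambda>\<beta>. t * v \<beta> + s * quad_center n J \<beta> + w \<beta>)) \<alpha> a b = ?g a b * ?h a b powr t" for t a b
      unfolding hess_def exp_on_def by (simp add: powr_def exp_add ac_simps)
    show "?h i j * ?h k l \<le> max (?h i k * ?h j l) (?h i l * ?h j k)"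
    proof (cases "?h i j * ?h k l = 0")
      case True
      show ?thesis unfolding True using hess_nonneg[of J v \<alpha>] by (simp add: le_max_iff_disj)
    next
      case False
      have g0: "0 \<le> ?g a b" and h0: "0 \<le> ?h a b" for a b by (rule hess_nonneg)+
      \<comment> \<open>Bounds both products of fixed factors at once, so that one constant serves
        whichever term attains the maximum for the given \<open>t\<close>.\<close>
      let ?U = "?g i k * ?g j l + ?g i l * ?g j k"
      show ?thesis
      proof (rule powr_dominance[where u = "?g i j * ?g k l" and c = "16 * ?U"])
        have "?g i j * ?g k l \<noteq> 0" using False by (simp add: hess_def exp_on_eq_0_iff)
        then show "0 < ?g i j * ?g k l" using g0 by (simp add: less_le)
        show "0 < ?h i j * ?h k l" using False h0 by (simp add: less_le)
        show "0 \<le> max (?h i k * ?h j l) (?h i l * ?h j k)" using h0 by (simp add: le_max_iff_disj)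
        fix t :: real assume t: "0 < t"
        have "(\<lambda>\<beta>. t * v \<beta> + s * quad_center n J \<beta> + w \<beta>) \<in> log_set lor n d J" using rec t by simp
        then have "lor {..<n} (hess (exp_on J (\<lambda>\<beta>. t * v \<beta> + s * quad_center n J \<beta> + w \<beta>)) \<alpha>)"
          using d unfolding log_set_def hess_all_def by blast
        from lor_four_point[OF finite_lessThan hess_sym_on hess_nonneg this ijkl, unfolded hg]
        have le: "?g i j * ?h i j powr t * (?g k l * ?h k l powr t) \<le>
          16 * max (?g i k * ?h i k powr t * (?g j l * ?h j l powr t)) (?g i l * ?h i l powr t * (?g j k * ?h j k powr t))" .
        define m where "m = max (?h i k * ?h j l) (?h i l * ?h j k)"
        have m: "(?h i k * ?h j l) powr t \<le> m powr t" "(?h i l * ?h j k) powr t \<le> m powr t"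
          using t h0 unfolding m_def by (auto intro!: powr_mono2)
        have "?g i k * ?h i k powr t * (?g j l * ?h j l powr t) = ?g i k * ?g j l * (?h i k * ?h j l) powr t"
          using h0 by (simp add: powr_mult)
        also have "\<dots> \<le> ?U * m powr t" using m(1) g0 by (intro mult_mono) auto
        finally have 1: "?g i k * ?h i k powr t * (?g j l * ?h j l powr t) \<le> ?U * m powr t" .
        have "?g i l * ?h i l powr t * (?g j k * ?h j k powr t) = ?g i l * ?g j k * (?h i l * ?h j k) powr t"
          using h0 by (simp add: powr_mult)
        also have "\<dots> \<le> ?U * m powr t" using m(2) g0 by (intro mult_mono) auto
        finally have 2: "?g i l * ?h i l powr t * (?g j k * ?h j k powr t) \<le> ?U * m powr t" .
        have "?g i j * ?g k l * (?h i j * ?h k l) powr t = ?g i j * ?h i j powr t * (?g k l * ?h k l powr t)"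
          using h0 by (simp add: powr_mult)
        also have "\<dots> \<le> 16 * (?U * m powr t)" using le 1 2 by simp
        finally show "?g i j * ?g k l * (?h i j * ?h k l) powr t \<le> 16 * ?U * max (?h i k * ?h j l) (?h i l * ?h j k) powr t"
          unfolding m_def by (simp only: mult.assoc)
      qed
    qed
  qed
qed

section \<open>Lorentzian polynomials\<close>

lemma lookup_partial_deriv:
  "Poly_Mapping.lookup (partial_deriv i f) \<beta> = real (lk \<beta> i + 1) * Poly_Mapping.lookup f (\<beta> + unit_expo i)"
proof -
  have "Poly_Mapping.lookup (partial_deriv i f) \<beta> =
      (\<Sum>\<gamma>\<in>Poly_Mapping.keys f. if \<gamma> = \<beta> + unit_expo i then real (lk \<beta> i + 1) * Poly_Mapping.lookup f (\<beta> + unit_expo i) else 0)"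
    unfolding partial_deriv_def lookup_sum
  proof (intro sum.cong refl)
    fix \<gamma> assume "\<gamma> \<in> Poly_Mapping.keys f"
    show "Poly_Mapping.lookup (Poly_Mapping.single (\<gamma> - unit_expo i) (real (lk \<gamma> i) * Poly_Mapping.lookup f \<gamma>)) \<beta> =
      (if \<gamma> = \<beta> + unit_expo i then real (lk \<beta> i + 1) * Poly_Mapping.lookup f (\<beta> + unit_expo i) else 0)"
    proof (cases "lk \<gamma> i = 0")
      case True
      then have "\<gamma> \<noteq> \<beta> + unit_expo i" by (auto simp: lk_simps)
      then show ?thesis using True by simp
    next
      case False
      then have "\<gamma> - unit_expo i + unit_expo i = \<gamma>" by (intro poly_mapping_eqI) (auto simp: lk_simps)
      then have iff: "\<gamma> - unit_expo i = \<beta> \<longleftrightarrow> \<gamma> = \<beta> + unit_expo i" by auto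
      show ?thesis
      proof (cases "\<gamma> = \<beta> + unit_expo i")
        case True
        then show ?thesis by (simp add: lookup_single lookup_add)
      next
        case False
        then show ?thesis using iff by (simp add: lookup_single when_def)
      qed
    qed
  qed
  then show ?thesis by (simp add: in_keys_iff)
qed

text \<open>In terms of the coefficients multiplied by \<open>\<beta>!\<close>, partial derivatives are shifts.\<close>

definition expo_fact :: "nat \<Rightarrow> expo \<Rightarrow> real" where
  "expo_fact n \<beta> = (\<Prod>k<n. fact (lk \<beta> k))"

definition weight :: "nat \<Rightarrow> rpoly \<Rightarrow> expo \<Rightarrow> real" where
  "weight n f \<beta> = expo_fact n \<beta> * Poly_Mapping.lookup f \<beta>"

lemma expo_fact_pos: "0 < expo_fact n \<beta>"
  unfolding expo_fact_def by (intro prod_pos) simp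

lemma expo_fact_add_unit:
  assumes "i < n"
  shows "expo_fact n (\<beta> + unit_expo i) = real (lk \<beta> i + 1) * expo_fact n \<beta>"
proof -
  have "expo_fact n (\<beta> + unit_expo i) = (\<Prod>k<n. (if k = i then real (lk \<beta> i + 1) else 1) * fact (lk \<beta> k))"
    unfolding expo_fact_def
  proof (intro prod.cong refl)
    fix k
    have "fact (m + 1) = (real m + 1) * (fact m :: real)" for m
      using fact_Suc[of m, where 'a = real] by (simp add: Suc_eq_plus1 add.commute)
    then show "fact (lk (\<beta> + unit_expo i) k) = (if k = i then real (lk \<beta> i + 1) else 1) * fact (lk \<beta> k)"
      by (auto simp: lk_simps)
  qed
  then show ?thesis using assms unfolding expo_fact_def prod.distrib by simp
qed

lemma weight_partial_deriv:
  "i < n \<Longrightarrow> weight n (partial_deriv i f) \<beta> = weight n f (\<beta> + unit_expo i)"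
  unfolding weight_def lookup_partial_deriv expo_fact_add_unit by simp

lemma weight_partial_deriv_power:
  assumes "i < n"
  shows "weight n ((partial_deriv i ^^ m) f) \<beta> = weight n f (\<beta> + Poly_Mapping.single i m)"
proof (induction m arbitrary: \<beta>)
  case 0
  then show ?case by simp
next
  case (Suc m)
  have "\<beta> + unit_expo i + Poly_Mapping.single i m = \<beta> + Poly_Mapping.single i (Suc m)"
    by (intro poly_mapping_eqI) (auto simp: lk_simps)
  then show ?case using Suc[of "\<beta> + unit_expo i"] weight_partial_deriv[OF assms, of "(partial_deriv i ^^ m) f" \<beta>] by simp
qed

lemma weight_foldr_partial_deriv:
  assumes "set xs \<subseteq> {..<n}"
  shows "weight n (foldr (\<lambda>i g. (partial_deriv i ^^ lk \<alpha> i) g) xs f) \<beta> =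
    weight n f (\<beta> + sum_list (map (\<lambda>i. Poly_Mapping.single i (lk \<alpha> i)) xs))"
  using assms
  by (induction xs arbitrary: \<beta>) (simp_all add: weight_partial_deriv_power ac_simps)

lemma weight_partial_derivs:
  assumes "\<alpha> \<in> simplex_pts n d"
  shows "weight n (partial_derivs n \<alpha> f) \<beta> = weight n f (\<beta> + \<alpha>)"
proof -
  have "sum_list (map (\<lambda>i. Poly_Mapping.single i (lk \<alpha> i)) [0..<n]) = (\<Sum>i<n. Poly_Mapping.single i (lk \<alpha> i))"
    by (simp add: sum_list_distinct_conv_sum_set atLeast0LessThan)
  also have "\<dots> = \<alpha>"
  proof (rule poly_mapping_eqI)
    fix k
    have "lk (\<Sum>i<n. Poly_Mapping.single i (lk \<alpha> i)) k = (\<Sum>i<n. if i = k then lk \<alpha> k else 0)"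
      unfolding lookup_sum by (intro sum.cong refl) (auto simp: lk_simps)
    also have "\<dots> = lk \<alpha> k" using assms unfolding simplex_pts_iff by (auto simp: not_less)
    finally show "lk (\<Sum>i<n. Poly_Mapping.single i (lk \<alpha> i)) k = lk \<alpha> k" .
  qed
  moreover have "set [0..<n] \<subseteq> {..<n}" by auto
  ultimately show ?thesis unfolding partial_derivs_def
    using weight_foldr_partial_deriv[of "[0..<n]" n \<alpha> f \<beta>] by simp
qed

lemma hessian_partial_derivs:
  assumes "\<alpha> \<in> simplex_pts n d"
  shows "hessian n (partial_derivs n \<alpha> f) = Matrix.mat n n (\<lambda>(i, j). hess (weight n f) \<alpha> i j)"
  unfolding hessian_def
proof (rule eq_matI)
  fix i j assume "i < dim_row (Matrix.mat n n (\<lambda>(i, j). hess (weight n f) \<alpha> i j))"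
    "j < dim_col (Matrix.mat n n (\<lambda>(i, j). hess (weight n f) \<alpha> i j))"
  then have ij: "i < n" "j < n" by auto
  let ?g = "partial_derivs n \<alpha> f"
  have "Poly_Mapping.lookup (partial_deriv i (partial_deriv j ?g)) 0 = weight n (partial_deriv i (partial_deriv j ?g)) 0"
    by (simp add: weight_def expo_fact_def)
  also have "\<dots> = hess (weight n f) \<alpha> i j"
    using ij by (simp add: weight_partial_deriv weight_partial_derivs[OF assms] hess_def ac_simps)
  finally show "Matrix.mat n n (\<lambda>(i, j). Poly_Mapping.lookup (partial_deriv i (partial_deriv j ?g)) 0) $$ (i, j) =
      Matrix.mat n n (\<lambda>(i, j). hess (weight n f) \<alpha> i j) $$ (i, j)" using ij by simp
qed auto

section \<open>Lorentzian polynomials and rescaling in logarithmic coordinates\<close>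

definition log_weight :: "nat \<Rightarrow> expo set \<Rightarrow> rpoly \<Rightarrow> expo \<Rightarrow> real" where
  "log_weight n J f = (\<lambda>\<alpha>. if \<alpha> \<in> J then ln (weight n f \<alpha>) else 0)"

definition poly_of_log :: "nat \<Rightarrow> expo set \<Rightarrow> (expo \<Rightarrow> real) \<Rightarrow> rpoly" where
  "poly_of_log n J v = (\<Sum>\<alpha>\<in>J. Poly_Mapping.single \<alpha> (exp (v \<alpha>) / expo_fact n \<alpha>))"

lemma log_weight_supported: "log_weight n J f \<in> supported J"
  unfolding supported_def log_weight_def by simp

lemma exp_on_log_weight:
  assumes "Poly_Mapping.keys f = J" "\<And>\<alpha>. 0 \<le> Poly_Mapping.lookup f \<alpha>"
  shows "exp_on J (log_weight n J f) = weight n f"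
proof
  fix \<alpha>
  show "exp_on J (log_weight n J f) \<alpha> = weight n f \<alpha>"
  proof (cases "\<alpha> \<in> J")
    case True
    then have "0 < Poly_Mapping.lookup f \<alpha>" using assms by (auto simp: less_le in_keys_iff)
    then have "0 < weight n f \<alpha>" unfolding weight_def using expo_fact_pos by simp
    then show ?thesis using True by (simp add: exp_on_def log_weight_def)
  next
    case False
    then have "Poly_Mapping.lookup f \<alpha> = 0" using assms(1) by (auto simp: in_keys_iff)
    then show ?thesis using False by (simp add: exp_on_def weight_def)
  qed
qed

text \<open>The Hessian of a derivative has the factorially weighted coefficients as entries, so the
  spectral criterion turns the eigenvalue condition into \<open>lor\<close>. Nonvanishing and
  M-convexity of the support are inherited from \<open>J\<close>.\<close>

lemma lorentzian_set_iff:
  assumes J: "J \<subseteq> simplex_pts n d" and M: "M_convex J"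
  shows "f \<in> lorentzian_set n d J \<longleftrightarrow> Poly_Mapping.keys f = J \<and> (\<forall>\<alpha>. 0 \<le> Poly_Mapping.lookup f \<alpha>) \<and>
    log_weight n J f \<in> log_set lor n d J"
proof (cases "Poly_Mapping.keys f = J \<and> (\<forall>\<alpha>. 0 \<le> Poly_Mapping.lookup f \<alpha>)")
  case False
  then show ?thesis unfolding lorentzian_set_def lorentzian_def by auto
next
  case True
  have "J \<noteq> {}" using M unfolding M_convex_def by blast
  then have "f \<noteq> 0" using True by auto
  moreover have "at_most_one_pos_eigenvalue (hessian n (partial_derivs n \<alpha> f)) \<longleftrightarrow> lor {..<n} (hess (weight n f) \<alpha>)"
    if "\<alpha> \<in> simplex_pts n (d - 2)" for \<alpha>
    unfolding hessian_partial_derivs[OF that] by (rule at_most_one_pos_eigenvalue_iff_lor[OF hess_sym_on])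
  ultimately have "f \<in> lorentzian_set n d J \<longleftrightarrow> hess_all lor n d (weight n f)"
    using True J M unfolding lorentzian_set_def lorentzian_def hess_all_def by auto
  also have "\<dots> \<longleftrightarrow> log_weight n J f \<in> log_set lor n d J"
    using True exp_on_log_weight[of f J n] log_weight_supported unfolding log_set_def by auto
  finally show ?thesis using True by blast
qed

lemma lookup_poly_of_log:
  assumes "finite J"
  shows "Poly_Mapping.lookup (poly_of_log n J v) \<alpha> = exp_on J v \<alpha> / expo_fact n \<alpha>"
proof -
  have "Poly_Mapping.lookup (poly_of_log n J v) \<alpha> = (\<Sum>\<beta>\<in>J. if \<beta> = \<alpha> then exp (v \<alpha>) / expo_fact n \<alpha> else 0)"
    unfolding poly_of_log_def lookup_sum by (intro sum.cong refl) (auto simp: lk_simps)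
  then show ?thesis using assms by (simp add: exp_on_def)
qed

lemma poly_of_log_props:
  assumes J: "finite J"
  shows "Poly_Mapping.keys (poly_of_log n J v) = J" "0 \<le> Poly_Mapping.lookup (poly_of_log n J v) \<alpha>"
    "v \<in> supported J \<Longrightarrow> log_weight n J (poly_of_log n J v) = v"
proof -
  have p: "expo_fact n \<alpha> \<noteq> 0" "0 \<le> expo_fact n \<alpha>" for \<alpha> using expo_fact_pos[of n \<alpha>] by auto
  show "Poly_Mapping.keys (poly_of_log n J v) = J"
    by (auto simp: in_keys_iff lookup_poly_of_log[OF J] exp_on_eq_0_iff p)
  show "0 \<le> Poly_Mapping.lookup (poly_of_log n J v) \<alpha>"
    unfolding lookup_poly_of_log[OF J] by (simp add: exp_on_nonneg p)
  show "v \<in> supported J \<Longrightarrow> log_weight n J (poly_of_log n J v) = v"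
    by (auto simp: log_weight_def weight_def lookup_poly_of_log[OF J] p exp_on_def supported_def)
qed

lemma single_power:
  "Poly_Mapping.single (unit_expo i) (x :: real) ^ m = Poly_Mapping.single (Poly_Mapping.single i m) (x ^ m)"
proof (induction m)
  case 0
  show ?case by simp
next
  case (Suc m)
  have "unit_expo i + Poly_Mapping.single i m = Poly_Mapping.single i (Suc m)"
    by (simp add: single_add[symmetric] Suc_eq_plus1_left)
  then show ?case using Suc by (simp add: mult_single)
qed

lemma prod_single:
  "finite A \<Longrightarrow> (\<Prod>i\<in>A. Poly_Mapping.single (u i :: expo) (x i :: real)) = Poly_Mapping.single (\<Sum>i\<in>A. u i) (\<Prod>i\<in>A. x i)"
  by (induction A rule: finite_induct) (simp_all add: mult_single)

lemma sum_single_keys: "(\<Sum>i\<in>Poly_Mapping.keys \<alpha>. Poly_Mapping.single i (lk \<alpha> i)) = \<alpha>"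
proof (rule poly_mapping_eqI)
  fix k
  have "lk (\<Sum>i\<in>Poly_Mapping.keys \<alpha>. Poly_Mapping.single i (lk \<alpha> i)) k = (\<Sum>i\<in>Poly_Mapping.keys \<alpha>. if i = k then lk \<alpha> k else 0)"
    unfolding lookup_sum by (intro sum.cong refl) (auto simp: lk_simps)
  then show "lk (\<Sum>i\<in>Poly_Mapping.keys \<alpha>. Poly_Mapping.single i (lk \<alpha> i)) k = lk \<alpha> k"
    by (auto simp: in_keys_iff)
qed

lemma lookup_rescale:
  "Poly_Mapping.lookup (rescale c f) \<alpha> = Poly_Mapping.lookup f \<alpha> * (\<Prod>i\<in>Poly_Mapping.keys \<alpha>. c i ^ lk \<alpha> i)"
proof -
  have "rescale c f = (\<Sum>\<alpha>\<in>Poly_Mapping.keys f. Poly_Mapping.single \<alpha> (Poly_Mapping.lookup f \<alpha> * (\<Prod>i\<in>Poly_Mapping.keys \<alpha>. c i ^ lk \<alpha> i)))"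
    unfolding rescale_def
    by (intro sum.cong refl) (simp only: single_power prod_single finite_keys mult_single sum_single_keys add_0)
  then have "Poly_Mapping.lookup (rescale c f) \<alpha> =
     (\<Sum>\<beta>\<in>Poly_Mapping.keys f. if \<beta> = \<alpha> then Poly_Mapping.lookup f \<alpha> * (\<Prod>i\<in>Poly_Mapping.keys \<alpha>. c i ^ lk \<alpha> i) else 0)"
    by (simp only: lookup_sum) (intro sum.cong refl, auto simp: lk_simps)
  then show ?thesis by (auto simp: in_keys_iff)
qed

lemma prod_keys_eq:
  assumes "\<alpha> \<in> simplex_pts n d"
  shows "(\<Prod>i\<in>Poly_Mapping.keys \<alpha>. (c i :: real) ^ lk \<alpha> i) = (\<Prod>i<n. c i ^ lk \<alpha> i)"
proof (rule prod.mono_neutral_left)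
  show "Poly_Mapping.keys \<alpha> \<subseteq> {..<n}" using assms unfolding simplex_pts_def by blast
qed (auto simp: in_keys_iff)

text \<open>Substitution multiplies the coefficient at \<alpha> by the exponential of the sum of
  \<alpha>_i log c_i, and the factorial weights cancel in the difference. Orbits are thus cosets of
  W_J.\<close>

lemma rescale_rel_iff:
  assumes J: "J \<subseteq> simplex_pts n d" and M: "M_convex J"
  shows "(f, g) \<in> rescale_rel n d J \<longleftrightarrow> f \<in> lorentzian_set n d J \<and> g \<in> lorentzian_set n d J \<and>
    (\<lambda>\<alpha>. log_weight n J g \<alpha> - log_weight n J f \<alpha>) \<in> W_space n J"
proof (cases "f \<in> lorentzian_set n d J \<and> g \<in> lorentzian_set n d J")
  case False
  then show ?thesis unfolding rescale_rel_def by blast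
next
  case True
  have f: "Poly_Mapping.keys f = J" "\<And>\<alpha>. 0 \<le> Poly_Mapping.lookup f \<alpha>"
    and g: "Poly_Mapping.keys g = J" "\<And>\<alpha>. 0 \<le> Poly_Mapping.lookup g \<alpha>"
    using True unfolding lorentzian_set_iff[OF J M] by auto
  have pf: "0 < Poly_Mapping.lookup f \<alpha>" and pg: "0 < Poly_Mapping.lookup g \<alpha>" if "\<alpha> \<in> J" for \<alpha>
    using that f g by (auto simp: less_le in_keys_iff)
  have diff: "log_weight n J g \<alpha> - log_weight n J f \<alpha> = ln (Poly_Mapping.lookup g \<alpha>) - ln (Poly_Mapping.lookup f \<alpha>)"
    if "\<alpha> \<in> J" for \<alpha>
    using that pf[OF that] pg[OF that] expo_fact_pos[of n \<alpha>] unfolding log_weight_def weight_def by (simp add: ln_mult)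
  have pr: "(\<Prod>i<n. exp (c i) ^ lk \<alpha> i) = exp (\<Sum>i<n. c i * real (lk \<alpha> i))" for c :: "nat \<Rightarrow> real" and \<alpha>
    by (simp add: exp_sum exp_of_nat_mult[symmetric] mult.commute)
  have "(\<exists>c. (\<forall>i<n. 0 < c i) \<and> g = rescale c f) \<longleftrightarrow>
    (\<lambda>\<alpha>. log_weight n J g \<alpha> - log_weight n J f \<alpha>) \<in> W_space n J"
  proof
    assume "\<exists>c. (\<forall>i<n. 0 < c i) \<and> g = rescale c f"
    then obtain c where c: "\<And>i. i < n \<Longrightarrow> 0 < c i" and gc: "g = rescale c f" by blast
    have "log_weight n J g \<alpha> - log_weight n J f \<alpha> = (if \<alpha> \<in> J then \<Sum>i<n. ln (c i) * real (lk \<alpha> i) else 0)" for \<alpha>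
    proof (cases "\<alpha> \<in> J")
      case True
      then have \<alpha>: "\<alpha> \<in> simplex_pts n d" using J by blast
      have "(\<Prod>i<n. c i ^ lk \<alpha> i) = (\<Prod>i<n. exp (ln (c i)) ^ lk \<alpha> i)" using c by (intro prod.cong) auto
      then have "Poly_Mapping.lookup g \<alpha> = Poly_Mapping.lookup f \<alpha> * exp (\<Sum>i<n. ln (c i) * real (lk \<alpha> i))"
        unfolding gc lookup_rescale prod_keys_eq[OF \<alpha>] pr by simp
      then show ?thesis unfolding diff[OF True] using pf[OF True] True by (simp add: ln_mult)
    next
      case False
      then show ?thesis by (simp add: log_weight_def)
    qed
    then show "(\<lambda>\<alpha>. log_weight n J g \<alpha> - log_weight n J f \<alpha>) \<in> W_space n J"
      by (auto simp: W_space_def fun_eq_iff intro!: exI[of _ "\<lambda>i. ln (c i)"])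
  next
    assume "(\<lambda>\<alpha>. log_weight n J g \<alpha> - log_weight n J f \<alpha>) \<in> W_space n J"
    then obtain c where "(\<lambda>\<alpha>. log_weight n J g \<alpha> - log_weight n J f \<alpha>) = (\<lambda>\<alpha>. if \<alpha> \<in> J then \<Sum>i<n. c i * real (lk \<alpha> i) else 0)"
      unfolding W_space_def by blast
    then have c: "log_weight n J g \<alpha> - log_weight n J f \<alpha> = (if \<alpha> \<in> J then \<Sum>i<n. c i * real (lk \<alpha> i) else 0)" for \<alpha>
      by metis
    have "g = rescale (\<lambda>i. exp (c i)) f"
    proof (rule poly_mapping_eqI)
      fix \<alpha>
      show "Poly_Mapping.lookup g \<alpha> = Poly_Mapping.lookup (rescale (\<lambda>i. exp (c i)) f) \<alpha>"
      proof (cases "\<alpha> \<in> J")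
        case True
        then have \<alpha>: "\<alpha> \<in> simplex_pts n d" using J by blast
        have "ln (Poly_Mapping.lookup g \<alpha>) = ln (Poly_Mapping.lookup f \<alpha>) + (\<Sum>i<n. c i * real (lk \<alpha> i))"
          using c[of \<alpha>] diff[OF True] True by simp
        then have "Poly_Mapping.lookup g \<alpha> = exp (ln (Poly_Mapping.lookup f \<alpha>) + (\<Sum>i<n. c i * real (lk \<alpha> i)))"
          using pg[OF True] by (metis exp_ln)
        then show ?thesis unfolding lookup_rescale prod_keys_eq[OF \<alpha>] pr using pf[OF True] by (simp add: exp_add)
      next
        case False
        then have "Poly_Mapping.lookup g \<alpha> = 0" "Poly_Mapping.lookup f \<alpha> = 0" using f g by (auto simp: in_keys_iff)
        then show ?thesis by (simp add: lookup_rescale)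
      qed
    qed
    then show "\<exists>c. (\<forall>i<n. 0 < c i) \<and> g = rescale c f" by (intro exI[of _ "\<lambda>i. exp (c i)"]) simp
  qed
  then show ?thesis using True unfolding rescale_rel_def by blast
qed

section \<open>Continuity of the logarithmic coordinates\<close>

lemma topspace_lorentzian_top: "topspace (lorentzian_top n d J) = lorentzian_set n d J"
  unfolding lorentzian_top_def topspace_pullback_topology by simp

lemma continuous_map_lookup: "continuous_map (lorentzian_top n d J) euclidean (\<lambda>f. Poly_Mapping.lookup f \<alpha>)"
proof -
  have "continuous_map (lorentzian_top n d J) euclidean ((\<lambda>h. h \<alpha>) \<circ> Poly_Mapping.lookup)"
    unfolding lorentzian_top_def
    by (rule continuous_map_pullback) (simp add: continuous_map_iff_continuous2)
  then show ?thesis by (simp add: comp_def)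
qed

lemma continuous_map_log_weight:
  assumes J: "J \<subseteq> simplex_pts n d" and M: "M_convex J"
  shows "continuous_map (lorentzian_top n d J) euclidean (log_weight n J)"
proof -
  have "continuous_map (lorentzian_top n d J) euclidean (\<lambda>f. log_weight n J f \<alpha>)" for \<alpha>
  proof (cases "\<alpha> \<in> J")
    case True
    have "0 < weight n f \<alpha>" if "f \<in> lorentzian_set n d J" for f
    proof -
      have "Poly_Mapping.keys f = J" "0 \<le> Poly_Mapping.lookup f \<alpha>"
        using that unfolding lorentzian_set_iff[OF J M] by auto
      then have "0 < Poly_Mapping.lookup f \<alpha>" using True by (auto simp: less_le in_keys_iff)
      then show ?thesis using expo_fact_pos[of n \<alpha>] by (simp add: weight_def)
    qed
    then have "continuous_map (lorentzian_top n d J) (top_of_set {0<..}) (\<lambda>f. weight n f \<alpha>)"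
      unfolding weight_def continuous_map_in_subtopology
      by (auto simp: topspace_lorentzian_top intro!: continuous_map_real_mult continuous_map_lookup)
    moreover have "continuous_map (top_of_set {0<..}) euclidean (ln :: real \<Rightarrow> real)"
      by (simp add: continuous_map_iff_continuous2 continuous_on_ln)
    ultimately have "continuous_map (lorentzian_top n d J) euclidean (ln \<circ> (\<lambda>f. weight n f \<alpha>))"
      by (rule continuous_map_compose)
    then show ?thesis using True by (simp add: comp_def log_weight_def)
  next
    case False
    then show ?thesis by (simp add: log_weight_def)
  qed
  then have "continuous_map (lorentzian_top n d J) (product_topology (\<lambda>_. euclidean) UNIV) (log_weight n J)"
    by (subst continuous_map_componentwise_UNIV) blast
  then show ?thesis by (simp add: euclidean_product_topology)
qed

lemma continuous_map_poly_of_log: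
  assumes J: "J \<subseteq> simplex_pts n d" and M: "M_convex J"
  shows "continuous_map (top_of_set (log_set lor n d J)) (lorentzian_top n d J) (poly_of_log n J)"
  unfolding lorentzian_top_def
proof (rule continuous_map_pullback')
  have fJ: "finite J" using J finite_simplex_pts finite_subset by blast
  have "continuous_on UNIV (\<lambda>v. exp_on J v \<alpha> / expo_fact n \<alpha>)" for \<alpha>
    using expo_fact_pos[of n \<alpha>] by (intro continuous_on_divide continuous_on_exp_on continuous_on_const) auto
  then have "continuous_on UNIV (\<lambda>v. \<lambda>\<alpha>. exp_on J v \<alpha> / expo_fact n \<alpha>)"
    by (rule continuous_on_coordinatewise_then_product)
  then have "continuous_on (log_set lor n d J) (\<lambda>v. \<lambda>\<alpha>. exp_on J v \<alpha> / expo_fact n \<alpha>)"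
    by (rule continuous_on_subset) simp
  moreover have "Poly_Mapping.lookup \<circ> poly_of_log n J = (\<lambda>v. \<lambda>\<alpha>. exp_on J v \<alpha> / expo_fact n \<alpha>)"
    by (auto simp: fun_eq_iff lookup_poly_of_log[OF fJ])
  ultimately show "continuous_map (top_of_set (log_set lor n d J)) euclidean (Poly_Mapping.lookup \<circ> poly_of_log n J)"
    by (simp add: continuous_map_iff_continuous2)
  show "topspace (top_of_set (log_set lor n d J)) \<subseteq> poly_of_log n J -` lorentzian_set n d J"
  proof
    fix v assume "v \<in> topspace (top_of_set (log_set lor n d J))"
    then have v: "v \<in> log_set lor n d J" by simp
    then have "log_weight n J (poly_of_log n J v) = v" by (intro poly_of_log_props[OF fJ]) (simp add: log_set_def)
    then show "v \<in> poly_of_log n J -` lorentzian_set n d J"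
      using v poly_of_log_props(1,2)[OF fJ] by (simp add: lorentzian_set_iff[OF J M])
  qed
qed

section \<open>Quotient topologies and gauges\<close>

text \<open>A continuous map with a continuous section is a quotient map onto its target. The
  inverse may evaluate \<open>P\<close> at any chosen representative because \<open>P\<close> is
  constant on classes. It serves both for V / W and for the orbits of polynomials.\<close>

lemma quotient_topology_homeomorphic:
  assumes P: "continuous_map X Y P" and s: "continuous_map Y X s" and Ps: "\<And>y. y \<in> topspace Y \<Longrightarrow> P (s y) = y"
    and r: "\<And>x x'. (x, x') \<in> r \<longleftrightarrow> x \<in> topspace X \<and> x' \<in> topspace X \<and> P x = P x'"
  shows "homeomorphic_maps Y (quotient_topology X r) (\<lambda>y. r `` {s y}) (\<lambda>C. P (SOME x. x \<in> C))"
proof -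
  have sX: "s y \<in> topspace X" if "y \<in> topspace Y" for y using s that unfolding continuous_map_def by blast
  have PY: "P x \<in> topspace Y" if "x \<in> topspace X" for x using P that unfolding continuous_map_def by blast
  have rI: "r `` {x} = {x' \<in> topspace X. P x' = P x}" if "x \<in> topspace X" for x
    using that by (auto simp: r)
  have cls: "P (SOME x'. x' \<in> r `` {x}) = P x" if "x \<in> topspace X" for x
  proof -
    define y where "y = (SOME x'. x' \<in> r `` {x})"
    have "x \<in> r `` {x}" using that by (simp add: rI)
    then have "y \<in> r `` {x}" unfolding y_def by (rule someI)
    then have "P y = P x" using that by (simp add: rI)
    then show ?thesis unfolding y_def .
  qed
  have cls_eq: "r `` {s (P x)} = r `` {x}" if x: "x \<in> topspace X" for x
    using x sX[OF PY[OF x]] Ps[OF PY[OF x]] by (simp add: rI)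
  show ?thesis
    unfolding homeomorphic_maps_def
  proof (intro conjI ballI)
    show "continuous_map Y (quotient_topology X r) (\<lambda>y. r `` {s y})"
      unfolding continuous_map_def topspace_quotient_topology
    proof (intro conjI allI impI)
      show "(\<lambda>y. r `` {s y}) \<in> topspace Y \<rightarrow> topspace X // r" using sX by (auto intro: quotientI)
      fix U assume U: "openin (quotient_topology X r) U"
      then have "openin X {x \<in> topspace X. r `` {x} \<in> U}" by (simp add: openin_quotient_topology)
      then have "openin Y {y \<in> topspace Y. s y \<in> {x \<in> topspace X. r `` {x} \<in> U}}"
        using s unfolding continuous_map_def by blast
      moreover have "{y \<in> topspace Y. s y \<in> {x \<in> topspace X. r `` {x} \<in> U}} = {y \<in> topspace Y. r `` {s y} \<in> U}"
        using sX by auto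
      ultimately show "openin Y {y \<in> topspace Y. r `` {s y} \<in> U}" by simp
    qed
    show "continuous_map (quotient_topology X r) Y (\<lambda>C. P (SOME x. x \<in> C))"
      unfolding continuous_map_def topspace_quotient_topology
    proof (intro conjI allI impI)
      show "(\<lambda>C. P (SOME x. x \<in> C)) \<in> topspace X // r \<rightarrow> topspace Y"
        using cls PY by (auto elim!: quotientE)
      fix U assume U: "openin Y U"
      have "{x \<in> topspace X. r `` {x} \<in> {C \<in> topspace X // r. P (SOME x. x \<in> C) \<in> U}} = {x \<in> topspace X. P x \<in> U}"
        using cls by (auto intro: quotientI)
      moreover have "openin X {x \<in> topspace X. P x \<in> U}" using P U unfolding continuous_map_def by blast
      ultimately show "openin (quotient_topology X r) {C \<in> topspace X // r. P (SOME x. x \<in> C) \<in> U}"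
        unfolding openin_quotient_topology by auto
    qed
    show "P (SOME x. x \<in> r `` {s y}) = y" if "y \<in> topspace Y" for y
      using cls[OF sX[OF that]] Ps[OF that] by simp
    fix C assume "C \<in> topspace (quotient_topology X r)"
    then obtain x where "x \<in> topspace X" "C = r `` {x}" unfolding topspace_quotient_topology by (auto elim!: quotientE)
    then show "r `` {s (P (SOME x. x \<in> C))} = C" using cls cls_eq by simp
  qed
qed

lemma continuous_on_tendsto_within:
  "continuous_on Z f \<Longrightarrow> z \<in> Z \<Longrightarrow> A \<subseteq> Z \<Longrightarrow> (f \<longlongrightarrow> f z) (at z within A)"
  unfolding continuous_on_def by (blast intro: tendsto_within_subset)

definition gauge :: "('a \<Rightarrow> real) set \<Rightarrow> ('a \<Rightarrow> real) \<Rightarrow> ('a \<Rightarrow> real) \<Rightarrow> real" where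
  "gauge K u z = Inf {l. 0 < l \<and> (\<lambda>i. u i + z i / l) \<in> K}"

text \<open>\<open>Z\<close> is a finite-dimensional space of functions; \<open>K\<close> is a closed subset that is star-shaped about its
  interior point \<open>u\<close> in the strong sense that open segments from \<open>u\<close> consist of interior points. Hence
  the gauge of \<open>K - u\<close> is continuous; it vanishes exactly on the recession directions.\<close>

locale strict_star =
  fixes I :: "'a set" and Z K :: "('a \<Rightarrow> real) set" and u :: "'a \<Rightarrow> real" and M :: "('a \<Rightarrow> real) \<Rightarrow> real"
  assumes I: "finite I" and supp: "\<And>z i. z \<in> Z \<Longrightarrow> i \<notin> I \<Longrightarrow> z i = 0"
    and lin: "\<And>z w a b. z \<in> Z \<Longrightarrow> w \<in> Z \<Longrightarrow> (\<lambda>i. a * z i + b * w i) \<in> Z" and closedZ: "closed Z"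
    and KZ: "K \<subseteq> Z" and closedK: "closed K" and uK: "u \<in> K"
    and int: "\<And>v p. v \<in> K \<Longrightarrow> 0 < p \<Longrightarrow> p < 1 \<Longrightarrow>
      \<exists>T. open T \<and> (\<lambda>i. p * v i + (1 - p) * u i) \<in> T \<and> T \<inter> Z \<subseteq> K"
    and contM: "continuous_on Z M" and M0: "\<And>z. z \<in> Z \<Longrightarrow> 0 \<le> M z"
    and M_eq_0: "\<And>z. z \<in> Z \<Longrightarrow> M z = 0 \<Longrightarrow> z = (\<lambda>_. 0)"
    and M_scale: "\<And>z a. z \<in> Z \<Longrightarrow> M (\<lambda>i. a * z i) = \<bar>a\<bar> * M z"
begin

abbreviation "q \<equiv> gauge K u"

lemma zero_Z: "(\<lambda>_. 0) \<in> Z"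
  using lin[of u u 0 0] uK KZ by auto

lemma scale_Z: "z \<in> Z \<Longrightarrow> (\<lambda>i. a * z i) \<in> Z"
  using lin[of z z a 0] by simp

lemma ray_Z: "z \<in> Z \<Longrightarrow> (\<lambda>i. u i + z i / l) \<in> Z"
  using lin[of u z 1 "1 / l"] uK KZ by auto

lemma M_zero: "M (\<lambda>_. 0) = 0"
  using M_scale[OF zero_Z, of 0] by simp

lemma M_pos: "z \<in> Z \<Longrightarrow> z \<noteq> (\<lambda>_. 0) \<Longrightarrow> 0 < M z"
  using M0 M_eq_0 by (force simp: less_le)

lemma u_interior: "\<exists>T. open T \<and> u \<in> T \<and> T \<inter> Z \<subseteq> K"
  using int[OF uK, of "1/2"] by (simp add: field_simps)

text \<open>The point with the larger divisor is the combination with weight p = l / l' of the given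
  point of \<open>K\<close> and the centre.\<close>

lemma ray_interior:
  assumes z: "z \<in> Z" and l: "0 < l" "l < l'" and K: "(\<lambda>i. u i + z i / l) \<in> K"
  shows "\<exists>T. open T \<and> (\<lambda>i. u i + z i / l') \<in> T \<and> T \<inter> Z \<subseteq> K"
proof -
  have p: "0 < l / l'" "l / l' < 1" using l by auto
  have "(\<lambda>i. l / l' * (u i + z i / l) + (1 - l / l') * u i) = (\<lambda>i. u i + z i / l')"
    using l by (auto simp: field_simps)
  then show ?thesis using int[OF K p] by simp
qed

lemma continuous_ray: "continuous_on UNIV (\<lambda>z :: 'a \<Rightarrow> real. \<lambda>i. u i + z i / l)"
  by (rule continuous_on_coordinatewise_then_product)
     (intro continuous_on_add continuous_on_const continuous_on_product_coordinates | simp add: divide_inverse continuous_on_mult_right)+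

lemma continuous_ray_param: "continuous_on UNIV (\<lambda>t. \<lambda>i. u i + t * z i)"
  by (rule continuous_on_coordinatewise_then_product) (intro continuous_intros)

lemma gauge_set_nonempty:
  assumes z: "z \<in> Z"
  shows "\<exists>l>0. (\<lambda>i. u i + z i / l) \<in> K"
proof -
  obtain T where T: "open T" "u \<in> T" "T \<inter> Z \<subseteq> K" using u_interior by blast
  have "open ((\<lambda>t. \<lambda>i. u i + t * z i) -` T)" by (rule open_vimage[OF T(1) continuous_ray_param])
  moreover have "0 \<in> (\<lambda>t. \<lambda>i. u i + t * z i) -` T" using T(2) by simp
  ultimately obtain e where e: "e > 0" "ball 0 e \<subseteq> (\<lambda>t. \<lambda>i. u i + t * z i) -` T"
    using open_contains_ball by blast
  have "e / 2 \<in> ball 0 e" using e by (simp add: dist_real_def)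
  then have "e / 2 \<in> (\<lambda>t. \<lambda>i. u i + t * z i) -` T" by (rule subsetD[OF e(2)])
  then have "(\<lambda>i. u i + e / 2 * z i) \<in> T" by (simp only: vimage_eq)
  moreover have "(\<lambda>i. u i + z i / (2 / e)) = (\<lambda>i. u i + e / 2 * z i)" using e by (auto simp: field_simps)
  ultimately have "(\<lambda>i. u i + z i / (2 / e)) \<in> K" using T(3) ray_Z[OF z, of "2 / e"] by auto
  then show ?thesis using e by (intro exI[of _ "2 / e"]) auto
qed

lemma gauge_nonneg: "z \<in> Z \<Longrightarrow> 0 \<le> q z"
  unfolding gauge_def using gauge_set_nonempty[of z] by (intro cInf_greatest) auto

lemma gauge_less: "z \<in> Z \<Longrightarrow> q z < a \<longleftrightarrow> (\<exists>l. 0 < l \<and> l < a \<and> (\<lambda>i. u i + z i / l) \<in> K)"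
proof -
  assume z: "z \<in> Z"
  have "{l. 0 < l \<and> (\<lambda>i. u i + z i / l) \<in> K} \<noteq> {}" using gauge_set_nonempty[OF z] by blast
  moreover have "bdd_below {l. 0 < l \<and> (\<lambda>i. u i + z i / l) \<in> K}" by (intro bdd_belowI[of _ 0]) auto
  ultimately show ?thesis unfolding gauge_def by (subst cInf_less_iff) auto
qed

text \<open>Closedness of \<open>K\<close> gives the inequality at the infimum itself: the divisors
  a + 1/(m + 1) are all admissible and tend to \<open>a\<close>.\<close>

lemma gauge_le:
  assumes z: "z \<in> Z" and a: "0 < a"
  shows "q z \<le> a \<longleftrightarrow> (\<lambda>i. u i + z i / a) \<in> K"
proof
  assume "(\<lambda>i. u i + z i / a) \<in> K"
  show "q z \<le> a"
  proof (rule ccontr)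
    assume "\<not> q z \<le> a"
    moreover have "q z < b" if "a < b" for b using gauge_less[OF z, of b] that a \<open>_ \<in> K\<close> by blast
    ultimately show False by (meson less_irrefl not_le)
  qed
next
  assume le: "q z \<le> a"
  have mem: "(\<lambda>i. u i + z i / (a + 1 / real (Suc m))) \<in> K" for m
  proof -
    have "q z < a + 1 / real (Suc m)" using le by (intro le_less_trans[OF le]) simp
    then obtain l where l: "0 < l" "l < a + 1 / real (Suc m)" "(\<lambda>i. u i + z i / l) \<in> K" using gauge_less[OF z] by blast
    show ?thesis using ray_interior[OF z l] ray_Z[OF z] by blast
  qed
  have "(\<lambda>m. a + 1 / real (Suc m)) \<longlonglongrightarrow> a + 0"
    by (intro tendsto_add tendsto_const LIMSEQ_inverse_real_of_nat[unfolded inverse_eq_divide])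
  then have lim: "(\<lambda>m. 1 / (a + 1 / real (Suc m))) \<longlonglongrightarrow> 1 / a" using a by (intro tendsto_divide tendsto_const) auto
  have ic: "isCont (\<lambda>t. \<lambda>i. u i + t * z i) (1 / a)"
    using continuous_ray_param[of z] by (simp add: continuous_on_eq_continuous_at)
  have "(\<lambda>i. u i + (1 / a) * z i) \<in> K"
  proof (rule Lim_in_closed_set[OF closedK _ _ isCont_tendsto_compose[OF ic lim]])
    show "\<forall>\<^sub>F m in sequentially. (\<lambda>i. u i + 1 / (a + 1 / real (Suc m)) * z i) \<in> K"
      using mem by simp
  qed simp
  then show "(\<lambda>i. u i + z i / a) \<in> K" by simp
qed

lemma gauge_le_1: "z \<in> Z \<Longrightarrow> q z \<le> 1 \<longleftrightarrow> (\<lambda>i. u i + z i) \<in> K"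
  using gauge_le[of z 1] by simp

lemma gauge_zero: "q (\<lambda>_. 0) = 0"
proof -
  have "q (\<lambda>_. 0) \<le> a" if "0 < a" for a using gauge_le[OF zero_Z that] uK by simp
  then have "q (\<lambda>_. 0) \<le> 0" by (rule dense_ge)
  then show ?thesis using gauge_nonneg[OF zero_Z] by simp
qed

lemma gauge_scale:
  assumes z: "z \<in> Z" and c: "0 \<le> c"
  shows "q (\<lambda>i. c * z i) = c * q z"
proof (cases "c = 0")
  case True
  then show ?thesis using gauge_zero by simp
next
  case False
  then have c: "0 < c" using c by simp
  have le: "q (\<lambda>i. c * z i) \<le> c * q z" if z: "z \<in> Z" and c: "0 < c" for z c
  proof (rule dense_ge)
    fix b assume b: "c * q z < b"
    then have "q z < b / c" using c by (simp add: field_simps)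
    then obtain l where l: "0 < l" "l < b / c" "(\<lambda>i. u i + z i / l) \<in> K" using gauge_less[OF z] by blast
    have "(\<lambda>i. u i + c * z i / (c * l)) \<in> K" using l(3) c by simp
    then have "q (\<lambda>i. c * z i) \<le> c * l" using c l by (subst gauge_le[OF scale_Z[OF z]]) auto
    also have "c * l \<le> b" using l(2) c by (simp add: field_simps)
    finally show "q (\<lambda>i. c * z i) \<le> b" .
  qed
  have "q z = q (\<lambda>i. (1 / c) * (c * z i))" using c by simp
  also have "\<dots> \<le> 1 / c * q (\<lambda>i. c * z i)" using c by (intro le scale_Z z) simp
  finally have "c * q z \<le> q (\<lambda>i. c * z i)" using c by (simp add: field_simps)
  then show ?thesis using le[OF z c] by simp
qed

lemma gauge_eq_0_iff:
  assumes z: "z \<in> Z"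
  shows "q z = 0 \<longleftrightarrow> (\<forall>t\<ge>0. (\<lambda>i. u i + t * z i) \<in> K)"
proof
  assume q0: "q z = 0"
  show "\<forall>t\<ge>0. (\<lambda>i. u i + t * z i) \<in> K"
  proof (intro allI impI)
    fix t :: real assume t: "0 \<le> t"
    have "q (\<lambda>i. t * z i) \<le> 1" using gauge_scale[OF z t] q0 by simp
    then show "(\<lambda>i. u i + t * z i) \<in> K" using gauge_le_1[OF scale_Z[OF z]] by simp
  qed
next
  assume r: "\<forall>t\<ge>0. (\<lambda>i. u i + t * z i) \<in> K"
  have "q z \<le> a" if a: "0 < a" for a
  proof -
    have "(\<lambda>i. u i + (1 / a) * z i) \<in> K" using r[rule_format, of "1 / a"] a by simp
    then show ?thesis using gauge_le[OF z a] by simp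
  qed
  then have "q z \<le> 0" by (rule dense_ge)
  then show "q z = 0" using gauge_nonneg[OF z] by simp
qed

text \<open>Lower semicontinuity comes from closedness of \<open>K\<close>. Upper semicontinuity
  needs strict star-shapedness: a slightly larger divisor reaches an interior point, and a whole
  neighbourhood with it.\<close>

lemma continuous_gauge: "continuous_on Z q"
  unfolding continuous_on_def
proof (intro ballI order_tendstoI)
  fix z a assume z: "z \<in> Z" and a: "a < q z"
  show "\<forall>\<^sub>F y in at z within Z. a < q y"
  proof (cases "a < 0")
    case True
    then show ?thesis using gauge_nonneg unfolding eventually_at_topological
      by (intro exI[of _ UNIV]) (auto intro: less_le_trans)
  next
    case False
    obtain b where b: "a < b" "b < q z" using a dense by blast
    then have b0: "0 < b" using False by simp
    have "open ((\<lambda>y. \<lambda>i. u i + y i / b) -` (- K))" by (rule open_vimage[OF open_Compl[OF closedK] continuous_ray])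
    moreover have "z \<in> (\<lambda>y. \<lambda>i. u i + y i / b) -` (- K)" using gauge_le[OF z b0] b by simp
    moreover have "a < q y" if "y \<in> (\<lambda>y. \<lambda>i. u i + y i / b) -` (- K)" "y \<in> Z" for y
      using gauge_le[OF that(2) b0] that(1) b by simp
    ultimately show ?thesis unfolding eventually_at_topological by blast
  qed
next
  fix z a assume z: "z \<in> Z" and a: "q z < a"
  obtain b where b: "q z < b" "b < a" using a dense by blast
  obtain l where l: "0 < l" "l < b" "(\<lambda>i. u i + z i / l) \<in> K" using b(1) gauge_less[OF z] by blast
  obtain T where T: "open T" "(\<lambda>i. u i + z i / b) \<in> T" "T \<inter> Z \<subseteq> K" using ray_interior[OF z l] by blast
  have "open ((\<lambda>y. \<lambda>i. u i + y i / b) -` T)" by (rule open_vimage[OF T(1) continuous_ray])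
  moreover have "q y < a" if "y \<in> (\<lambda>y. \<lambda>i. u i + y i / b) -` T" "y \<in> Z" for y
  proof -
    have "(\<lambda>i. u i + y i / b) \<in> K" using that T(3) ray_Z[OF that(2)] by auto
    then have "q y \<le> b" using gauge_le[OF that(2)] l by simp
    then show ?thesis using b by simp
  qed
  ultimately show "\<forall>\<^sub>F y in at z within Z. q y < a" unfolding eventually_at_topological using T(2) by blast
qed

text \<open>The quotient of gauge and norm is continuous on a compact sphere and homogeneous of
  degree 0. The bound controls the radial map near the origin.\<close>

lemma gauge_bound: "\<exists>C\<ge>0. \<forall>z\<in>Z. q z \<le> C * M z"
proof -
  define S where "S = {x \<in> Z. (\<forall>i. i \<notin> I \<longrightarrow> x i = 0) \<and> (\<Sum>i\<in>I. \<bar>x i\<bar>) = 1}"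
  have S: "compact S" unfolding S_def by (rule compact_l1_sphere[OF I closedZ])
  have SZ: "S \<subseteq> Z" unfolding S_def by blast
  have Mpos: "0 < M z" if "z \<in> S" for z
  proof (rule M_pos)
    show "z \<in> Z" using that SZ by blast
    show "z \<noteq> (\<lambda>_. 0)" using that unfolding S_def by auto
  qed
  have norm: "\<exists>s>0. \<exists>y\<in>S. z = (\<lambda>i. s * y i)" if z: "z \<in> Z" "z \<noteq> (\<lambda>_. 0)" for z
  proof -
    define s where "s = (\<Sum>i\<in>I. \<bar>z i\<bar>)"
    have "s \<noteq> 0"
    proof
      assume "s = 0"
      then have "z i = 0" if "i \<in> I" for i using I that unfolding s_def by (simp add: sum_nonneg_eq_0_iff)
      then have "z = (\<lambda>_. 0)" using supp[OF z(1)] by auto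
      then show False using z by simp
    qed
    then have s: "0 < s" unfolding s_def by (simp add: less_le sum_nonneg)
    define y where "y = (\<lambda>i. (1 / s) * z i)"
    have "y \<in> Z" unfolding y_def by (rule scale_Z[OF z(1)])
    moreover have "(\<Sum>i\<in>I. \<bar>y i\<bar>) = 1"
    proof -
      have "(\<Sum>i\<in>I. \<bar>y i\<bar>) = (\<Sum>i\<in>I. \<bar>z i\<bar> / s)" unfolding y_def using s by (simp add: abs_mult)
      also have "\<dots> = 1" unfolding sum_divide_distrib[symmetric] using s by (simp add: s_def)
      finally show ?thesis .
    qed
    ultimately have "y \<in> S" unfolding S_def using supp by auto
    moreover have "z = (\<lambda>i. s * y i)" unfolding y_def using s by simp
    ultimately show ?thesis using s by blast
  qed
  have "\<exists>C\<ge>0. \<forall>y\<in>S. q y \<le> C * M y"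
  proof (cases "S = {}")
    case False
    have "continuous_on S (\<lambda>z. q z / M z)"
      using Mpos by (intro continuous_on_divide continuous_on_subset[OF continuous_gauge SZ] continuous_on_subset[OF contM SZ]) force
    from continuous_attains_sup[OF S False this] obtain x where x: "x \<in> S" "\<And>y. y \<in> S \<Longrightarrow> q y / M y \<le> q x / M x" by blast
    then have "\<forall>y\<in>S. q y \<le> q x / M x * M y" using Mpos by (force simp: field_simps)
    moreover have "0 \<le> q x / M x" using x(1) SZ gauge_nonneg M0 by auto
    ultimately show ?thesis by blast
  qed auto
  then obtain C where C: "C \<ge> 0" "\<And>y. y \<in> S \<Longrightarrow> q y \<le> C * M y" by blast
  have "q z \<le> C * M z" if z: "z \<in> Z" for z
  proof (cases "z = (\<lambda>_. 0)")
    case True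
    then show ?thesis using gauge_zero M_zero by simp
  next
    case False
    then obtain s y where s: "s > 0" "y \<in> S" "z = (\<lambda>i. s * y i)" using norm[OF z] by blast
    then have y: "y \<in> Z" using SZ by blast
    have "q z = s * q y" using s gauge_scale[OF y] by simp
    also have "\<dots> \<le> s * (C * M y)" using C(2) s by (intro mult_left_mono) auto
    also have "\<dots> = C * M z" using s M_scale[OF y, of s] by simp
    finally show ?thesis .
  qed
  then show ?thesis using C by blast
qed

section \<open>The radial homeomorphism\<close>

definition X :: "('a \<Rightarrow> real) set" where
  "X = {w \<in> Z. M w \<le> 1 \<and> \<not> (M w = 1 \<and> q w = 0)}"

definition K0 :: "('a \<Rightarrow> real) set" where
  "K0 = {z \<in> Z. q z \<le> 1}"

definition fwd_factor :: "('a \<Rightarrow> real) \<Rightarrow> real" where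
  "fwd_factor z = (M z + q z) / (M z * (1 + M z))"

text \<open>Obtained by solving s = t (1 + 1/T) / (1 + t) for t, which gives t / s = 1 / (1 + 1/T -
  s), with s = \<open>M w\<close> and 1/T = \<open>q w / M w\<close>. At the origin both factors are
  0 by the convention for division, which is harmless since they multiply the zero vector.\<close>

definition bwd_factor :: "('a \<Rightarrow> real) \<Rightarrow> real" where
  "bwd_factor w = M w / (M w + q w - (M w)\<^sup>2)"

text \<open>On the ray through \<open>z\<close>, parametrised by \<open>t = M z\<close> and with \<open>K\<close> ending at \<open>t = T = M z / q z \<le> \<infinity>\<close>, the
  homeomorphism is \<open>t \<mapsto> t (1 + 1/T) / (1 + t)\<close>, which maps \<open>[0, T]\<close> to \<open>[0, 1]\<close> and \<open>[0, \<infinity>)\<close> to \<open>[0, 1)\<close>.\<close>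

lemma fwd_props:
  assumes z: "z \<in> K0" and nz: "z \<noteq> (\<lambda>_. 0)"
  defines "w \<equiv> \<lambda>i. fwd_factor z * z i"
  shows "w \<in> X" "bwd_factor w * fwd_factor z = 1"
proof -
  have zZ: "z \<in> Z" and q1: "q z \<le> 1" using z unfolding K0_def by auto
  have m: "0 < M z" and q0: "0 \<le> q z" using M_pos[OF zZ nz] gauge_nonneg[OF zZ] by auto
  have c: "0 < fwd_factor z" unfolding fwd_factor_def using m q0 by (intro divide_pos_pos) auto
  have Mw: "M w = fwd_factor z * M z" and qw: "q w = fwd_factor z * q z"
    unfolding w_def using M_scale[OF zZ] gauge_scale[OF zZ] c by auto
  have Mw': "M w = (M z + q z) / (1 + M z)" unfolding Mw fwd_factor_def using m by simp
  have le: "M w \<le> 1" unfolding Mw' using m q1 by simp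
  have nz0: "q w \<noteq> 0" if "M w = 1"
  proof -
    have "M z + q z = 1 + M z" using that m unfolding Mw' by (simp add: divide_eq_1_iff)
    then have "q z = 1" by simp
    then show ?thesis unfolding qw using c by simp
  qed
  show "w \<in> X" unfolding X_def using le nz0 scale_Z[OF zZ] by (auto simp: w_def)
  define c where "c = fwd_factor z"
  have cp: "0 < c" using \<open>0 < fwd_factor z\<close> unfolding c_def .
  have ce: "c * (M z * (1 + M z)) = M z + q z" unfolding c_def fwd_factor_def using m by simp
  have den: "M w + q w - (M w)\<^sup>2 = c * (c * M z)"
  proof -
    have "M w + q w - (M w)\<^sup>2 = c * (M z + q z) - c * c * M z * M z"
      unfolding Mw qw c_def[symmetric] by (simp add: algebra_simps power2_eq_square)
    also have "\<dots> = c * (c * M z)" unfolding ce[symmetric] by (simp add: algebra_simps)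
    finally show ?thesis .
  qed
  show "bwd_factor w * fwd_factor z = 1"
    unfolding bwd_factor_def den unfolding Mw c_def[symmetric] using cp m by simp
qed

text \<open>The denominator is \<open>M w * (1 - M w) + q w\<close>. For nonzero vectors of the unit
  ball it vanishes exactly at the removed points.\<close>

lemma bwd_den_pos:
  assumes w: "w \<in> X" and nz: "w \<noteq> (\<lambda>_. 0)"
  shows "0 < M w + q w - (M w)\<^sup>2"
proof -
  have wZ: "w \<in> Z" and m1: "M w \<le> 1" and n: "\<not> (M w = 1 \<and> q w = 0)" using w unfolding X_def by blast+
  have m: "0 < M w" and q0: "0 \<le> q w" using M_pos[OF wZ nz] gauge_nonneg[OF wZ] by auto
  have e: "M w + q w - (M w)\<^sup>2 = M w * (1 - M w) + q w" by (simp add: algebra_simps power2_eq_square)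
  show ?thesis
  proof (cases "M w = 1")
    case True
    then show ?thesis unfolding e using n q0 by auto
  next
    case False
    then have "0 < M w * (1 - M w)" using m m1 by simp
    then show ?thesis unfolding e using q0 by simp
  qed
qed

lemma bwd_props:
  assumes w: "w \<in> X" and nz: "w \<noteq> (\<lambda>_. 0)"
  defines "z \<equiv> \<lambda>i. bwd_factor w * w i"
  shows "z \<in> K0" "fwd_factor z * bwd_factor w = 1"
proof -
  have wZ: "w \<in> Z" and m1: "M w \<le> 1" using w unfolding X_def by blast+
  have m: "0 < M w" and q0: "0 \<le> q w" using M_pos[OF wZ nz] gauge_nonneg[OF wZ] by auto
  note den = bwd_den_pos[OF w nz]
  define e where "e = bwd_factor w"
  have e: "0 < e" unfolding e_def bwd_factor_def using m den by simp
  have ee: "e * (M w + q w - (M w)\<^sup>2) = M w" unfolding e_def bwd_factor_def using den by simp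
  have Mz: "M z = e * M w" and qz: "q z = e * q w"
    unfolding z_def e_def[symmetric] using M_scale[OF wZ, of e] gauge_scale[OF wZ, of e] e by auto
  \<comment> \<open>Expanded, this inequality is precisely the bound
    \<open>q z \<le> 1\<close>.\<close>
  have "0 \<le> (1 - M w) * (M w + q w)" using m m1 q0 by simp
  then have "M w * q w \<le> M w + q w - (M w)\<^sup>2" by (simp add: algebra_simps power2_eq_square)
  then have "q z \<le> 1" unfolding qz e_def bwd_factor_def using den by (simp add: field_simps)
  then show "z \<in> K0" unfolding K0_def using scale_Z[OF wZ] by (simp add: z_def)
  have "M z + q z = e * (M w + q w)" unfolding Mz qz by (simp add: algebra_simps)
  also have "\<dots> = M w * (1 + M z)"
  proof -
    have "e * (M w + q w) = M w + e * M w * M w" using ee by (simp add: algebra_simps power2_eq_square)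
    then show ?thesis unfolding Mz by (simp add: algebra_simps)
  qed
  finally have s: "M z + q z = M w * (1 + M z)" .
  have "0 < M z" unfolding Mz using e m by simp
  then have "fwd_factor z = M w / M z" unfolding fwd_factor_def s by simp
  then show "fwd_factor z * bwd_factor w = 1" unfolding Mz e_def[symmetric] using e m by simp
qed

text \<open>The factor has no limit at the origin in general, but \<open>gauge_bound\<close> keeps
  it between 0 and 1 + C, so its product with the coordinate tends to 0.\<close>

lemma continuous_fwd: "continuous_on K0 (\<lambda>z. \<lambda>i. fwd_factor z * z i)"
proof (rule continuous_on_coordinatewise_then_product)
  fix i
  have K0Z: "K0 \<subseteq> Z" unfolding K0_def by blast
  obtain C where C: "C \<ge> 0" "\<And>z. z \<in> Z \<Longrightarrow> q z \<le> C * M z" using gauge_bound by blast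
  show "continuous_on K0 (\<lambda>z. fwd_factor z * z i)"
    unfolding continuous_on_def
  proof
    fix z assume z: "z \<in> K0"
    then have zZ: "z \<in> Z" using K0Z by blast
    have ti: "((\<lambda>y. y i) \<longlongrightarrow> z i) (at z within K0)"
      by (rule continuous_on_tendsto_within[OF continuous_on_product_coordinates]) auto
    have tM: "(M \<longlongrightarrow> M z) (at z within K0)" by (rule continuous_on_tendsto_within[OF contM zZ K0Z])
    have tq: "(q \<longlongrightarrow> q z) (at z within K0)" by (rule continuous_on_tendsto_within[OF continuous_gauge zZ K0Z])
    show "((\<lambda>z. fwd_factor z * z i) \<longlongrightarrow> fwd_factor z * z i) (at z within K0)"
    proof (cases "z = (\<lambda>_. 0)")
      case False
      then show ?thesis unfolding fwd_factor_def using M_pos[OF zZ]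
        by (intro tendsto_mult tendsto_divide tendsto_add tendsto_const ti tM tq) auto
    next
      case True
      have "((\<lambda>y. (1 + C) * \<bar>y i\<bar>) \<longlongrightarrow> (1 + C) * \<bar>z i\<bar>) (at z within K0)"
        by (intro tendsto_mult tendsto_const tendsto_rabs ti)
      then have "((\<lambda>y. (1 + C) * \<bar>y i\<bar>) \<longlongrightarrow> 0) (at z within K0)" using True by simp
      moreover have "\<forall>\<^sub>F y in at z within K0. norm (fwd_factor y * y i) \<le> (1 + C) * \<bar>y i\<bar>"
      proof -
        have "norm (fwd_factor y * y i) \<le> (1 + C) * \<bar>y i\<bar>" if "y \<in> K0" "y \<noteq> z" for y
        proof -
          have y: "y \<in> Z" using that K0Z by blast
          have m: "0 < M y" using M_pos[OF y] that True by blast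
          have f0: "0 \<le> fwd_factor y" unfolding fwd_factor_def using m gauge_nonneg[OF y] by simp
          have "M y + q y \<le> (1 + C) * M y" using C(2)[OF y] by (simp add: algebra_simps)
          also have "\<dots> \<le> (1 + C) * (M y * (1 + M y))" using m C(1) by (intro mult_left_mono) auto
          finally have "fwd_factor y \<le> 1 + C" unfolding fwd_factor_def using m by (simp add: pos_divide_le_eq)
          then show ?thesis using f0 by (simp add: abs_mult mult_right_mono)
        qed
        then show ?thesis unfolding eventually_at_topological by (intro exI[of _ UNIV]) auto
      qed
      ultimately have "((\<lambda>y. fwd_factor y * y i) \<longlongrightarrow> 0) (at z within K0)" by (rule Lim_null_comparison[rotated])
      then show ?thesis using True by simp
    qed
  qed
qed

text \<open>At the origin boundedness of the factor suffices; it is at most 2 as soon as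
  \<open>M y < 1/2\<close>.\<close>

lemma continuous_bwd: "continuous_on X (\<lambda>z. \<lambda>i. bwd_factor z * z i)"
proof (rule continuous_on_coordinatewise_then_product)
  fix i
  have XZ: "X \<subseteq> Z" unfolding X_def by blast
  show "continuous_on X (\<lambda>z. bwd_factor z * z i)"
    unfolding continuous_on_def
  proof
    fix z assume z: "z \<in> X"
    then have zZ: "z \<in> Z" using XZ by blast
    have ti: "((\<lambda>y. y i) \<longlongrightarrow> z i) (at z within X)"
      by (rule continuous_on_tendsto_within[OF continuous_on_product_coordinates]) auto
    have tM: "(M \<longlongrightarrow> M z) (at z within X)" by (rule continuous_on_tendsto_within[OF contM zZ XZ])
    have tq: "(q \<longlongrightarrow> q z) (at z within X)" by (rule continuous_on_tendsto_within[OF continuous_gauge zZ XZ])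
    show "((\<lambda>z. bwd_factor z * z i) \<longlongrightarrow> bwd_factor z * z i) (at z within X)"
    proof (cases "z = (\<lambda>_. 0)")
      case False
      then show ?thesis unfolding bwd_factor_def using bwd_den_pos[OF z]
        by (intro tendsto_mult tendsto_divide tendsto_add tendsto_diff tendsto_power ti tM tq) auto
    next
      case True
      have "((\<lambda>y. 2 * \<bar>y i\<bar>) \<longlongrightarrow> 2 * \<bar>z i\<bar>) (at z within X)"
        by (intro tendsto_mult tendsto_const tendsto_rabs ti)
      then have "((\<lambda>y. 2 * \<bar>y i\<bar>) \<longlongrightarrow> 0) (at z within X)" using True by simp
      moreover have "\<forall>\<^sub>F y in at z within X. norm (bwd_factor y * y i) \<le> 2 * \<bar>y i\<bar>"
      proof -
        have "M z < 1 / 2" using True M_zero by simp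
        then have "\<forall>\<^sub>F y in at z within X. M y < 1 / 2" using tM order_tendstoD(2) by blast
        moreover have "\<forall>\<^sub>F y in at z within X. y \<in> X \<and> y \<noteq> z"
          unfolding eventually_at_topological by (intro exI[of _ UNIV]) auto
        ultimately show ?thesis
        proof eventually_elim
          case (elim y)
          have y: "y \<in> Z" using elim XZ by blast
          have m: "0 < M y" using M_pos[OF y] elim True by blast
          have den: "0 < M y + q y - (M y)\<^sup>2" using bwd_den_pos[of y] elim True by blast
          have f0: "0 \<le> bwd_factor y" unfolding bwd_factor_def using m den by simp
          have "(M y)\<^sup>2 \<le> M y * (1 / 2)" unfolding power2_eq_square using m elim(1) by (intro mult_left_mono) auto
          then have "M y \<le> 2 * (M y + q y - (M y)\<^sup>2)" using gauge_nonneg[OF y] by simp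
          then have "bwd_factor y \<le> 2" unfolding bwd_factor_def using den by (simp add: pos_divide_le_eq)
          then show ?case using f0 by (simp add: abs_mult mult_right_mono)
        qed
      qed
      ultimately have "((\<lambda>y. bwd_factor y * y i) \<longlongrightarrow> 0) (at z within X)" by (rule Lim_null_comparison[rotated])
      then show ?thesis using True by simp
    qed
  qed
qed

lemma zero_in_X_K0: "(\<lambda>_. 0) \<in> X" "(\<lambda>_. 0) \<in> K0"
  unfolding X_def K0_def using zero_Z M_zero gauge_zero by auto

lemma homeomorphic_K_X: "top_of_set K homeomorphic_space top_of_set X"
proof -
  define \<phi> where "\<phi> z = (\<lambda>i. fwd_factor z * z i)" for z :: "'a \<Rightarrow> real"
  define \<psi> where "\<psi> z = (\<lambda>i. bwd_factor z * z i)" for z :: "'a \<Rightarrow> real"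
  have \<phi>0: "\<phi> (\<lambda>_. 0) = (\<lambda>_. 0)" and \<psi>0: "\<psi> (\<lambda>_. 0) = (\<lambda>_. 0)" unfolding \<phi>_def \<psi>_def by auto
  have \<phi>X: "\<phi> z \<in> X" if "z \<in> K0" for z
    using fwd_props(1)[OF that] zero_in_X_K0(1) \<phi>0 unfolding \<phi>_def by (cases "z = (\<lambda>_. 0)") auto
  have \<psi>K: "\<psi> w \<in> K0" if "w \<in> X" for w
    using bwd_props(1)[OF that] zero_in_X_K0(2) \<psi>0 unfolding \<psi>_def by (cases "w = (\<lambda>_. 0)") auto
  have \<psi>\<phi>: "\<psi> (\<phi> z) = z" if "z \<in> K0" for z
  proof (cases "z = (\<lambda>_. 0)")
    case True
    then show ?thesis using \<phi>0 \<psi>0 by simp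
  next
    case False
    have "\<psi> (\<phi> z) = (\<lambda>i. bwd_factor (\<phi> z) * fwd_factor z * z i)" unfolding \<psi>_def \<phi>_def by (simp add: mult.assoc)
    then show ?thesis using fwd_props(2)[OF that False] unfolding \<phi>_def by simp
  qed
  have \<phi>\<psi>: "\<phi> (\<psi> w) = w" if "w \<in> X" for w
  proof (cases "w = (\<lambda>_. 0)")
    case True
    then show ?thesis using \<phi>0 \<psi>0 by simp
  next
    case False
    have "\<phi> (\<psi> w) = (\<lambda>i. fwd_factor (\<psi> w) * bwd_factor w * w i)" unfolding \<psi>_def \<phi>_def by (simp add: mult.assoc)
    then show ?thesis using bwd_props(2)[OF that False] unfolding \<psi>_def by simp
  qed
  have KK0: "(\<lambda>i. v i - u i) \<in> K0" if v: "v \<in> K" for v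
  proof -
    have "(\<lambda>i. v i - u i) \<in> Z" using lin[of v u 1 "-1"] v uK KZ by auto
    then show ?thesis unfolding K0_def using gauge_le_1 v by simp
  qed
  have K0K: "(\<lambda>i. u i + z i) \<in> K" if "z \<in> K0" for z using that gauge_le_1 unfolding K0_def by blast
  have ct: "continuous_on K (\<lambda>v. \<lambda>i. v i - u i)"
    by (rule continuous_on_coordinatewise_then_product) (intro continuous_on_diff continuous_on_const continuous_on_subset[OF continuous_on_product_coordinates subset_UNIV])
  have ct': "continuous_on K0 (\<lambda>z. \<lambda>i. u i + z i)"
    by (rule continuous_on_coordinatewise_then_product) (intro continuous_on_add continuous_on_const continuous_on_subset[OF continuous_on_product_coordinates subset_UNIV])
  have "homeomorphic_maps (top_of_set K) (top_of_set X) (\<lambda>v. \<phi> (\<lambda>i. v i - u i)) (\<lambda>w. \<lambda>i. u i + \<psi> w i)"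
    unfolding homeomorphic_maps_def
  proof (intro conjI ballI)
    have "continuous_on K (\<lambda>v. \<phi> (\<lambda>i. v i - u i))"
      using continuous_on_compose2[OF continuous_fwd ct] KK0 unfolding \<phi>_def by blast
    then show "continuous_map (top_of_set K) (top_of_set X) (\<lambda>v. \<phi> (\<lambda>i. v i - u i))"
      using \<phi>X KK0 by (auto simp: continuous_map_in_subtopology)
    have "continuous_on X (\<lambda>w. \<lambda>i. u i + \<psi> w i)"
      using continuous_on_compose2[OF ct' continuous_bwd] \<psi>K unfolding \<psi>_def by blast
    then show "continuous_map (top_of_set X) (top_of_set K) (\<lambda>w. \<lambda>i. u i + \<psi> w i)"
      using \<psi>K K0K by (auto simp: continuous_map_in_subtopology)
  next
    fix v assume "v \<in> topspace (top_of_set K)"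
    then show "(\<lambda>i. u i + \<psi> (\<phi> (\<lambda>i. v i - u i)) i) = v" using \<psi>\<phi> KK0 by simp
  next
    fix w assume "w \<in> topspace (top_of_set X)"
    then show "\<phi> (\<lambda>i. u i + \<psi> w i - u i) = w" using \<phi>\<psi> by simp
  qed
  then show ?thesis unfolding homeomorphic_space_def by blast
qed

end

section \<open>The reduced spaces\<close>

text \<open>A left inverse of the inclusion of the subspace, for the pointwise vector space
  structure on functions.\<close>

lemma exists_linear_projection:
  fixes W :: "('a \<Rightarrow> real) set"
  assumes W0: "(\<lambda>_. 0) \<in> W" and W: "\<And>x y a b. x \<in> W \<Longrightarrow> y \<in> W \<Longrightarrow> (\<lambda>i. a * x i + b * y i) \<in> W"
  shows "\<exists>g. (\<forall>x. g x \<in> W) \<and> (\<forall>x. x \<in> W \<longrightarrow> g x = x) \<and>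
    (\<forall>a b x y. g (\<lambda>i. a * x i + b * y i) = (\<lambda>i. a * g x i + b * g y i))"
proof -
  define sc where "sc a x = (\<lambda>i. a * x i)" for a and x :: "'a \<Rightarrow> real"
  interpret V: vector_space sc
    by unfold_locales (simp_all add: sc_def fun_eq_iff distrib_left distrib_right)
  interpret VV: vector_space_pair sc sc ..
  have "Vector_Spaces.linear sc sc (\<lambda>x. x)" by (rule V.linear_ident)
  moreover have "V.subspace W"
    unfolding V.subspace_def
  proof (intro conjI ballI allI)
    show "0 \<in> W" using W0 by (simp add: zero_fun_def)
    show "x + y \<in> W" if "x \<in> W" "y \<in> W" for x y
      using W[OF that, of 1 1] by (simp add: plus_fun_def)
    show "sc c x \<in> W" if "x \<in> W" for c x
      using W[OF that that, of c 0] by (simp add: sc_def)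
  qed
  ultimately obtain g where g: "g ` UNIV \<subseteq> W" "Vector_Spaces.linear sc sc g" "\<And>x. x \<in> W \<Longrightarrow> g x = x"
    using VV.linear_exists_left_inverse_on[of "\<lambda>x. x" W] by (auto simp: inj_on_def)
  interpret g: Vector_Spaces.linear sc sc g by (rule g(2))
  have "g (\<lambda>i. a * x i + b * y i) = (\<lambda>i. a * g x i + b * g y i)" for a b x y
  proof -
    have "g (sc a x + sc b y) = sc a (g x) + sc b (g y)" unfolding g.add g.scale ..
    then show ?thesis unfolding sc_def plus_fun_def .
  qed
  moreover have "g x \<in> W" for x using g(1) by blast
  ultimately show ?thesis using g(3) by (intro exI[of _ g] conjI allI impI)
qed

text \<open>On functions supported in a finite set a linear map is a finite combination of
  coordinates; its continuity follows from this formula.\<close>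

lemma linear_expansion:
  fixes g :: "('a \<Rightarrow> real) \<Rightarrow> ('a \<Rightarrow> real)"
  assumes lin: "\<And>a b x y. g (\<lambda>i. a * x i + b * y i) = (\<lambda>i. a * g x i + b * g y i)"
    and A: "finite A" and x: "\<And>i. i \<notin> A \<Longrightarrow> x i = 0"
  shows "g x k = (\<Sum>b\<in>A. x b * g (unit_fun b) k)"
  using A x
proof (induction A arbitrary: x rule: finite_induct)
  case empty
  then have "x = (\<lambda>i. 0 * x i + 0 * x i)" by auto
  then have "g x = (\<lambda>i. 0 * g x i + 0 * g x i)" using lin[of 0 x 0 x] by metis
  then show ?case by (metis add_0 mult_zero_left sum.empty)
next
  case (insert a A)
  define y where "y i = (if i = a then 0 else x i)" for i
  have "x = (\<lambda>i. x a * unit_fun a i + 1 * y i)" by (auto simp: y_def unit_fun_def)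
  then have "g x = (\<lambda>i. x a * g (unit_fun a) i + 1 * g y i)" using lin[of "x a" "unit_fun a" 1 y] by metis
  then have "g x k = x a * g (unit_fun a) k + g y k" by (metis mult_1)
  also have "g y k = (\<Sum>b\<in>A. y b * g (unit_fun b) k)" using insert.prems by (intro insert.IH) (auto simp: y_def)
  also have "\<dots> = (\<Sum>b\<in>A. x b * g (unit_fun b) k)" using insert.hyps by (intro sum.cong) (auto simp: y_def)
  finally show ?case using insert.hyps by simp
qed

lemma seminorm_expansion:
  fixes M :: "('a \<Rightarrow> real) \<Rightarrow> real" and h :: "('a \<Rightarrow> real) \<Rightarrow> ('a \<Rightarrow> real)"
  assumes V0: "(\<lambda>_. 0) \<in> V" and V: "\<And>x y a b. x \<in> V \<Longrightarrow> y \<in> V \<Longrightarrow> (\<lambda>i. a * x i + b * y i) \<in> V"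
    and scale: "\<And>x a. x \<in> V \<Longrightarrow> M (\<lambda>i. a * x i) = \<bar>a\<bar> * M x"
    and tri: "\<And>x y. x \<in> V \<Longrightarrow> y \<in> V \<Longrightarrow> M (\<lambda>i. x i + y i) \<le> M x + M y"
    and A: "finite A" and e: "\<And>b. b \<in> A \<Longrightarrow> e b \<in> V"
  shows "(\<lambda>k. \<Sum>b\<in>A. x b * e b k) \<in> V \<and> M (\<lambda>k. \<Sum>b\<in>A. x b * e b k) \<le> (\<Sum>b\<in>A. \<bar>x b\<bar> * M (e b))"
  using A e
proof (induction A rule: finite_induct)
  case empty
  have "M (\<lambda>_. 0) = 0" using scale[OF V0, of 0] by simp
  then show ?case using V0 by simp
next
  case (insert a A)
  then have a: "e a \<in> V" and IH: "(\<lambda>k. \<Sum>b\<in>A. x b * e b k) \<in> V" "M (\<lambda>k. \<Sum>b\<in>A. x b * e b k) \<le> (\<Sum>b\<in>A. \<bar>x b\<bar> * M (e b))" by auto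
  have eq: "(\<lambda>k. \<Sum>b\<in>insert a A. x b * e b k) = (\<lambda>k. x a * e a k + 1 * (\<Sum>b\<in>A. x b * e b k))"
    using insert.hyps by simp
  have xa: "(\<lambda>k. x a * e a k) \<in> V" using V[OF a a, of "x a" 0] by simp
  have "M (\<lambda>k. x a * e a k + (\<Sum>b\<in>A. x b * e b k)) \<le> \<bar>x a\<bar> * M (e a) + (\<Sum>b\<in>A. \<bar>x b\<bar> * M (e b))"
    using tri[OF xa IH(1)] IH(2) scale[OF a, of "x a"] by simp
  then show ?case using V[OF a IH(1), of "x a" 1] insert.hyps unfolding eq by simp
qed

text \<open>The seminorm is controlled only on \<open>V\<close>, which may fail to contain the unit
  functions. Their images under a linear projection onto \<open>V\<close> lie in \<open>V\<close>
  and expand every element of \<open>V\<close>, which gives a Lipschitz bound by finitely many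
  coordinates.\<close>

lemma continuous_on_seminorm:
  fixes M :: "('a \<Rightarrow> real) \<Rightarrow> real"
  assumes A: "finite A" and supp: "\<And>x i. x \<in> V \<Longrightarrow> i \<notin> A \<Longrightarrow> x i = 0"
    and V0: "(\<lambda>_. 0) \<in> V" and V: "\<And>x y a b. x \<in> V \<Longrightarrow> y \<in> V \<Longrightarrow> (\<lambda>i. a * x i + b * y i) \<in> V"
    and scale: "\<And>x a. x \<in> V \<Longrightarrow> M (\<lambda>i. a * x i) = \<bar>a\<bar> * M x"
    and tri: "\<And>x y. x \<in> V \<Longrightarrow> y \<in> V \<Longrightarrow> M (\<lambda>i. x i + y i) \<le> M x + M y"
  shows "continuous_on V M"
proof -
  from exists_linear_projection[of V, OF V0 V]
  obtain h where "(\<forall>x. h x \<in> V) \<and> (\<forall>x. x \<in> V \<longrightarrow> h x = x) \<and>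
    (\<forall>a b x y. h (\<lambda>i. a * x i + b * y i) = (\<lambda>i. a * h x i + b * h y i))" ..
  note h = conjunct1[OF this, rule_format] conjunct1[OF conjunct2[OF this], rule_format]
    conjunct2[OF conjunct2[OF this], rule_format]
  have bound: "M x \<le> (\<Sum>b\<in>A. \<bar>x b\<bar> * M (h (unit_fun b)))" if x: "x \<in> V" for x
  proof -
    have "x = (\<lambda>k. \<Sum>b\<in>A. x b * h (unit_fun b) k)"
    proof
      fix k
      have "h x k = (\<Sum>b\<in>A. x b * h (unit_fun b) k)" by (rule linear_expansion[OF h(3) A supp[OF x]])
      then show "x k = (\<Sum>b\<in>A. x b * h (unit_fun b) k)" using h(2)[OF x] by simp
    qed
    moreover have "M (\<lambda>k. \<Sum>b\<in>A. x b * h (unit_fun b) k) \<le> (\<Sum>b\<in>A. \<bar>x b\<bar> * M (h (unit_fun b)))"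
      by (rule conjunct2[OF seminorm_expansion[where V = V]]) (fact V0 A | rule V scale tri h(1); assumption)+
    ultimately show ?thesis by simp
  qed
  have diff: "\<bar>M x - M y\<bar> \<le> (\<Sum>b\<in>A. \<bar>x b - y b\<bar> * M (h (unit_fun b)))" if "x \<in> V" "y \<in> V" for x y
  proof -
    have one: "M x - M y \<le> (\<Sum>b\<in>A. \<bar>x b - y b\<bar> * M (h (unit_fun b)))" if x: "x \<in> V" and y: "y \<in> V" for x y
    proof -
      have d: "(\<lambda>i. x i - y i) \<in> V" using V[OF x y, of 1 "-1"] by simp
      have "M x \<le> M (\<lambda>i. x i - y i) + M y" using tri[OF d y] by simp
      then show ?thesis using bound[OF d] by simp
    qed
    have "(\<Sum>b\<in>A. \<bar>y b - x b\<bar> * M (h (unit_fun b))) = (\<Sum>b\<in>A. \<bar>x b - y b\<bar> * M (h (unit_fun b)))"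
      by (simp add: abs_minus_commute)
    then show ?thesis using one[OF that] one[OF that(2,1)] by (simp add: abs_le_iff)
  qed
  show ?thesis unfolding continuous_on_def
  proof
    fix y assume y: "y \<in> V"
    have ti: "((\<lambda>x. x i) \<longlongrightarrow> y i) (at y within V)" for i
      by (rule continuous_on_tendsto_within[OF continuous_on_product_coordinates]) auto
    have "((\<lambda>x. \<Sum>b\<in>A. \<bar>x b - y b\<bar> * M (h (unit_fun b))) \<longlongrightarrow> (\<Sum>b\<in>A. \<bar>y b - y b\<bar> * M (h (unit_fun b)))) (at y within V)"
      by (intro tendsto_sum tendsto_mult tendsto_rabs tendsto_diff tendsto_const ti)
    then have lim: "((\<lambda>x. \<Sum>b\<in>A. \<bar>x b - y b\<bar> * M (h (unit_fun b))) \<longlongrightarrow> 0) (at y within V)" by simp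
    have "((\<lambda>x. M x - M y) \<longlongrightarrow> 0) (at y within V)"
    proof (rule Lim_null_comparison[OF _ lim])
      have "\<forall>\<^sub>F x in at y within V. x \<in> V" unfolding eventually_at_topological by (intro exI[of _ UNIV]) auto
      then show "\<forall>\<^sub>F x in at y within V. norm (M x - M y) \<le> (\<Sum>b\<in>A. \<bar>x b - y b\<bar> * M (h (unit_fun b)))"
        by eventually_elim (use diff[OF _ y] in simp)
    qed
    then show "(M \<longlongrightarrow> M y) (at y within V)" by (simp add: LIM_zero_iff)
  qed
qed

lemma W_space_zero: "(\<lambda>_. 0) \<in> W_space n J"
  unfolding W_space_def by (intro CollectI exI[of _ "\<lambda>_. 0"]) (simp add: fun_eq_iff)

lemma W_space_lincomb:
  assumes "v \<in> W_space n J" "w \<in> W_space n J"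
  shows "(\<lambda>\<alpha>. a * v \<alpha> + b * w \<alpha>) \<in> W_space n J"
proof -
  obtain c e where v: "v = (\<lambda>\<alpha>. if \<alpha> \<in> J then \<Sum>i<n. c i * real (lk \<alpha> i) else 0)"
    and w: "w = (\<lambda>\<alpha>. if \<alpha> \<in> J then \<Sum>i<n. e i * real (lk \<alpha> i) else 0)"
    using assms unfolding W_space_def by blast
  have "(\<lambda>\<alpha>. a * v \<alpha> + b * w \<alpha>) = (\<lambda>\<alpha>. if \<alpha> \<in> J then \<Sum>i<n. (a * c i + b * e i) * real (lk \<alpha> i) else 0)"
    unfolding v w by (auto simp: fun_eq_iff sum_distrib_left sum.distrib[symmetric] algebra_simps)
  then show ?thesis unfolding W_space_def by (intro CollectI exI[of _ "\<lambda>i. a * c i + b * e i"])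
qed

text \<open>Everything is transported to the linear complement \<open>Z\<close> of \<open>W\<close> in \<open>V\<close> given by a linear projection
  \<open>g\<close> onto \<open>W\<close>: both quotients \<open>V / W\<close> and \<open>L\<^sub>J / R\<^sup>n\<close> are identified with subsets of \<open>Z\<close>.\<close>

locale normed_setting =
  fixes n d :: nat and J :: "expo set" and N :: "(expo \<Rightarrow> real) set \<Rightarrow> real" and g :: "(expo \<Rightarrow> real) \<Rightarrow> (expo \<Rightarrow> real)"
  assumes J: "J \<subseteq> simplex_pts n d" and MJ: "M_convex J" and N: "VW_norm n d J N"
    and gW: "\<And>x. g x \<in> W_space n J" and gid: "\<And>x. x \<in> W_space n J \<Longrightarrow> g x = x"
    and glin: "\<And>a b x y. g (\<lambda>i. a * x i + b * y i) = (\<lambda>i. a * g x i + b * g y i)"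
begin

abbreviation "V \<equiv> log_set weak_infty n d J"
abbreviation "S \<equiv> log_set lor n d J"
abbreviation "D \<equiv> log_set weak_zero n d J"
abbreviation "W \<equiv> W_space n J"
abbreviation "cls \<equiv> VW_class n d J"

text \<open>The projection along \<open>W\<close>. The coefficients are written out so that the
  linearity law of \<open>g\<close> applies literally.\<close>

definition P :: "(expo \<Rightarrow> real) \<Rightarrow> expo \<Rightarrow> real" where
  "P v = (\<lambda>\<alpha>. 1 * v \<alpha> + (-1) * g v \<alpha>)"

definition Z :: "(expo \<Rightarrow> real) set" where
  "Z = {v \<in> V. g v = (\<lambda>_. 0)}"

definition M :: "(expo \<Rightarrow> real) \<Rightarrow> real" where
  "M v = N (cls v)"

lemma finite_J: "finite J"
  using J finite_simplex_pts finite_subset by blast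

lemma WV: "W \<subseteq> V" by (rule W_space_subset[OF MJ])
lemma SV: "S \<subseteq> V" by (rule log_set_lor_subset)
lemma V_lin: "v \<in> V \<Longrightarrow> w \<in> V \<Longrightarrow> (\<lambda>\<alpha>. a * v \<alpha> + b * w \<alpha>) \<in> V"
  by (rule log_set_infty_lincomb[OF MJ])
lemma V_supp: "v \<in> V \<Longrightarrow> \<alpha> \<notin> J \<Longrightarrow> v \<alpha> = 0"
  unfolding log_set_def supported_def by blast
lemma zero_V: "(\<lambda>_. 0) \<in> V" using WV W_space_zero by blast

lemma VW_rel_iff: "(v, w) \<in> VW_rel n d J \<longleftrightarrow> v \<in> V \<and> w \<in> V \<and> (\<lambda>\<alpha>. v \<alpha> - w \<alpha>) \<in> W"
  unfolding VW_rel_def V_space_eq[OF J MJ] by simp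

text \<open>\<open>W\<close> is the kernel of \<open>P\<close>, so cosets are fibres of
  \<open>P\<close>.\<close>

lemma W_diff_iff: "(\<lambda>\<alpha>. v \<alpha> - w \<alpha>) \<in> W \<longleftrightarrow> P v = P w"
proof
  assume "(\<lambda>\<alpha>. v \<alpha> - w \<alpha>) \<in> W"
  then have "g (\<lambda>\<alpha>. 1 * v \<alpha> + (-1) * w \<alpha>) = (\<lambda>\<alpha>. v \<alpha> - w \<alpha>)" using gid by simp
  then have "(\<lambda>\<alpha>. 1 * g v \<alpha> + (-1) * g w \<alpha>) = (\<lambda>\<alpha>. v \<alpha> - w \<alpha>)" unfolding glin .
  then have "1 * g v \<alpha> + (-1) * g w \<alpha> = v \<alpha> - w \<alpha>" for \<alpha> by (rule fun_cong)
  then show "P v = P w" unfolding P_def by (auto simp: fun_eq_iff algebra_simps)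
next
  assume "P v = P w"
  then have "P v \<alpha> = P w \<alpha>" for \<alpha> by simp
  then have "v \<alpha> - w \<alpha> = 1 * g v \<alpha> + (-1) * g w \<alpha>" for \<alpha> unfolding P_def by (simp add: algebra_simps)
  then show "(\<lambda>\<alpha>. v \<alpha> - w \<alpha>) \<in> W" using W_space_lincomb[OF gW gW, of 1 v "-1" w] by simp
qed

lemma P_V: "v \<in> V \<Longrightarrow> P v \<in> Z"
proof -
  assume v: "v \<in> V"
  have "g (P v) = (\<lambda>\<alpha>. 1 * g v \<alpha> + (-1) * g (g v) \<alpha>)" unfolding P_def by (rule glin)
  then have "g (P v) = (\<lambda>_. 0)" using gid[OF gW] by simp
  moreover have "P v \<in> V" unfolding P_def using v gW WV by (intro V_lin) auto
  ultimately show ?thesis unfolding Z_def by blast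
qed

lemma P_Z: "z \<in> Z \<Longrightarrow> P z = z"
  unfolding P_def Z_def by simp

lemma Z_V: "Z \<subseteq> V" unfolding Z_def by blast

lemma S_add_W: "v \<in> S \<Longrightarrow> w \<in> W \<Longrightarrow> (\<lambda>\<alpha>. v \<alpha> + w \<alpha>) \<in> S"
  using log_set_lor_contract[of v n d J w 1 0] by simp

lemma P_S: "v \<in> S \<Longrightarrow> P v \<in> S"
proof -
  assume v: "v \<in> S"
  have "(\<lambda>\<alpha>. 0 * g v \<alpha> + (-1) * g v \<alpha>) \<in> W" by (rule W_space_lincomb[OF gW gW])
  from S_add_W[OF v this] show ?thesis unfolding P_def by simp
qed

lemma cls_eq_iff: "v \<in> V \<Longrightarrow> w \<in> V \<Longrightarrow> cls v = cls w \<longleftrightarrow> (\<lambda>\<alpha>. v \<alpha> - w \<alpha>) \<in> W"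
proof -
  assume v: "v \<in> V" and w: "w \<in> V"
  have c: "cls x = {y \<in> V. P x = P y}" if "x \<in> V" for x
    using that by (auto simp: VW_rel_iff W_diff_iff)
  show ?thesis unfolding W_diff_iff c[OF v] c[OF w]
  proof
    assume e: "{y \<in> V. P v = P y} = {y \<in> V. P w = P y}"
    have "v \<in> {y \<in> V. P v = P y}" using v by simp
    then have "v \<in> {y \<in> V. P w = P y}" unfolding e .
    then show "P v = P w" by simp
  qed simp
qed

lemma M_nonneg: "v \<in> V \<Longrightarrow> 0 \<le> M v"
  and M_scale: "v \<in> V \<Longrightarrow> M (\<lambda>\<alpha>. a * v \<alpha>) = \<bar>a\<bar> * M v"
  and M_tri: "v \<in> V \<Longrightarrow> w \<in> V \<Longrightarrow> M (\<lambda>\<alpha>. v \<alpha> + w \<alpha>) \<le> M v + M w"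
  using N unfolding VW_norm_def V_space_eq[OF J MJ] M_def by blast+

lemma M_eq_0: "v \<in> V \<Longrightarrow> M v = 0 \<Longrightarrow> v \<in> W"
proof -
  assume v: "v \<in> V" and "M v = 0"
  then have "cls v = cls (\<lambda>_. 0)" using N unfolding VW_norm_def V_space_eq[OF J MJ] M_def by blast
  then have "(\<lambda>\<alpha>. v \<alpha> - 0) \<in> W" using cls_eq_iff[OF v zero_V] by blast
  then show ?thesis by simp
qed

lemma continuous_M: "continuous_on V M"
proof (rule continuous_on_seminorm[where A = J])
  show "x \<in> V \<Longrightarrow> i \<notin> J \<Longrightarrow> x i = 0" for x i by (rule V_supp)
  show "x \<in> V \<Longrightarrow> y \<in> V \<Longrightarrow> (\<lambda>i. a * x i + b * y i) \<in> V" for x y a b by (rule V_lin)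
  show "x \<in> V \<Longrightarrow> M (\<lambda>i. a * x i) = \<bar>a\<bar> * M x" for x a by (rule M_scale)
  show "x \<in> V \<Longrightarrow> y \<in> V \<Longrightarrow> M (\<lambda>i. x i + y i) \<le> M x + M y" for x y by (rule M_tri)
qed (fact finite_J zero_V)+

lemma continuous_g: "continuous_on V (\<lambda>v. g v \<alpha>)"
proof -
  have "continuous_on UNIV (\<lambda>v. \<Sum>b\<in>J. v b * g (unit_fun b) \<alpha>)"
    by (intro continuous_on_sum continuous_on_mult continuous_on_const continuous_on_product_coordinates)
  then have "continuous_on V (\<lambda>v. \<Sum>b\<in>J. v b * g (unit_fun b) \<alpha>)" by (rule continuous_on_subset) simp
  moreover have "(\<Sum>b\<in>J. v b * g (unit_fun b) \<alpha>) = g v \<alpha>" if "v \<in> V" for v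
    by (rule linear_expansion[OF glin finite_J V_supp[OF that], symmetric])
  ultimately show ?thesis by (simp cong: continuous_on_cong)
qed

lemma continuous_P: "continuous_on V P"
  unfolding P_def
  by (rule continuous_on_coordinatewise_then_product)
     (intro continuous_on_add continuous_on_mult continuous_on_const continuous_g
        continuous_on_subset[OF continuous_on_product_coordinates subset_UNIV])

lemma closed_Z: "closed Z"
proof -
  have cV: "closed V" by (rule closed_log_set_infty[OF MJ])
  have "closed {v \<in> V. g v \<alpha> = 0}" for \<alpha>
    using continuous_closed_preimage[OF continuous_g cV closed_singleton[of 0]] by (simp add: vimage_def Int_def conj_commute)
  then have "closed (V \<inter> (\<Inter>\<alpha>. {v \<in> V. g v \<alpha> = 0}))" using cV by blast
  moreover have "V \<inter> (\<Inter>\<alpha>. {v \<in> V. g v \<alpha> = 0}) = Z" unfolding Z_def by (auto simp: fun_eq_iff)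
  ultimately show ?thesis by simp
qed

lemma Z_lin: "z \<in> Z \<Longrightarrow> w \<in> Z \<Longrightarrow> (\<lambda>\<alpha>. a * z \<alpha> + b * w \<alpha>) \<in> Z"
  unfolding Z_def using V_lin glin by simp

definition w0 :: "expo \<Rightarrow> real" where
  "w0 = (\<lambda>\<alpha>. 0 * g (quad_center n J) \<alpha> + (-1) * g (quad_center n J) \<alpha>)"

text \<open>The star centre projected into the complement \<open>Z\<close>; it changes only by an
  element of \<open>W\<close>, under which the Lorentzian set is invariant.\<close>

definition u :: "expo \<Rightarrow> real" where
  "u = (\<lambda>\<alpha>. quad_center n J \<alpha> + w0 \<alpha>)"

lemma w0: "w0 \<in> W" unfolding w0_def by (rule W_space_lincomb[OF gW gW])

lemma quad_S: "quad_center n J \<in> S"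
proof -
  have "(\<lambda>_. 0) \<in> S" using zero_in_log_set[OF MJ] log_set_weak_zero_subset by blast
  from log_set_lor_contract[OF this W_space_zero, of 1 1] show ?thesis by simp
qed

lemma u_S: "u \<in> S"
  unfolding u_def using S_add_W[OF quad_S w0] .

lemma u_Z: "u \<in> Z"
proof -
  have "u = P (quad_center n J)" unfolding u_def w0_def P_def by simp
  then show ?thesis using P_V quad_S SV by auto
qed

lemma recession_iff: "z \<in> V \<Longrightarrow> z \<in> D \<longleftrightarrow> (\<forall>t\<ge>0. (\<lambda>\<alpha>. u \<alpha> + t * z \<alpha>) \<in> S)"
proof -
  assume "z \<in> V"
  then have "z \<in> supported J" unfolding log_set_def by blast
  moreover have "(\<lambda>\<alpha>. u \<alpha> + t * z \<alpha>) = (\<lambda>\<beta>. t * z \<beta> + 1 * quad_center n J \<beta> + w0 \<beta>)" for t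
    unfolding u_def by (simp add: ac_simps)
  ultimately show ?thesis using log_set_weak_zero_iff_recession[OF MJ w0, of 1 z] by simp
qed

text \<open>Recession directions inherit the invariance under \<open>W\<close> of the set they
  belong to: along the ray the two directions differ by multiples of one element of
  \<open>W\<close>.\<close>

lemma D_W_invariant:
  assumes v: "v \<in> D" and z: "z \<in> V" and w: "(\<lambda>\<alpha>. z \<alpha> - v \<alpha>) \<in> W"
  shows "z \<in> D"
proof -
  have "v \<in> V" using v log_set_weak_zero_subset SV by blast
  then have r: "(\<lambda>\<alpha>. u \<alpha> + t * v \<alpha>) \<in> S" if "0 \<le> t" for t using recession_iff v that by blast
  have "(\<lambda>\<alpha>. u \<alpha> + t * z \<alpha>) \<in> S" if t: "0 \<le> t" for t
  proof -
    have "(\<lambda>\<alpha>. t * (z \<alpha> - v \<alpha>)) \<in> W" using W_space_lincomb[OF w w, of t 0] by simp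
    from S_add_W[OF r[OF t] this] show ?thesis by (simp add: algebra_simps)
  qed
  then show ?thesis using recession_iff[OF z] by blast
qed

sublocale star: strict_star J Z "S \<inter> Z" u M
proof
  show "finite J" by (rule finite_J)
  show "z \<alpha> = 0" if "z \<in> Z" "\<alpha> \<notin> J" for z \<alpha> using that V_supp Z_V by blast
  show "(\<lambda>i. a * z i + b * w i) \<in> Z" if "z \<in> Z" "w \<in> Z" for z w a b using Z_lin[OF that] .
  show "closed Z" by (rule closed_Z)
  show "S \<inter> Z \<subseteq> Z" by blast
  show "closed (S \<inter> Z)" by (intro closed_Int closed_Z closed_log_set_lor)
  show "u \<in> S \<inter> Z" using u_S u_Z by blast
  show "continuous_on Z M" by (rule continuous_on_subset[OF continuous_M Z_V])
  show "0 \<le> M z" if "z \<in> Z" for z using that M_nonneg Z_V by blast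
  show "z = (\<lambda>_. 0)" if "z \<in> Z" "M z = 0" for z
  proof -
    have "z \<in> W" using that M_eq_0 Z_V by blast
    then show ?thesis using gid that(1) unfolding Z_def by auto
  qed
  show "M (\<lambda>i. a * z i) = \<bar>a\<bar> * M z" if "z \<in> Z" for z a using that M_scale Z_V by blast
  show "\<exists>T. open T \<and> (\<lambda>i. p * v i + (1 - p) * u i) \<in> T \<and> T \<inter> Z \<subseteq> S \<inter> Z"
    if v: "v \<in> S \<inter> Z" and p: "0 < p" "p < 1" for v p
  proof -
    \<comment> \<open>The correction carried by \<open>u\<close> is scaled along with the centre,
      and \<open>s = 1 - p\<close> turns the interior statement into one about the segment from
      \<open>u\<close> to \<open>v\<close>.\<close>
    have w: "(\<lambda>\<alpha>. (1 - p) * w0 \<alpha>) \<in> W" using W_space_lincomb[OF w0 w0, of "1 - p" 0] by simp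
    have "v \<in> S" "0 < 1 - p" using v p by auto
    from log_set_lor_interior[OF this(1) w p this(2)]
    obtain T where T: "open T" "(\<lambda>\<beta>. p * v \<beta> + (1 - p) * quad_center n J \<beta> + (1 - p) * w0 \<beta>) \<in> T" "T \<inter> V \<subseteq> S"
      by blast
    have "(\<lambda>\<beta>. p * v \<beta> + (1 - p) * quad_center n J \<beta> + (1 - p) * w0 \<beta>) = (\<lambda>i. p * v i + (1 - p) * u i)"
      unfolding u_def by (simp add: algebra_simps)
    then show ?thesis using T Z_V by auto
  qed
qed

lemma X_eq: "star.X = {z \<in> Z. M z \<le> 1 \<and> \<not> (M z = 1 \<and> z \<in> D)}"
proof -
  have "gauge (S \<inter> Z) u z = 0 \<longleftrightarrow> z \<in> D" if z: "z \<in> Z" for z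
  proof -
    have "(\<lambda>\<alpha>. u \<alpha> + t * z \<alpha>) \<in> Z" for t using Z_lin[OF u_Z z, of 1 t] by simp
    then show ?thesis using star.gauge_eq_0_iff[OF z] recession_iff[of z] z Z_V by auto
  qed
  then show ?thesis unfolding star.X_def by auto
qed

section \<open>Transport between the quotients and the complement\<close>

lemma VW_homeomorphic:
  "homeomorphic_maps (top_of_set Z) (VW_top n d J) cls (\<lambda>C. P (SOME v. v \<in> C))"
  unfolding VW_top_def V_space_eq[OF J MJ]
proof (rule quotient_topology_homeomorphic)
  show "continuous_map (top_of_set V) (top_of_set Z) P"
    using continuous_P P_V by (auto simp: continuous_map_in_subtopology)
  show "continuous_map (top_of_set Z) (top_of_set V) (\<lambda>z. z)"
    using Z_V by (auto simp: continuous_map_in_subtopology continuous_on_id)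
  show "P z = z" if "z \<in> topspace (top_of_set Z)" for z using that P_Z by simp
  show "(v, w) \<in> VW_rel n d J \<longleftrightarrow> v \<in> topspace (top_of_set V) \<and> w \<in> topspace (top_of_set V) \<and> P v = P w" for v w
    by (simp add: VW_rel_iff W_diff_iff)
qed

lemma lorentzian_homeomorphic:
  "homeomorphic_maps (top_of_set (S \<inter> Z)) (reduced_lorentzian n d J)
    (\<lambda>v. rescale_rel n d J `` {poly_of_log n J v}) (\<lambda>C. P (log_weight n J (SOME f. f \<in> C)))"
  unfolding reduced_lorentzian_def
proof (rule quotient_topology_homeomorphic)
  note top = topspace_lorentzian_top[of n d J] and mem = lorentzian_set_iff[OF J MJ]
  have "continuous_map (lorentzian_top n d J) (top_of_set V) (log_weight n J)"
    using continuous_map_log_weight[OF J MJ] SV by (auto simp: continuous_map_in_subtopology top mem)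
  moreover have "continuous_map (top_of_set V) euclidean P" using continuous_P by simp
  ultimately have "continuous_map (lorentzian_top n d J) euclidean (P \<circ> log_weight n J)"
    by (rule continuous_map_compose)
  then show "continuous_map (lorentzian_top n d J) (top_of_set (S \<inter> Z)) (\<lambda>f. P (log_weight n J f))"
    using P_S P_V SV by (auto simp: continuous_map_in_subtopology top mem comp_def)
  have "continuous_map (subtopology (top_of_set S) Z) (lorentzian_top n d J) (poly_of_log n J)"
    by (rule continuous_map_from_subtopology[OF continuous_map_poly_of_log[OF J MJ]])
  then show "continuous_map (top_of_set (S \<inter> Z)) (lorentzian_top n d J) (poly_of_log n J)"
    by (simp add: subtopology_subtopology)
  show "P (log_weight n J (poly_of_log n J v)) = v" if "v \<in> topspace (top_of_set (S \<inter> Z))" for v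
  proof -
    have "v \<in> supported J" using that unfolding log_set_def by auto
    then show ?thesis using poly_of_log_props(3)[OF finite_J] P_Z that by simp
  qed
  show "(f, f') \<in> rescale_rel n d J \<longleftrightarrow> f \<in> topspace (lorentzian_top n d J) \<and> f' \<in> topspace (lorentzian_top n d J) \<and>
      P (log_weight n J f) = P (log_weight n J f')" for f f'
    unfolding rescale_rel_iff[OF J MJ] top W_diff_iff by auto
qed

text \<open>The frontier is the one in the quotient, hence relative to \<open>Z\<close>. A point of
  norm 1 is not interior because arbitrarily small outward multiples of it leave the ball.\<close>

lemma frontier_ball: "top_of_set Z frontier_of {z \<in> Z. M z \<le> 1} = {z \<in> Z. M z = 1}"
proof -
  have cl: "closedin (top_of_set Z) {z \<in> Z. M z \<le> 1}"
    using continuous_closedin_preimage[OF star.contM, of "{..1}"] by (simp add: vimage_def Int_def)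
  have op: "openin (top_of_set Z) {z \<in> Z. M z < 1}"
    using continuous_openin_preimage_gen[OF star.contM, of "{..<1}"] by (simp add: vimage_def Int_def)
  have int: "top_of_set Z interior_of {z \<in> Z. M z \<le> 1} = {z \<in> Z. M z < 1}"
  proof (rule interior_of_unique[OF _ op])
    fix T assume T: "T \<subseteq> {z \<in> Z. M z \<le> 1}" "openin (top_of_set Z) T"
    obtain O' where O': "open O'" "T = Z \<inter> O'" using T(2) by (auto simp: openin_open)
    show "T \<subseteq> {z \<in> Z. M z < 1}"
    proof
      fix z assume z: "z \<in> T"
      then have zZ: "z \<in> Z" and le: "M z \<le> 1" using T(1) by auto
      have "M z \<noteq> 1"
      proof
        assume one: "M z = 1"
        have "continuous_on UNIV (\<lambda>t :: real. \<lambda>\<alpha>. t * z \<alpha>)"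
          by (rule continuous_on_coordinatewise_then_product) (intro continuous_intros)
        then have "open ((\<lambda>t. \<lambda>\<alpha>. t * z \<alpha>) -` O')" by (rule open_vimage[OF O'(1)])
        moreover have "1 \<in> (\<lambda>t. \<lambda>\<alpha>. t * z \<alpha>) -` O'" using z O'(2) by simp
        ultimately obtain e where e: "e > 0" "ball 1 e \<subseteq> (\<lambda>t. \<lambda>\<alpha>. t * z \<alpha>) -` O'"
          using open_contains_ball by blast
        have "1 + e / 2 \<in> ball 1 e" using e(1) by (simp add: dist_real_def)
        then have "1 + e / 2 \<in> (\<lambda>t. \<lambda>\<alpha>. t * z \<alpha>) -` O'" by (rule subsetD[OF e(2)])
        then have "(\<lambda>\<alpha>. (1 + e / 2) * z \<alpha>) \<in> T" using O'(2) star.scale_Z[OF zZ] by simp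
        then have "M (\<lambda>\<alpha>. (1 + e / 2) * z \<alpha>) \<le> 1" using T(1) by blast
        then show False using star.M_scale[OF zZ, of "1 + e / 2"] one e(1) by simp
      qed
      then show "z \<in> {z \<in> Z. M z < 1}" using zZ le by simp
    qed
  qed auto
  show ?thesis unfolding frontier_of_def closure_of_closedin[OF cl] int by auto
qed

lemma ball_eq: "closed_unit_ball n d J N = cls ` {z \<in> Z. M z \<le> 1}"
proof -
  have "C \<in> V // VW_rel n d J \<longleftrightarrow> C \<in> cls ` Z" for C
  proof
    assume "C \<in> V // VW_rel n d J"
    then obtain v where v: "v \<in> V" "C = cls v" by (auto elim!: quotientE)
    then have "cls v = cls (P v)" using cls_eq_iff[OF v(1), of "P v"] P_V Z_V P_Z[OF P_V[OF v(1)]]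
      by (auto simp: W_diff_iff)
    then show "C \<in> cls ` Z" using v P_V by blast
  next
    assume "C \<in> cls ` Z"
    then show "C \<in> V // VW_rel n d J" using Z_V by (auto intro: quotientI)
  qed
  then show ?thesis unfolding closed_unit_ball_def V_space_eq[OF J MJ] M_def by auto
qed

text \<open>The tropical set is a union of cosets within V, so membership of a class can be tested
  on its representative in \<open>Z\<close>.\<close>

lemma reduced_dressian_iff: "z \<in> Z \<Longrightarrow> cls z \<in> reduced_dressian n d J \<longleftrightarrow> z \<in> D"
proof -
  assume z: "z \<in> Z"
  have zV: "z \<in> V" by (rule subsetD[OF Z_V z])
  have "reduced_dressian n d J = cls ` D"
    unfolding reduced_dressian_def strong_rep_zero_eq[OF J MJ, symmetric] by (simp add: image_image)
  moreover have "z \<in> D" if v: "v \<in> D" and eq: "cls z = cls v" for v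
  proof -
    have "v \<in> V" using v log_set_weak_zero_subset SV by blast
    then have "(\<lambda>\<alpha>. z \<alpha> - v \<alpha>) \<in> W" using cls_eq_iff[OF zV] eq by blast
    then show ?thesis by (rule D_W_invariant[OF v zV])
  qed
  ultimately show ?thesis by blast
qed

text \<open>Injectivity of the class map on \<open>Z\<close> lets set differences and intersections
  be computed upstairs, and a homeomorphism preserves frontiers; the ball without its Dressian
  boundary thus becomes \<open>star.X\<close>.\<close>

lemma reduced_lorentzian_homeomorphic:
  assumes B: "B = closed_unit_ball n d J N"
    and X: "X = B - (reduced_dressian n d J \<inter> (VW_top n d J frontier_of B))"
  shows "reduced_lorentzian n d J homeomorphic_space subtopology (VW_top n d J) X"
proof -
  have inj: "inj_on cls Z"
  proof (rule inj_onI)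
    fix z z' assume z: "z \<in> Z" "z' \<in> Z" and "cls z = cls z'"
    then have "P z = P z'" using cls_eq_iff[of z z'] Z_V W_diff_iff by blast
    then show "z = z'" using z P_Z by simp
  qed
  have hm: "homeomorphic_map (top_of_set Z) (VW_top n d J) cls"
    by (rule homeomorphic_maps_imp_map[OF VW_homeomorphic])
  have "VW_top n d J frontier_of B = cls ` {z \<in> Z. M z = 1}"
    unfolding B ball_eq frontier_ball[symmetric] by (rule homeomorphic_map_frontier_of[OF hm]) auto
  then have "X = cls ` {z \<in> Z. M z \<le> 1} - (reduced_dressian n d J \<inter> cls ` {z \<in> Z. M z = 1})"
    unfolding X B ball_eq by simp
  also have "reduced_dressian n d J \<inter> cls ` {z \<in> Z. M z = 1} = cls ` {z \<in> Z. M z = 1 \<and> z \<in> D}"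
    using reduced_dressian_iff by blast
  also have "cls ` {z \<in> Z. M z \<le> 1} - cls ` {z \<in> Z. M z = 1 \<and> z \<in> D} = cls ` ({z \<in> Z. M z \<le> 1} - {z \<in> Z. M z = 1 \<and> z \<in> D})"
    by (rule inj_on_image_set_diff[OF inj, symmetric]) blast+
  also have "{z \<in> Z. M z \<le> 1} - {z \<in> Z. M z = 1 \<and> z \<in> D} = star.X"
    unfolding X_eq by blast
  finally have X: "X = cls ` star.X" .
  have XZ: "star.X \<subseteq> Z" unfolding star.X_def by blast
  have top: "topspace (VW_top n d J) = cls ` Z"
    using homeomorphic_imp_surjective_map[OF hm] by simp
  have "homeomorphic_maps (subtopology (top_of_set Z) star.X) (subtopology (VW_top n d J) X) cls (\<lambda>C. P (SOME v. v \<in> C))"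
    by (rule homeomorphic_maps_subtopologies[OF VW_homeomorphic]) (use XZ in \<open>auto simp: top X\<close>)
  then have "top_of_set star.X homeomorphic_space subtopology (VW_top n d J) X"
    using XZ unfolding homeomorphic_space_def by (auto simp: subtopology_subtopology Int_absorb1)
  moreover have "reduced_lorentzian n d J homeomorphic_space top_of_set (S \<inter> Z)"
    using lorentzian_homeomorphic homeomorphic_space_sym unfolding homeomorphic_space_def by blast
  moreover have "top_of_set (S \<inter> Z) homeomorphic_space top_of_set star.X" by (rule star.homeomorphic_K_X)
  ultimately show ?thesis by (metis homeomorphic_space_trans)
qed

end

theorem theorem4p22:
  fixes n d :: nat and J :: "(nat \<Rightarrow>\<^sub>0 nat) set"
    and N :: "((nat \<Rightarrow>\<^sub>0 nat) \<Rightarrow> real) set \<Rightarrow> real"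
    and B X :: "((nat \<Rightarrow>\<^sub>0 nat) \<Rightarrow> real) set set"
  assumes "J \<subseteq> simplex_pts n d"
    and "M_convex J"
    and "VW_norm n d J N"
    and "B = closed_unit_ball n d J N"
    and "X = B - (reduced_dressian n d J \<inter> (VW_top n d J frontier_of B))"
  shows "reduced_lorentzian n d J homeomorphic_space subtopology (VW_top n d J) X"
proof -
  from exists_linear_projection[of "W_space n J", OF W_space_zero W_space_lincomb]
  obtain g where g: "(\<forall>x. g x \<in> W_space n J) \<and> (\<forall>x. x \<in> W_space n J \<longrightarrow> g x = x) \<and>
    (\<forall>a b x y. g (\<lambda>i. a * x i + b * y i) = (\<lambda>i. a * g x i + b * g y i))" by blast
  interpret normed_setting n d J N g
    by (unfold_locales; (fact assms | rule conjunct1[OF g, rule_format] conjunct1[OF conjunct2[OF g], rule_format]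
      conjunct2[OF conjunct2[OF g], rule_format]; assumption?))
  show ?thesis by (rule reduced_lorentzian_homeomorphic[OF assms(4,5)])
qed

end
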